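(* Suppose that $X$ is a $\mathcal D$-measurable $D([0,1]^m)$-valued random variable ($m\ge1$), and let $\ell\ge1$. (i) The injective moment $\mathbb E[X^{\check\otimes\ell}]$ exists in Dunford sense if and only if $\sup_{t\in[0,1]^m}\mathbb E|X(t)|^\ell<\infty$. (ii) The injective moment $\mathbb E[X^{\check\otimes\ell}]$ exists in Pettis sense if and only if the family $\{|X(t)|^\ell:t\in[0,1]^m\}$ of random variables is uniformly integrable.
   Context: $D([0,1]^m)$ is the set of functions $f:[0,1]^m\to\mathbb R$ such that at every $t=(t_1,\dots,t_m)\in[0,1]^m$ the limit of $f(s)$ exists (as a finite real number) as $s\to t$ within each set $J_1\times\dots\times J_m$, where each $J_i$ is either $[t_i,1]$ or $[0,t_i)$ (the latter only if $t_i>0$). It is a Banach space with the norm $\|f\|=\sup_{t\in[0,1]^m}|f(t)|$. $\mathcal D$ is the $\sigma$-field on it generated by all point evaluations $f\mapsto f(t)$. A $\mathcal D$-measurable $D([0,1]^m)$-valued random variable is a map $X$ from a probability space $(\Omega,\mathcal F,\mathbb P)$ to $D([0,1]^m)$ such that $X(t)$ is a real random variable for each $t\in[0,1]^m$. For a Banach space $B$, $B^{\check\otimes\ell}$ denotes the $\ell$-fold injective (completed) tensor power of $B$, and $X^{\check\otimes\ell}$ denotes $X\otimes\dots\otimes X$ ($\ell$ factors) regarded as a function $\Omega\to B^{\check\otimes\ell}$. Here $B=D([0,1]^m)$. A function $F:\Omega\to E$ into a Banach space $E$ is Dunford integrable if $\langle\chi,F\rangle$ is measurable and integrable for every $\chi\in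 E^*$; its Dunford integral is the unique element $\int_\Omega F\,\mathrm d\mathbb P\in E^{**}$ with $\langle\int_\Omega F\,\mathrm d\mathbb P,\chi\rangle=\int_\Omega\langle\chi,F\rangle\,\mathrm d\mathbb P$ for all $\chi\in E^*$. $F$ is Pettis integrable if it is Dunford integrable and $\int_AF\,\mathrm d\mathbb P\in E$ for every measurable $A\subseteq\Omega$. The injective moment exists in Dunford (Pettis) sense if $X^{\check\otimes\ell}$ is Dunford (Pettis) integrable in $B^{\check\otimes\ell}$. *)

theory Defs
  imports "HOL-Probability.Probability"
begin

section \<open>The space $D([0,1]^m)$\<close>

text \<open>The dimension \<open>m\<close> is \<open>CARD('m)\<close> for an arbitrary finite (hence non-empty) index type \<open>'m\<close>.\<close>

definition unit_cube :: "(real ^ 'm) set" where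
  "unit_cube = {t. \<forall>i. 0 \<le> t $ i \<and> t $ i \<le> 1}"

text \<open>
  The filter \<^term>\<open>inf (nhds t) (principal Q)\<close> describes \<open>s \<rightarrow> t\<close> within \<open>Q\<close> with the value
  \<open>s = t\<close> allowed whenever \<open>t \<in> Q\<close>; the library's \<^term>\<open>at t within Q\<close> would exclude it.  As \<open>t\<close>
  belongs to the orthant all of whose sides are \<open>[t\<^sub>i, 1]\<close>, the limit there is \<open>f t\<close>; for
  \<open>m = 1\<close> this is right-continuity with left limits.
\<close>

definition is_cadlag :: "(real ^ 'm \<Rightarrow> real) \<Rightarrow> bool" where
  "is_cadlag f \<longleftrightarrow>
     (\<forall>t\<in>unit_cube. \<forall>J :: 'm \<Rightarrow> real set.
        (\<forall>i. J i = {t $ i..1} \<or> (0 < t $ i \<and> J i = {0..<t $ i})) \<longrightarrow>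
        (\<exists>L. (f \<longlongrightarrow> L) (inf (nhds t) (principal {s. \<forall>i. s $ i \<in> J i}))))"

lemma is_cadlagD:
  assumes "is_cadlag f" "t \<in> unit_cube"
    "\<And>i. J i = {t $ i..1} \<or> (0 < t $ i \<and> J i = {0..<t $ i})"
  shows "\<exists>L. (f \<longlongrightarrow> L) (inf (nhds t) (principal {s. \<forall>i. s $ i \<in> J i}))"
  using assms unfolding is_cadlag_def by blast

lemma is_cadlag_combine:
  assumes "is_cadlag f" "is_cadlag g"
    and h: "\<And>F a b. (f \<longlongrightarrow> a) F \<Longrightarrow> (g \<longlongrightarrow> b) F \<Longrightarrow> \<exists>L. (h \<longlongrightarrow> L) F"
  shows "is_cadlag h"
  unfolding is_cadlag_def
proof (intro ballI allI impI)
  fix t :: "real ^ 'a" and J :: "'a \<Rightarrow> real set"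
  assume t: "t \<in> unit_cube"
    and J: "\<forall>i. J i = {t $ i..1} \<or> (0 < t $ i \<and> J i = {0..<t $ i})"
  obtain a where a: "(f \<longlongrightarrow> a) (inf (nhds t) (principal {s. \<forall>i. s $ i \<in> J i}))"
    using is_cadlagD[OF assms(1) t, of J] J by blast
  obtain b where b: "(g \<longlongrightarrow> b) (inf (nhds t) (principal {s. \<forall>i. s $ i \<in> J i}))"
    using is_cadlagD[OF assms(2) t, of J] J by blast
  show "\<exists>L. (h \<longlongrightarrow> L) (inf (nhds t) (principal {s. \<forall>i. s $ i \<in> J i}))"
    by (rule h[OF a b])
qed

lemma is_cadlag_add: "is_cadlag f \<Longrightarrow> is_cadlag g \<Longrightarrow> is_cadlag (\<lambda>t. f t + g t)"
  by (rule is_cadlag_combine[of f g]) (blast intro: tendsto_add)+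

lemma is_cadlag_scale: "is_cadlag f \<Longrightarrow> is_cadlag (\<lambda>t. c * f t)"
  by (rule is_cadlag_combine[of f f]) (blast intro: tendsto_mult_left)+

lemma unit_cube_ne: "unit_cube \<noteq> {}"
proof -
  have "0 \<in> unit_cube" by (simp add: unit_cube_def)
  then show ?thesis by blast
qed

lemma compact_unit_cube: "compact (unit_cube :: (real ^ 'm) set)"
proof -
  have "unit_cube = cbox (0 :: real ^ 'm) 1"
    by (auto simp: unit_cube_def mem_box_cart)
  then show ?thesis by (metis compact_cbox)
qed

lemma is_cadlag_locally_bounded:
  fixes f :: "real ^ 'm \<Rightarrow> real"
  assumes f: "is_cadlag f" and t: "t \<in> unit_cube"
  shows "\<exists>K. \<forall>\<^sub>F s in nhds t. s \<in> unit_cube \<longrightarrow> \<bar>f s\<bar> \<le> K"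
proof -
  define J :: "'m set \<Rightarrow> 'm \<Rightarrow> real set"
    where "J = (\<lambda>S i. if i \<in> S \<and> 0 < t $ i then {0..<t $ i} else {t $ i..1})"
  have "\<exists>K\<ge>0. \<forall>\<^sub>F s in nhds t. (\<forall>i. s $ i \<in> J S i) \<longrightarrow> \<bar>f s\<bar> \<le> K" for S
  proof -
    have "J S i = {t $ i..1} \<or> (0 < t $ i \<and> J S i = {0..<t $ i})" for i
      by (auto simp: J_def)
    then obtain L where L: "(f \<longlongrightarrow> L) (inf (nhds t) (principal {s. \<forall>i. s $ i \<in> J S i}))"
      using is_cadlagD[OF f t, of "J S"] by blast
    have "\<forall>\<^sub>F s in inf (nhds t) (principal {s. \<forall>i. s $ i \<in> J S i}). dist (f s) L < 1"
      by (rule tendstoD[OF L]) simp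
    then have "\<forall>\<^sub>F s in nhds t. (\<forall>i. s $ i \<in> J S i) \<longrightarrow> \<bar>f s\<bar> \<le> \<bar>L\<bar> + 1"
      unfolding eventually_inf_principal
      by eventually_elim (auto simp: dist_real_def)
    then show ?thesis by (intro exI[of _ "\<bar>L\<bar> + 1"]) auto
  qed
  then have "\<exists>K. \<forall>S. K S \<ge> 0 \<and> (\<forall>\<^sub>F s in nhds t. (\<forall>i. s $ i \<in> J S i) \<longrightarrow> \<bar>f s\<bar> \<le> K S)"
    by (intro choice allI)
  then obtain K where K0: "\<And>S. K S \<ge> 0"
    and K: "\<And>S. \<forall>\<^sub>F s in nhds t. (\<forall>i. s $ i \<in> J S i) \<longrightarrow> \<bar>f s\<bar> \<le> K S"
    by blast
  have "\<forall>\<^sub>F s in nhds t. \<forall>S\<in>UNIV. (\<forall>i. s $ i \<in> J S i) \<longrightarrow> \<bar>f s\<bar> \<le> K S"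
    by (intro eventually_ball_finite ballI K finite)
  then have "\<forall>\<^sub>F s in nhds t. s \<in> unit_cube \<longrightarrow> \<bar>f s\<bar> \<le> (\<Sum>S\<in>UNIV. K S)"
  proof eventually_elim
    case (elim s)
    show ?case
    proof
      assume s: "s \<in> unit_cube"
      define S where "S = {i. s $ i < t $ i}"
      have "s $ i \<in> J S i" for i
        using s by (auto simp: J_def S_def unit_cube_def not_less intro: order_trans[of "t $ i" 0])
      then have "\<bar>f s\<bar> \<le> K S" using elim by blast
      also have "\<dots> \<le> (\<Sum>S\<in>UNIV. K S)"
        by (rule member_le_sum) (auto simp: K0)
      finally show "\<bar>f s\<bar> \<le> (\<Sum>S\<in>UNIV. K S)" .
    qed
  qed
  then show ?thesis by blast
qed

lemma is_cadlag_bounded: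
  fixes f :: "real ^ 'm \<Rightarrow> real"
  assumes f: "is_cadlag f"
  shows "\<exists>K. \<forall>t\<in>unit_cube. \<bar>f t\<bar> \<le> K"
proof -
  have "\<exists>K U. open U \<and> t \<in> U \<and> (\<forall>s\<in>U. s \<in> unit_cube \<longrightarrow> \<bar>f s\<bar> \<le> K)" if "t \<in> unit_cube" for t
    using is_cadlag_locally_bounded[OF f that] unfolding eventually_nhds by blast
  then obtain K U where U: "\<And>t. t \<in> unit_cube \<Longrightarrow> open (U t)" "\<And>t. t \<in> unit_cube \<Longrightarrow> t \<in> U t"
    and K: "\<And>t s. t \<in> unit_cube \<Longrightarrow> s \<in> U t \<Longrightarrow> s \<in> unit_cube \<Longrightarrow> \<bar>f s\<bar> \<le> K t"
    by metis
  obtain C where C: "C \<subseteq> unit_cube" "finite C" "unit_cube \<subseteq> (\<Union>t\<in>C. U t)"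
    using compactE_image[OF compact_unit_cube, of unit_cube U] U by blast
  have "\<bar>f s\<bar> \<le> Max (K ` C)" if s: "s \<in> unit_cube" for s
  proof -
    obtain t where t: "t \<in> C" "s \<in> U t" using C s by blast
    then have "\<bar>f s\<bar> \<le> K t" using K C s by blast
    also have "\<dots> \<le> Max (K ` C)" using t C by simp
    finally show ?thesis .
  qed
  then show ?thesis by blast
qed

text \<open>
  Functions on \<open>[0,1]^m\<close> are represented by their extensions by \<open>0\<close> to the whole of \<open>\<real>^m\<close>, so that
  equality in the type is equality on the cube.
\<close>

typedef (overloaded) 'm cadlag =
  "{f :: real ^ ('m::finite) \<Rightarrow> real. is_cadlag f \<and> (\<forall>t. t \<notin> unit_cube \<longrightarrow> f t = 0)}"
  morphisms cadlag_apply Cadlag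
  by (rule exI[of _ "\<lambda>_. 0"]) (auto simp: is_cadlag_def)

setup_lifting type_definition_cadlag

lemma cadlag_apply_is_cadlag: "is_cadlag (cadlag_apply f)"
  using cadlag_apply[of f] by simp

lemma cadlag_apply_outside: "t \<notin> unit_cube \<Longrightarrow> cadlag_apply f t = 0"
  using cadlag_apply[of f] by simp

lemma cadlag_eqI: "(\<And>t. t \<in> unit_cube \<Longrightarrow> cadlag_apply f t = cadlag_apply g t) \<Longrightarrow> f = g"
  using cadlag_apply_outside cadlag_apply_inject by (metis ext)

instantiation cadlag :: (finite) real_vector
begin

lift_definition zero_cadlag :: "'a cadlag" is "\<lambda>_. 0"
  by (auto simp: is_cadlag_def)

lift_definition plus_cadlag :: "'a cadlag \<Rightarrow> 'a cadlag \<Rightarrow> 'a cadlag" is "\<lambda>f g t. f t + g t"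
  by (simp add: is_cadlag_add)

lift_definition scaleR_cadlag :: "real \<Rightarrow> 'a cadlag \<Rightarrow> 'a cadlag" is "\<lambda>c f t. c * f t"
  by (simp add: is_cadlag_scale)

definition uminus_cadlag :: "'a cadlag \<Rightarrow> 'a cadlag" where
  "uminus_cadlag f = (-1) *\<^sub>R f"

definition minus_cadlag :: "'a cadlag \<Rightarrow> 'a cadlag \<Rightarrow> 'a cadlag" where
  "minus_cadlag f g = f + (-1) *\<^sub>R g"

lemma cadlag_apply_simps:
  "cadlag_apply 0 t = 0"
  "cadlag_apply (f + g) t = cadlag_apply f t + cadlag_apply g t"
  "cadlag_apply (c *\<^sub>R f) t = c * cadlag_apply f t"
  "cadlag_apply (- f) t = - cadlag_apply f t"
  "cadlag_apply (f - g) t = cadlag_apply f t - cadlag_apply g t"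
  by (simp_all add: zero_cadlag.rep_eq plus_cadlag.rep_eq scaleR_cadlag.rep_eq uminus_cadlag_def
      minus_cadlag_def)

instance
  by standard (auto intro!: cadlag_eqI simp: cadlag_apply_simps algebra_simps)

end

lemma cadlag_bdd_above: "bdd_above ((\<lambda>t. \<bar>cadlag_apply f t\<bar>) ` unit_cube)"
  using is_cadlag_bounded[OF cadlag_apply_is_cadlag[of f]] by (auto simp: bdd_above_def)

instantiation cadlag :: (finite) real_normed_vector
begin

definition norm_cadlag :: "'a cadlag \<Rightarrow> real" where
  "norm_cadlag f = (SUP t\<in>unit_cube. \<bar>cadlag_apply f t\<bar>)"

definition dist_cadlag :: "'a cadlag \<Rightarrow> 'a cadlag \<Rightarrow> real" where
  "dist_cadlag f g = norm (f - g)"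

definition sgn_cadlag :: "'a cadlag \<Rightarrow> 'a cadlag" where
  "sgn_cadlag f = f /\<^sub>R norm f"

definition uniformity_cadlag :: "('a cadlag \<times> 'a cadlag) filter" where
  "uniformity_cadlag = (INF e\<in>{0<..}. principal {(f, g). dist f g < e})"

definition open_cadlag :: "'a cadlag set \<Rightarrow> bool" where
  "open_cadlag S = (\<forall>f\<in>S. \<forall>\<^sub>F (f', g) in uniformity. f' = f \<longrightarrow> g \<in> S)"

lemma cadlag_apply_le_norm: "\<bar>cadlag_apply f t\<bar> \<le> norm f"
proof (cases "t \<in> unit_cube")
  case True
  then show ?thesis unfolding norm_cadlag_def by (rule cSUP_upper[OF _ cadlag_bdd_above])
next
  case False
  obtain s :: "real ^ 'a" where "s \<in> unit_cube" using unit_cube_ne by blast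
  then have "\<bar>cadlag_apply f s\<bar> \<le> norm f"
    unfolding norm_cadlag_def by (rule cSUP_upper[OF _ cadlag_bdd_above])
  then show ?thesis using False by (simp add: cadlag_apply_outside)
qed

lemma norm_cadlag_leI: "(\<And>t. t \<in> unit_cube \<Longrightarrow> \<bar>cadlag_apply f t\<bar> \<le> K) \<Longrightarrow> norm f \<le> K"
  unfolding norm_cadlag_def by (rule cSUP_least[OF unit_cube_ne])

instance
proof
  fix f g :: "'a cadlag" and c :: real
  show "norm f = 0 \<longleftrightarrow> f = 0"
  proof
    assume "norm f = 0"
    then show "f = 0"
      using cadlag_apply_le_norm[of f] by (intro cadlag_eqI) (simp add: cadlag_apply_simps)
  next
    assume "f = 0"
    then show "norm f = 0" by (simp add: norm_cadlag_def cadlag_apply_simps unit_cube_ne)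
  qed
  show "norm (f + g) \<le> norm f + norm g"
  proof (rule norm_cadlag_leI)
    fix t :: "real ^ 'a"
    show "\<bar>cadlag_apply (f + g) t\<bar> \<le> norm f + norm g"
      using cadlag_apply_le_norm[of f t] cadlag_apply_le_norm[of g t]
      by (simp add: cadlag_apply_simps)
  qed
  have le: "norm (c *\<^sub>R f) \<le> \<bar>c\<bar> * norm f" for c and f :: "'a cadlag"
    by (rule norm_cadlag_leI)
      (simp add: cadlag_apply_simps abs_mult mult_left_mono cadlag_apply_le_norm)
  show "norm (c *\<^sub>R f) = \<bar>c\<bar> * norm f"
  proof (cases "c = 0")
    case True
    then show ?thesis by (simp add: norm_cadlag_def cadlag_apply_simps unit_cube_ne)
  next
    case False
    have "norm f \<le> \<bar>inverse c\<bar> * norm (c *\<^sub>R f)"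
      using le[of "inverse c" "c *\<^sub>R f"] False by simp
    then have "\<bar>c\<bar> * norm f \<le> norm (c *\<^sub>R f)"
      using False by (simp add: field_simps)
    with le[of c f] show ?thesis by simp
  qed
qed (rule dist_cadlag_def sgn_cadlag_def uniformity_cadlag_def open_cadlag_def)+

end

instance cadlag :: (finite) banach
proof
  fix X :: "nat \<Rightarrow> 'a cadlag"
  assume X: "Cauchy X"
  have dist: "dist (cadlag_apply f t) (cadlag_apply g t) \<le> dist f g" for f g :: "'a cadlag" and t
    using cadlag_apply_le_norm[of "f - g" t] by (simp add: dist_norm cadlag_apply_simps)
  have "uniformly_Cauchy_on UNIV (\<lambda>n. cadlag_apply (X n))"
    using X dist unfolding uniformly_Cauchy_on_def Cauchy_def by (meson le_less_trans)
  then obtain h where h: "uniform_limit UNIV (\<lambda>n. cadlag_apply (X n)) h sequentially"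
    using Cauchy_uniformly_convergent unfolding uniformly_convergent_on_def by blast
  have pt: "(\<lambda>n. cadlag_apply (X n) t) \<longlonglongrightarrow> h t" for t
    using tendsto_uniform_limitI[OF h] by simp
  have "is_cadlag h"
    unfolding is_cadlag_def
  proof (intro ballI allI impI)
    fix t :: "real ^ 'a" and J :: "'a \<Rightarrow> real set"
    assume t: "t \<in> unit_cube"
      and J: "\<forall>i. J i = {t $ i..1} \<or> (0 < t $ i \<and> J i = {0..<t $ i})"
    define G where "G = inf (nhds t) (principal {s. \<forall>i. s $ i \<in> J i})"
    have "\<exists>L. (cadlag_apply (X n) \<longlongrightarrow> L) G" for n
      unfolding G_def using is_cadlagD[OF cadlag_apply_is_cadlag t] J by blast
    then obtain g where g: "\<And>n. (cadlag_apply (X n) \<longlongrightarrow> g n) G" by metis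
    show "\<exists>L. (h \<longlongrightarrow> L) (inf (nhds t) (principal {s. \<forall>i. s $ i \<in> J i}))"
    proof (cases "G = bot")
      case True
      then show ?thesis by (simp add: G_def)
    next
      case False
      have "dist (g m) (g n) \<le> dist (X m) (X n)" for m n
        by (rule tendsto_upperbound[OF tendsto_dist[OF g g] _ False]) (simp add: dist)
      then have "Cauchy g" using X unfolding Cauchy_def by (meson le_less_trans)
      then obtain l where "g \<longlonglongrightarrow> l" using real_Cauchy_convergent convergent_def by blast
      then have "(h \<longlongrightarrow> l) G"
        by (intro swap_uniform_limit'[OF _ _ h]) (auto simp: g)
      then show ?thesis unfolding G_def by blast
    qed
  qed
  moreover have "h t = 0" if "t \<notin> unit_cube" for t
    using LIMSEQ_unique[OF pt[of t]] that by (simp add: cadlag_apply_outside)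
  ultimately obtain H where H: "cadlag_apply H = h"
    using cadlag_apply_cases[of h] by auto
  have "X \<longlonglongrightarrow> H"
  proof (rule tendstoI)
    fix e :: real
    assume "e > 0"
    then have "\<forall>\<^sub>F n in sequentially. \<forall>t\<in>UNIV. dist (cadlag_apply (X n) t) (h t) < e / 2"
      by (intro uniform_limitD[OF h]) simp
    then show "\<forall>\<^sub>F n in sequentially. dist (X n) H < e"
    proof eventually_elim
      case (elim n)
      have "dist (X n) H \<le> e / 2"
        unfolding dist_norm
      proof (rule norm_cadlag_leI)
        fix t
        show "\<bar>cadlag_apply (X n - H) t\<bar> \<le> e / 2"
          using elim by (simp add: cadlag_apply_simps H dist_real_def less_imp_le)
      qed
      then show ?case using \<open>e > 0\<close> by simp
    qed
  qed
  then show "convergent X" by (rule convergentI)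
qed

definition evaluation_algebra :: "'m::finite cadlag measure" where
  "evaluation_algebra =
     sigma UNIV (\<Union>t\<in>unit_cube. {(\<lambda>f. cadlag_apply f t) -` B | B. B \<in> sets borel})"

lemma measurable_evaluation_algebra_iff:
  fixes X :: "'w \<Rightarrow> 'm::finite cadlag"
  shows "X \<in> M \<rightarrow>\<^sub>M evaluation_algebra \<longleftrightarrow>
     (\<forall>t\<in>unit_cube. (\<lambda>\<omega>. cadlag_apply (X \<omega>) t) \<in> borel_measurable M)"
proof
  assume X: "X \<in> M \<rightarrow>\<^sub>M evaluation_algebra"
  show "\<forall>t\<in>unit_cube. (\<lambda>\<omega>. cadlag_apply (X \<omega>) t) \<in> borel_measurable M"
  proof
    fix t :: "real ^ 'm"
    assume t: "t \<in> unit_cube"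
    have "(\<lambda>f. cadlag_apply f t) \<in> borel_measurable evaluation_algebra"
    proof (rule measurableI)
      fix B :: "real set"
      assume "B \<in> sets borel"
      then show "(\<lambda>f. cadlag_apply f t) -` B \<inter> space evaluation_algebra \<in> sets evaluation_algebra"
        using t by (auto simp: evaluation_algebra_def intro!: sigma_sets.Basic)
    qed simp
    then show "(\<lambda>\<omega>. cadlag_apply (X \<omega>) t) \<in> borel_measurable M"
      using measurable_compose[OF X] by blast
  qed
next
  assume *: "\<forall>t\<in>unit_cube. (\<lambda>\<omega>. cadlag_apply (X \<omega>) t) \<in> borel_measurable M"
  show "X \<in> M \<rightarrow>\<^sub>M evaluation_algebra"
    unfolding evaluation_algebra_def
  proof (rule measurable_measure_of)
    fix A :: "'m cadlag set"
    assume "A \<in> (\<Union>t\<in>unit_cube. {(\<lambda>f. cadlag_apply f t) -` B | B. B \<in> sets borel})"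
    then obtain t B where t: "t \<in> unit_cube" "B \<in> sets borel" "A = (\<lambda>f. cadlag_apply f t) -` B"
      by blast
    have "(\<lambda>\<omega>. cadlag_apply (X \<omega>) t) -` B \<inter> space M \<in> sets M"
      using * t by (auto intro: measurable_sets)
    then show "X -` A \<inter> space M \<in> sets M"
      using t by (simp add: vimage_def)
  qed auto
qed


section \<open>Bounded multilinear forms\<close>

text \<open>The number of arguments is \<open>CARD('l)\<close> for an arbitrary finite (hence non-empty) type \<open>'l\<close>.\<close>

definition multilinear :: "(('l \<Rightarrow> 'a::real_vector) \<Rightarrow> real) \<Rightarrow> bool" where
  "multilinear \<phi> \<longleftrightarrow> (\<forall>i x. linear (\<lambda>y. \<phi> (x(i := y))))"

lemma multilinear_scale:
  fixes \<phi> :: "('l::finite \<Rightarrow> 'a::real_vector) \<Rightarrow> real"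
  assumes "multilinear \<phi>"
  shows "\<phi> (\<lambda>i. c i *\<^sub>R x i) = (\<Prod>i\<in>UNIV. c i) * \<phi> x"
proof -
  have "\<phi> (\<lambda>i. if i \<in> S then c i *\<^sub>R x i else x i) = (\<Prod>i\<in>S. c i) * \<phi> x" if "finite S" for S
    using that
  proof induction
    case (insert j S)
    define z where "z = (\<lambda>i. if i \<in> S then c i *\<^sub>R x i else x i)"
    have lin: "linear (\<lambda>y. \<phi> (z(j := y)))" using assms by (simp add: multilinear_def)
    have "(\<lambda>i. if i \<in> insert j S then c i *\<^sub>R x i else x i) = z(j := c j *\<^sub>R x j)"
      by (auto simp: z_def)
    then have "\<phi> (\<lambda>i. if i \<in> insert j S then c i *\<^sub>R x i else x i) = c j * \<phi> (z(j := x j))"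
      using linear_scale[OF lin] by simp
    also have "z(j := x j) = z" using insert by (auto simp: z_def)
    finally show ?case using insert by (simp add: z_def)
  qed simp
  from this[of UNIV] show ?thesis by simp
qed

typedef (overloaded) ('a::real_normed_vector, 'l::finite) mform =
  "{\<phi> :: ('l \<Rightarrow> 'a) \<Rightarrow> real. multilinear \<phi> \<and> (\<exists>K. \<forall>x. \<bar>\<phi> x\<bar> \<le> K * (\<Prod>i\<in>UNIV. norm (x i)))}"
  morphisms mform_apply Mform
  by (rule exI[of _ "\<lambda>_. 0"]) (auto simp: multilinear_def linear_iff intro!: exI[of _ 0])

setup_lifting type_definition_mform

lemma mform_multilinear: "multilinear (mform_apply \<phi>)"
  using mform_apply[of \<phi>] by simp

lemma mform_eqI: "(\<And>x. mform_apply \<phi> x = mform_apply \<psi> x) \<Longrightarrow> \<phi> = \<psi>"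
  using mform_apply_inject by blast

instantiation mform :: (real_normed_vector, finite) real_vector
begin

lift_definition zero_mform :: "('a, 'b) mform" is "\<lambda>_. 0"
  by (auto simp: multilinear_def linear_iff intro!: exI[of _ 0])

lift_definition plus_mform :: "('a, 'b) mform \<Rightarrow> ('a, 'b) mform \<Rightarrow> ('a, 'b) mform"
  is "\<lambda>\<phi> \<psi> x. \<phi> x + \<psi> x"
proof safe
  fix \<phi> \<psi> :: "('b \<Rightarrow> 'a) \<Rightarrow> real" and K L
  assume *: "multilinear \<phi>" "multilinear \<psi>"
    "\<forall>x. \<bar>\<phi> x\<bar> \<le> K * (\<Prod>i\<in>UNIV. norm (x i))" "\<forall>x. \<bar>\<psi> x\<bar> \<le> L * (\<Prod>i\<in>UNIV. norm (x i))"
  then show "multilinear (\<lambda>x. \<phi> x + \<psi> x)"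
    by (auto simp: multilinear_def intro!: linear_compose_add)
  show "\<exists>K. \<forall>x. \<bar>\<phi> x + \<psi> x\<bar> \<le> K * (\<Prod>i\<in>UNIV. norm (x i))"
  proof (intro exI[of _ "K + L"] allI)
    fix x
    show "\<bar>\<phi> x + \<psi> x\<bar> \<le> (K + L) * (\<Prod>i\<in>UNIV. norm (x i))"
      using *(3)[rule_format, of x] *(4)[rule_format, of x] by (simp add: algebra_simps)
  qed
qed

lift_definition scaleR_mform :: "real \<Rightarrow> ('a, 'b) mform \<Rightarrow> ('a, 'b) mform"
  is "\<lambda>c \<phi> x. c * \<phi> x"
proof safe
  fix c and \<phi> :: "('b \<Rightarrow> 'a) \<Rightarrow> real" and K
  assume *: "multilinear \<phi>" "\<forall>x. \<bar>\<phi> x\<bar> \<le> K * (\<Prod>i\<in>UNIV. norm (x i))"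
  then show "multilinear (\<lambda>x. c * \<phi> x)"
    by (auto simp: multilinear_def linear_iff algebra_simps)
  show "\<exists>K. \<forall>x. \<bar>c * \<phi> x\<bar> \<le> K * (\<Prod>i\<in>UNIV. norm (x i))"
  proof (intro exI[of _ "\<bar>c\<bar> * K"] allI)
    fix x
    show "\<bar>c * \<phi> x\<bar> \<le> \<bar>c\<bar> * K * (\<Prod>i\<in>UNIV. norm (x i))"
      using mult_left_mono[OF *(2)[rule_format, of x], of "\<bar>c\<bar>"] by (simp add: abs_mult ac_simps)
  qed
qed

definition uminus_mform :: "('a, 'b) mform \<Rightarrow> ('a, 'b) mform" where
  "uminus_mform \<phi> = (-1) *\<^sub>R \<phi>"

definition minus_mform :: "('a, 'b) mform \<Rightarrow> ('a, 'b) mform \<Rightarrow> ('a, 'b) mform" where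
  "minus_mform \<phi> \<psi> = \<phi> + (-1) *\<^sub>R \<psi>"

lemma mform_apply_simps:
  "mform_apply 0 x = 0"
  "mform_apply (\<phi> + \<psi>) x = mform_apply \<phi> x + mform_apply \<psi> x"
  "mform_apply (c *\<^sub>R \<phi>) x = c * mform_apply \<phi> x"
  "mform_apply (- \<phi>) x = - mform_apply \<phi> x"
  "mform_apply (\<phi> - \<psi>) x = mform_apply \<phi> x - mform_apply \<psi> x"
  by (simp_all add: zero_mform.rep_eq plus_mform.rep_eq scaleR_mform.rep_eq uminus_mform_def
      minus_mform_def)

instance
  by standard (auto intro!: mform_eqI simp: mform_apply_simps algebra_simps)

end

lemma mform_bdd_above:
  fixes \<phi> :: "('a::real_normed_vector, 'l::finite) mform"
  shows "bdd_above ((\<lambda>x. \<bar>mform_apply \<phi> x\<bar>) ` {x. \<forall>i. norm (x i) \<le> 1})"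
proof -
  obtain K where K: "\<And>x. \<bar>mform_apply \<phi> x\<bar> \<le> K * (\<Prod>i\<in>UNIV. norm (x i))"
    using mform_apply[of \<phi>] by auto
  have "\<bar>mform_apply \<phi> x\<bar> \<le> \<bar>K\<bar>" if "\<forall>i. norm (x i) \<le> 1" for x
  proof -
    have "(\<Prod>i\<in>UNIV. norm (x i)) \<le> 1" using that by (intro prod_le_1) auto
    moreover have "0 \<le> (\<Prod>i\<in>UNIV. norm (x i))" by (intro prod_nonneg) auto
    ultimately have "\<bar>K\<bar> * (\<Prod>i\<in>UNIV. norm (x i)) \<le> \<bar>K\<bar>"
      by (intro mult_left_le) auto
    moreover have "K * (\<Prod>i\<in>UNIV. norm (x i)) \<le> \<bar>K\<bar> * (\<Prod>i\<in>UNIV. norm (x i))"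
      by (intro mult_right_mono prod_nonneg) auto
    ultimately show ?thesis using K[of x] by linarith
  qed
  then show ?thesis by (auto simp: bdd_above_def)
qed

instantiation mform :: (real_normed_vector, finite) real_normed_vector
begin

definition norm_mform :: "('a, 'b) mform \<Rightarrow> real" where
  "norm_mform \<phi> = (SUP x\<in>{x. \<forall>i. norm (x i) \<le> 1}. \<bar>mform_apply \<phi> x\<bar>)"

definition dist_mform :: "('a, 'b) mform \<Rightarrow> ('a, 'b) mform \<Rightarrow> real" where
  "dist_mform \<phi> \<psi> = norm (\<phi> - \<psi>)"

definition sgn_mform :: "('a, 'b) mform \<Rightarrow> ('a, 'b) mform" where
  "sgn_mform \<phi> = \<phi> /\<^sub>R norm \<phi>"

definition uniformity_mform :: "(('a, 'b) mform \<times> ('a, 'b) mform) filter" where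
  "uniformity_mform = (INF e\<in>{0<..}. principal {(\<phi>, \<psi>). dist \<phi> \<psi> < e})"

definition open_mform :: "('a, 'b) mform set \<Rightarrow> bool" where
  "open_mform S = (\<forall>\<phi>\<in>S. \<forall>\<^sub>F (\<phi>', \<psi>) in uniformity. \<phi>' = \<phi> \<longrightarrow> \<psi> \<in> S)"

lemma norm_mform_ge:
  fixes \<phi> :: "('a, 'b) mform"
  shows "(\<And>i. norm (x i) \<le> 1) \<Longrightarrow> \<bar>mform_apply \<phi> x\<bar> \<le> norm \<phi>"
  unfolding norm_mform_def by (rule cSUP_upper[OF _ mform_bdd_above]) simp

lemma norm_mform_leI:
  fixes \<phi> :: "('a, 'b) mform"
  shows "(\<And>x. (\<And>i. norm (x i) \<le> 1) \<Longrightarrow> \<bar>mform_apply \<phi> x\<bar> \<le> K) \<Longrightarrow> norm \<phi> \<le> K"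
  unfolding norm_mform_def by (rule cSUP_least) (auto intro!: exI[of _ "\<lambda>_. 0"])

lemma mform_apply_le:
  fixes \<phi> :: "('a, 'b) mform"
  shows "\<bar>mform_apply \<phi> x\<bar> \<le> norm \<phi> * (\<Prod>i\<in>UNIV. norm (x i))"
proof -
  have "norm (x i) *\<^sub>R sgn (x i) = x i" for i
    by (cases "x i = 0") (simp_all add: sgn_div_norm)
  then have "mform_apply \<phi> x = (\<Prod>i\<in>UNIV. norm (x i)) * mform_apply \<phi> (\<lambda>i. sgn (x i))"
    using multilinear_scale[OF mform_multilinear, of \<phi> "\<lambda>i. norm (x i)" "\<lambda>i. sgn (x i)"] by simp
  moreover have "\<bar>mform_apply \<phi> (\<lambda>i. sgn (x i))\<bar> \<le> norm \<phi>"
    by (rule norm_mform_ge) (simp add: norm_sgn)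
  ultimately show ?thesis
    by (simp add: abs_mult abs_prod mult.commute[of "norm \<phi>"] mult_left_mono prod_nonneg)
qed

instance
proof
  fix \<phi> \<psi> :: "('a, 'b) mform" and c :: real
  show "norm \<phi> = 0 \<longleftrightarrow> \<phi> = 0"
  proof
    assume "norm \<phi> = 0"
    then show "\<phi> = 0"
      using mform_apply_le[of \<phi>] by (intro mform_eqI) (simp add: mform_apply_simps)
  next
    assume "\<phi> = 0"
    then have "norm \<phi> \<le> 0" by (intro norm_mform_leI) (simp add: mform_apply_simps)
    moreover have "0 \<le> norm \<phi>" using norm_mform_ge[of "\<lambda>_. 0" \<phi>] by simp
    ultimately show "norm \<phi> = 0" by simp
  qed
  show "norm (\<phi> + \<psi>) \<le> norm \<phi> + norm \<psi>"
  proof (rule norm_mform_leI)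
    fix x :: "'b \<Rightarrow> 'a"
    assume "\<And>i. norm (x i) \<le> 1"
    then show "\<bar>mform_apply (\<phi> + \<psi>) x\<bar> \<le> norm \<phi> + norm \<psi>"
      using norm_mform_ge[of x \<phi>] norm_mform_ge[of x \<psi>] by (simp add: mform_apply_simps)
  qed
  have le: "norm (c *\<^sub>R \<phi>) \<le> \<bar>c\<bar> * norm \<phi>" for c and \<phi> :: "('a, 'b) mform"
    by (rule norm_mform_leI)
      (simp add: mform_apply_simps abs_mult mult_left_mono norm_mform_ge)
  show "norm (c *\<^sub>R \<phi>) = \<bar>c\<bar> * norm \<phi>"
  proof (cases "c = 0")
    case True
    have "0 \<le> norm (c *\<^sub>R \<phi>)" using norm_mform_ge[of "\<lambda>_. 0" "c *\<^sub>R \<phi>"] by simp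
    then show ?thesis using le[of c \<phi>] True by simp
  next
    case False
    have "norm \<phi> \<le> \<bar>inverse c\<bar> * norm (c *\<^sub>R \<phi>)"
      using le[of "inverse c" "c *\<^sub>R \<phi>"] False by simp
    then have "\<bar>c\<bar> * norm \<phi> \<le> norm (c *\<^sub>R \<phi>)"
      using False by (simp add: field_simps)
    with le[of c \<phi>] show ?thesis by simp
  qed
qed (rule dist_mform_def sgn_mform_def uniformity_mform_def open_mform_def)+

end

instance mform :: (real_normed_vector, finite) banach
proof
  fix X :: "nat \<Rightarrow> ('a, 'b) mform"
  assume X: "Cauchy X"
  have diff: "\<bar>mform_apply (X m) x - mform_apply (X n) x\<bar> \<le> dist (X m) (X n) * (\<Prod>i\<in>UNIV. norm (x i))"
    for m n x
    using mform_apply_le[of "X m - X n" x] by (simp add: dist_norm mform_apply_simps)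
  have "\<exists>L. (\<lambda>n. mform_apply (X n) x) \<longlonglongrightarrow> L" for x
  proof -
    define p where "p = (\<Prod>i\<in>UNIV. norm (x i))"
    have p: "p \<ge> 0" by (simp add: p_def prod_nonneg)
    have "Cauchy (\<lambda>n. mform_apply (X n) x)"
    proof (rule metric_CauchyI)
      fix e :: real
      assume e: "e > 0"
      then have "e / (p + 1) > 0" using p by simp
      then obtain N where N: "\<And>m n. m \<ge> N \<Longrightarrow> n \<ge> N \<Longrightarrow> dist (X m) (X n) < e / (p + 1)"
        using metric_CauchyD[OF X] by metis
      show "\<exists>N. \<forall>m\<ge>N. \<forall>n\<ge>N. dist (mform_apply (X m) x) (mform_apply (X n) x) < e"
      proof (intro exI allI impI)
        fix m n
        assume "N \<le> m" "N \<le> n"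
        have "dist (mform_apply (X m) x) (mform_apply (X n) x) \<le> dist (X m) (X n) * p"
          using diff by (simp add: dist_real_def p_def)
        also have "\<dots> \<le> e / (p + 1) * p"
          using N[OF \<open>N \<le> m\<close> \<open>N \<le> n\<close>] p by (intro mult_right_mono) auto
        also have "\<dots> < e" using p e by (simp add: field_simps)
        finally show "dist (mform_apply (X m) x) (mform_apply (X n) x) < e" .
      qed
    qed
    then show ?thesis using real_Cauchy_convergent convergent_def by blast
  qed
  then obtain h where h: "\<And>x. (\<lambda>n. mform_apply (X n) x) \<longlonglongrightarrow> h x" by metis
  have "multilinear h"
    unfolding multilinear_def linear_iff
  proof (intro allI conjI)
    fix i and x :: "'b \<Rightarrow> 'a" and y z and c :: real
    have lin: "linear (\<lambda>y. mform_apply (X n) (x(i := y)))" for n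
      using mform_multilinear[of "X n"] by (simp add: multilinear_def)
    show "h (x(i := y + z)) = h (x(i := y)) + h (x(i := z))"
      using tendsto_add[OF h[of "x(i := y)"] h[of "x(i := z)"]] h[of "x(i := y + z)"]
      by (simp add: linear_add[OF lin] LIMSEQ_unique)
    show "h (x(i := c *\<^sub>R y)) = c *\<^sub>R h (x(i := y))"
      using tendsto_mult_left[OF h[of "x(i := y)"], of c] h[of "x(i := c *\<^sub>R y)"]
      by (simp add: linear_scale[OF lin] LIMSEQ_unique)
  qed
  moreover obtain K where K: "\<And>n. norm (X n) \<le> K"
    using Cauchy_Bseq[OF X] by (auto simp: Bseq_def)
  have "\<bar>h x\<bar> \<le> K * (\<Prod>i\<in>UNIV. norm (x i))" for x
  proof (rule tendsto_upperbound[OF tendsto_rabs[OF h]])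
    have "\<bar>mform_apply (X n) x\<bar> \<le> K * (\<Prod>i\<in>UNIV. norm (x i))" for n
      using mform_apply_le[of "X n" x] K[of n]
      by (meson mult_right_mono order_trans norm_ge_zero prod_nonneg)
    then show "\<forall>\<^sub>F n in sequentially. \<bar>mform_apply (X n) x\<bar> \<le> K * (\<Prod>i\<in>UNIV. norm (x i))"
      by simp
  qed simp
  ultimately obtain H where H: "mform_apply H = h"
    using mform_apply_cases[of h] by blast
  have "X \<longlonglongrightarrow> H"
  proof (rule metric_LIMSEQ_I)
    fix e :: real
    assume e: "e > 0"
    then obtain N where N: "\<And>m n. m \<ge> N \<Longrightarrow> n \<ge> N \<Longrightarrow> dist (X m) (X n) < e / 2"
      using metric_CauchyD[OF X, of "e / 2"] by auto
    show "\<exists>N. \<forall>n\<ge>N. dist (X n) H < e"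
    proof (intro exI allI impI)
      fix n
      assume n: "N \<le> n"
      have "dist (X n) H \<le> e / 2"
        unfolding dist_norm
      proof (rule norm_mform_leI)
        fix x :: "'b \<Rightarrow> 'a"
        assume x: "\<And>i. norm (x i) \<le> 1"
        have "\<bar>mform_apply (X n) x - h x\<bar> \<le> e / 2"
        proof (rule tendsto_upperbound[OF tendsto_rabs[OF tendsto_diff[OF tendsto_const h]]])
          have "\<bar>mform_apply (X n) x - mform_apply (X m) x\<bar> \<le> e / 2" if "m \<ge> N" for m
            using norm_mform_ge[of x "X n - X m"] x N[OF n that]
            by (simp add: dist_norm mform_apply_simps)
          then show "\<forall>\<^sub>F m in sequentially. \<bar>mform_apply (X n) x - mform_apply (X m) x\<bar> \<le> e / 2"
            by (auto simp: eventually_sequentially)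
        qed simp
        then show "\<bar>mform_apply (X n - H) x\<bar> \<le> e / 2" by (simp add: mform_apply_simps H)
      qed
      then show "dist (X n) H < e" using e by simp
    qed
  qed
  then show "convergent X" by (rule convergentI)
qed


section \<open>Injective tensor powers\<close>

text \<open>
  The algebraic tensor power of \<open>B\<close> is realised in the usual way: \<open>x\<^sub>1 \<otimes> \<dots> \<otimes> x\<^sub>l\<close> is the form
  \<open>(\<xi>\<^sub>1, \<dots>, \<xi>\<^sub>l) \<mapsto> \<xi>\<^sub>1(x\<^sub>1) \<dots> \<xi>\<^sub>l(x\<^sub>l)\<close> on the dual \<open>B*\<close>, and the tensor power is the linear span of these
  forms (the canonical map of the algebraic tensor power into the forms on \<open>B*\<close> is injective,
  because \<open>B*\<close> separates points).  The norm of \<open>u = \<Sum>\<^sub>k c\<^sub>k x\<^sub>k\<^sub>1 \<otimes> \<dots> \<otimes> x\<^sub>k\<^sub>l\<close> as a form is the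
  supremum of \<open>\<bar>\<Sum>\<^sub>k c\<^sub>k \<xi>\<^sub>1(x\<^sub>k\<^sub>1) \<dots> \<xi>\<^sub>l(x\<^sub>k\<^sub>l)\<bar>\<close> over \<open>\<xi>\<^sub>1, \<dots>, \<xi>\<^sub>l\<close> in the unit ball of \<open>B*\<close>, that is, the
  injective norm.  The space of forms being complete, the completion is the closure in it.
\<close>

lift_definition elem_tensor_form ::
    "('l::finite \<Rightarrow> 'b::real_normed_vector) \<Rightarrow> ('b \<Rightarrow>\<^sub>L real, 'l) mform"
  is "\<lambda>x \<xi>. \<Prod>i\<in>UNIV. blinfun_apply (\<xi> i) (x i)"
proof safe
  fix x :: "'l \<Rightarrow> 'b"
  show "multilinear (\<lambda>\<xi>. \<Prod>i\<in>UNIV. blinfun_apply (\<xi> i) (x i))"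
    unfolding multilinear_def
  proof (intro allI)
    fix j and \<xi> :: "'l \<Rightarrow> 'b \<Rightarrow>\<^sub>L real"
    have "(\<Prod>i\<in>UNIV. blinfun_apply ((\<xi>(j := \<eta>)) i) (x i)) =
        blinfun_apply \<eta> (x j) * (\<Prod>i\<in>UNIV - {j}. blinfun_apply (\<xi> i) (x i))" for \<eta>
      by (subst prod.remove[of _ j]) (auto intro!: prod.cong)
    then show "linear (\<lambda>\<eta>. \<Prod>i\<in>UNIV. blinfun_apply ((\<xi>(j := \<eta>)) i) (x i))"
      by (simp add: linear_iff blinfun.add_left blinfun.scaleR_left algebra_simps)
  qed
  show "\<exists>K. \<forall>\<xi>. \<bar>\<Prod>i\<in>UNIV. blinfun_apply (\<xi> i) (x i)\<bar> \<le> K * (\<Prod>i\<in>UNIV. norm (\<xi> i))"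
  proof (intro exI[of _ "\<Prod>i\<in>UNIV. norm (x i)"] allI)
    fix \<xi> :: "'l \<Rightarrow> 'b \<Rightarrow>\<^sub>L real"
    have "\<bar>\<Prod>i\<in>UNIV. blinfun_apply (\<xi> i) (x i)\<bar> \<le> (\<Prod>i\<in>UNIV. norm (\<xi> i) * norm (x i))"
      unfolding abs_prod using norm_blinfun[of "\<xi> _" "x _"] by (intro prod_mono) simp
    then show "\<bar>\<Prod>i\<in>UNIV. blinfun_apply (\<xi> i) (x i)\<bar> \<le>
        (\<Prod>i\<in>UNIV. norm (x i)) * (\<Prod>i\<in>UNIV. norm (\<xi> i))"
      by (simp add: prod.distrib mult.commute)
  qed
qed

typedef (overloaded) ('b::real_normed_vector, 'l::finite) inj_tensor =
  "closure (span (range elem_tensor_form)) :: ('b \<Rightarrow>\<^sub>L real, 'l) mform set"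
  morphisms form_of_tensor Abs_inj_tensor
  by (intro exI[of _ 0] subsetD[OF closure_subset] span_zero)

setup_lifting type_definition_inj_tensor

lemma subspace_closure_span:
  fixes S :: "'a::real_normed_vector set"
  shows "subspace (closure (span S))"
proof (rule subspaceI)
  show "0 \<in> closure (span S)" by (intro subsetD[OF closure_subset] span_zero)
next
  fix x y
  assume "x \<in> closure (span S)" "y \<in> closure (span S)"
  then obtain X Y where "\<forall>n. X n \<in> span S" "X \<longlonglongrightarrow> x" "\<forall>n. Y n \<in> span S" "Y \<longlonglongrightarrow> y"
    unfolding closure_sequential by blast
  then show "x + y \<in> closure (span S)"
    unfolding closure_sequential
    by (intro exI[of _ "\<lambda>n. X n + Y n"]) (simp add: span_add tendsto_add)
next
  fix c x
  assume "x \<in> closure (span S)"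
  then obtain X where "\<forall>n. X n \<in> span S" "X \<longlonglongrightarrow> x"
    unfolding closure_sequential by blast
  then show "c *\<^sub>R x \<in> closure (span S)"
    unfolding closure_sequential
    by (intro exI[of _ "\<lambda>n. c *\<^sub>R X n"]) (simp add: span_scale tendsto_scaleR)
qed

instantiation inj_tensor :: (real_normed_vector, finite) real_vector
begin

lift_definition zero_inj_tensor :: "('a, 'b) inj_tensor" is 0
  by (rule subspace_0[OF subspace_closure_span])

lift_definition plus_inj_tensor ::
    "('a, 'b) inj_tensor \<Rightarrow> ('a, 'b) inj_tensor \<Rightarrow> ('a, 'b) inj_tensor" is "(+)"
  by (rule subspace_add[OF subspace_closure_span])

lift_definition uminus_inj_tensor :: "('a, 'b) inj_tensor \<Rightarrow> ('a, 'b) inj_tensor" is uminus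
  by (rule subspace_neg[OF subspace_closure_span])

lift_definition minus_inj_tensor ::
    "('a, 'b) inj_tensor \<Rightarrow> ('a, 'b) inj_tensor \<Rightarrow> ('a, 'b) inj_tensor" is "(-)"
  by (rule subspace_diff[OF subspace_closure_span])

lift_definition scaleR_inj_tensor ::
    "real \<Rightarrow> ('a, 'b) inj_tensor \<Rightarrow> ('a, 'b) inj_tensor" is "scaleR"
  by (rule subspace_scale[OF subspace_closure_span])

instance
  by standard (transfer; simp add: algebra_simps)+

end

instantiation inj_tensor :: (real_normed_vector, finite) real_normed_vector
begin

definition norm_inj_tensor :: "('a, 'b) inj_tensor \<Rightarrow> real" where
  "norm_inj_tensor u = norm (form_of_tensor u)"

definition dist_inj_tensor :: "('a, 'b) inj_tensor \<Rightarrow> ('a, 'b) inj_tensor \<Rightarrow> real" where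
  "dist_inj_tensor u v = norm (u - v)"

definition sgn_inj_tensor :: "('a, 'b) inj_tensor \<Rightarrow> ('a, 'b) inj_tensor" where
  "sgn_inj_tensor u = u /\<^sub>R norm u"

definition uniformity_inj_tensor :: "(('a, 'b) inj_tensor \<times> ('a, 'b) inj_tensor) filter" where
  "uniformity_inj_tensor = (INF e\<in>{0<..}. principal {(u, v). dist u v < e})"

definition open_inj_tensor :: "('a, 'b) inj_tensor set \<Rightarrow> bool" where
  "open_inj_tensor S = (\<forall>u\<in>S. \<forall>\<^sub>F (u', v) in uniformity. u' = u \<longrightarrow> v \<in> S)"

instance
proof
  fix u v :: "('a, 'b) inj_tensor" and c :: real
  show "norm u = 0 \<longleftrightarrow> u = 0"
    by (simp add: norm_inj_tensor_def flip: form_of_tensor_inject zero_inj_tensor.rep_eq)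
  show "norm (u + v) \<le> norm u + norm v"
    by (simp add: norm_inj_tensor_def plus_inj_tensor.rep_eq norm_triangle_ineq)
  show "norm (c *\<^sub>R u) = \<bar>c\<bar> * norm u"
    by (simp add: norm_inj_tensor_def scaleR_inj_tensor.rep_eq)
qed (rule dist_inj_tensor_def sgn_inj_tensor_def uniformity_inj_tensor_def open_inj_tensor_def)+

end

lemma dist_form_of_tensor: "dist (form_of_tensor u) (form_of_tensor v) = dist u v"
  by (simp add: dist_norm norm_inj_tensor_def minus_inj_tensor.rep_eq)

instance inj_tensor :: (real_normed_vector, finite) banach
proof
  fix X :: "nat \<Rightarrow> ('a, 'b) inj_tensor"
  assume "Cauchy X"
  then have "Cauchy (\<lambda>n. form_of_tensor (X n))"
    by (simp add: Cauchy_def dist_form_of_tensor)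
  then obtain \<phi> where \<phi>: "(\<lambda>n. form_of_tensor (X n)) \<longlonglongrightarrow> \<phi>"
    using Cauchy_convergent convergent_def by blast
  have "\<phi> \<in> closure (span (range elem_tensor_form))"
    using closed_sequentially[OF closed_closure form_of_tensor \<phi>] .
  then obtain u where u: "\<phi> = form_of_tensor u" using form_of_tensor_cases by blast
  have "X \<longlonglongrightarrow> u" using \<phi> unfolding u tendsto_iff dist_form_of_tensor .
  then show "convergent X" by (rule convergentI)
qed

lift_definition elem_tensor ::
    "('l::finite \<Rightarrow> 'b::real_normed_vector) \<Rightarrow> ('b, 'l) inj_tensor" is elem_tensor_form
  by (intro subsetD[OF closure_subset] span_base rangeI)

definition tensor_power :: "'b::real_normed_vector \<Rightarrow> ('b, 'l::finite) inj_tensor" where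
  "tensor_power x = elem_tensor (\<lambda>_. x)"

lemma form_of_tensor_sum: "form_of_tensor (sum f A) = (\<Sum>k\<in>A. form_of_tensor (f k))"
  by (induction A rule: infinite_finite_induct)
    (simp_all add: zero_inj_tensor.rep_eq plus_inj_tensor.rep_eq)

lemma mform_apply_sum: "mform_apply (sum f A) x = (\<Sum>k\<in>A. mform_apply (f k) x)"
  by (induction A rule: infinite_finite_induct) (simp_all add: mform_apply_simps)

lemma norm_sum_elem_tensor:
  fixes x :: "'k \<Rightarrow> 'l::finite \<Rightarrow> 'b::real_normed_vector"
  shows "norm (\<Sum>k\<in>A. c k *\<^sub>R elem_tensor (x k)) =
    (SUP \<xi>\<in>{\<xi> :: 'l \<Rightarrow> 'b \<Rightarrow>\<^sub>L real. \<forall>i. norm (\<xi> i) \<le> 1}.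
       \<bar>\<Sum>k\<in>A. c k * (\<Prod>i\<in>UNIV. blinfun_apply (\<xi> i) (x k i))\<bar>)"
  by (simp add: norm_inj_tensor_def norm_mform_def form_of_tensor_sum mform_apply_sum
      scaleR_inj_tensor.rep_eq elem_tensor.rep_eq mform_apply_simps elem_tensor_form.rep_eq)

lemma closure_span_elem_tensor:
  "closure (span (range elem_tensor)) = (UNIV :: ('a::real_normed_vector, 'b::finite) inj_tensor set)"
proof -
  have lin: "linear (form_of_tensor :: ('a, 'b) inj_tensor \<Rightarrow> _)"
    by (rule linearI) (simp_all add: plus_inj_tensor.rep_eq scaleR_inj_tensor.rep_eq)
  have span: "form_of_tensor ` span (range (elem_tensor :: _ \<Rightarrow> ('a, 'b) inj_tensor)) =
      span (range elem_tensor_form)"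
    by (simp add: linear_span_image[OF lin, symmetric] image_image elem_tensor.rep_eq)
  have "u \<in> closure (span (range elem_tensor))" for u :: "('a, 'b) inj_tensor"
    unfolding closure_approachable
  proof (intro allI impI)
    fix e :: real
    assume "e > 0"
    then obtain \<phi> where "\<phi> \<in> span (range elem_tensor_form)" "dist \<phi> (form_of_tensor u) < e"
      using form_of_tensor[of u] unfolding closure_approachable by blast
    then show "\<exists>v\<in>span (range elem_tensor). dist v u < e"
      unfolding span[symmetric] by (auto simp: dist_form_of_tensor)
  qed
  then show ?thesis by blast
qed


section \<open>Dunford and Pettis integrals\<close>

definition dunford_integrable :: "'w measure \<Rightarrow> ('w \<Rightarrow> 'e::banach) \<Rightarrow> bool" where
  "dunford_integrable M F \<longleftrightarrow>
     (\<forall>\<xi> :: 'e \<Rightarrow>\<^sub>L real. integrable M (\<lambda>\<omega>. blinfun_apply \<xi> (F \<omega>)))"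

definition is_dunford_integral ::
    "'w measure \<Rightarrow> 'w set \<Rightarrow> ('w \<Rightarrow> 'e::banach) \<Rightarrow> (('e \<Rightarrow>\<^sub>L real) \<Rightarrow>\<^sub>L real) \<Rightarrow> bool" where
  "is_dunford_integral M A F I \<longleftrightarrow>
     (\<forall>\<xi>. blinfun_apply I \<xi> = (LINT \<omega>:A|M. blinfun_apply \<xi> (F \<omega>)))"

definition dunford_integral ::
    "'w measure \<Rightarrow> 'w set \<Rightarrow> ('w \<Rightarrow> 'e::banach) \<Rightarrow> ('e \<Rightarrow>\<^sub>L real) \<Rightarrow>\<^sub>L real" where
  "dunford_integral M A F = (THE I. is_dunford_integral M A F I)"

lift_definition bidual_embedding :: "'e::real_normed_vector \<Rightarrow> ('e \<Rightarrow>\<^sub>L real) \<Rightarrow>\<^sub>L real"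
  is "\<lambda>x \<xi>. blinfun_apply \<xi> x"
  by (rule blinfun.bounded_linear_left)

definition pettis_integrable :: "'w measure \<Rightarrow> ('w \<Rightarrow> 'e::banach) \<Rightarrow> bool" where
  "pettis_integrable M F \<longleftrightarrow>
     dunford_integrable M F \<and> (\<forall>A\<in>sets M. dunford_integral M A F \<in> range bidual_embedding)"

lemma is_dunford_integral_unique:
  "is_dunford_integral M A F I \<Longrightarrow> is_dunford_integral M A F I' \<Longrightarrow> I = I'"
  by (auto simp: is_dunford_integral_def intro: blinfun_eqI)

lemma dunford_integrable_bound:
  fixes F :: "'w \<Rightarrow> 'e::banach"
  assumes F: "dunford_integrable M F"
  shows "\<exists>K. \<forall>\<xi> :: 'e \<Rightarrow>\<^sub>L real. (LINT \<omega>|M. \<bar>blinfun_apply \<xi> (F \<omega>)\<bar>) \<le> K * norm \<xi>"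
proof -
  have int: "integrable M (\<lambda>\<omega>. blinfun_apply \<xi> (F \<omega>))" for \<xi> :: "'e \<Rightarrow>\<^sub>L real"
    using F by (simp add: dunford_integrable_def)
  define N where "N = (\<lambda>\<xi> :: 'e \<Rightarrow>\<^sub>L real. LINT \<omega>|M. \<bar>blinfun_apply \<xi> (F \<omega>)\<bar>)"
  have N_nn: "(\<integral>\<^sup>+\<omega>. ennreal \<bar>blinfun_apply \<xi> (F \<omega>)\<bar> \<partial>M) = ennreal (N \<xi>)" for \<xi>
    unfolding N_def using int[of \<xi>] by (intro nn_integral_eq_integral) auto
  have N_diff: "N (\<xi> - \<eta>) \<le> N \<xi> + N \<eta>" for \<xi> \<eta>
  proof -
    have "N (\<xi> - \<eta>) \<le> (LINT \<omega>|M. \<bar>blinfun_apply \<xi> (F \<omega>)\<bar> + \<bar>blinfun_apply \<eta> (F \<omega>)\<bar>)"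
      unfolding N_def using int[of \<xi>] int[of \<eta>]
      by (intro integral_mono) (auto simp: blinfun.diff_left)
    also have "\<dots> = N \<xi> + N \<eta>"
      unfolding N_def using int[of \<xi>] int[of \<eta>]
      by (intro Bochner_Integration.integral_add integrable_abs)
    finally show ?thesis .
  qed
  have N_scale: "N (c *\<^sub>R \<xi>) = \<bar>c\<bar> * N \<xi>" for c \<xi>
    by (simp add: N_def blinfun.scaleR_left abs_mult)
  define V where "V = (\<lambda>n::nat. {\<xi>. N \<xi> \<le> real n})"
  have closed_V: "closed (V n)" for n
    unfolding closed_sequential_limits
  proof safe
    fix X l
    assume X: "\<forall>k. X k \<in> V n" and lim: "X \<longlonglongrightarrow> l"
    have "(\<integral>\<^sup>+\<omega>. ennreal \<bar>blinfun_apply l (F \<omega>)\<bar> \<partial>M) =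
        (\<integral>\<^sup>+\<omega>. liminf (\<lambda>k. ennreal \<bar>blinfun_apply (X k) (F \<omega>)\<bar>) \<partial>M)"
    proof (rule nn_integral_cong)
      fix \<omega>
      have "(\<lambda>k. ennreal \<bar>blinfun_apply (X k) (F \<omega>)\<bar>) \<longlonglongrightarrow> ennreal \<bar>blinfun_apply l (F \<omega>)\<bar>"
        by (intro tendsto_intros lim)
      then show "ennreal \<bar>blinfun_apply l (F \<omega>)\<bar> = liminf (\<lambda>k. ennreal \<bar>blinfun_apply (X k) (F \<omega>)\<bar>)"
        by (rule lim_imp_Liminf[OF sequentially_bot, symmetric])
    qed
    also have "\<dots> \<le> liminf (\<lambda>k. \<integral>\<^sup>+\<omega>. ennreal \<bar>blinfun_apply (X k) (F \<omega>)\<bar> \<partial>M)"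
      using int by (intro nn_integral_liminf) auto
    also have "\<dots> \<le> ennreal (real n)"
    proof (rule order_trans[OF Liminf_mono])
      show "\<forall>\<^sub>F k in sequentially. (\<integral>\<^sup>+\<omega>. ennreal \<bar>blinfun_apply (X k) (F \<omega>)\<bar> \<partial>M) \<le> ennreal (real n)"
        using X by (auto simp: N_nn V_def intro!: always_eventually ennreal_leI)
    qed (simp add: Liminf_const)
    finally show "l \<in> V n" by (simp add: N_nn V_def)
  qed
  have "\<exists>n. interior (V n) \<noteq> {}"
  proof (rule ccontr)
    assume *: "\<nexists>n. interior (V n) \<noteq> {}"
    have "euclidean interior_of (\<Union>(range V)) = {}"
    proof (rule Baire_category_alt)
      show "completely_metrizable_space (euclidean :: ('e \<Rightarrow>\<^sub>L real) topology) \<or>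
          locally_compact_space (euclidean :: ('e \<Rightarrow>\<^sub>L real) topology) \<and>
          regular_space (euclidean :: ('e \<Rightarrow>\<^sub>L real) topology)"
        by (intro disjI1 completely_metrizable_space_euclidean)
      show "closedin euclidean T \<and> euclidean interior_of T = {}" if "T \<in> range V" for T
        using that * closed_V by auto
    qed simp
    moreover have "\<Union>(range V) = UNIV"
    proof -
      have "\<exists>n. \<xi> \<in> V n" for \<xi>
        using real_arch_simple[of "N \<xi>"] by (auto simp: V_def)
      then show ?thesis by blast
    qed
    ultimately show False by simp
  qed
  then obtain n a r where r: "r > 0" and ball: "cball a r \<subseteq> V n"
    by (metis ex_in_conv mem_interior_cball)
  have small: "N \<xi> \<le> 2 * real n" if "norm \<xi> \<le> r" for \<xi>
  proof -
    have "a + \<xi> \<in> V n" "a \<in> V n"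
      using ball that r by (auto simp: subset_iff dist_norm)
    then show ?thesis using N_diff[of "a + \<xi>" a] by (simp add: V_def)
  qed
  have "N \<xi> \<le> 2 * real n / r * norm \<xi>" for \<xi>
  proof (cases "\<xi> = 0")
    case True
    then show ?thesis by (simp add: N_def)
  next
    case False
    have "N ((r / norm \<xi>) *\<^sub>R \<xi>) \<le> 2 * real n"
      using False r by (intro small) simp
    then show ?thesis using False r by (simp add: N_scale field_simps)
  qed
  then show ?thesis unfolding N_def by blast
qed

lemma dunford_integral:
  fixes F :: "'w \<Rightarrow> 'e::banach"
  assumes F: "dunford_integrable M F" and A: "A \<in> sets M"
  shows "is_dunford_integral M A F (dunford_integral M A F)"
proof -
  have int: "integrable M (\<lambda>\<omega>. blinfun_apply \<xi> (F \<omega>))" for \<xi> :: "'e \<Rightarrow>\<^sub>L real"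
    using F by (simp add: dunford_integrable_def)
  have set_int: "set_integrable M A (\<lambda>\<omega>. blinfun_apply \<xi> (F \<omega>))" for \<xi> :: "'e \<Rightarrow>\<^sub>L real"
    using int A unfolding set_integrable_def by (intro integrable_mult_indicator) auto
  obtain K where K: "\<And>\<xi> :: 'e \<Rightarrow>\<^sub>L real. (LINT \<omega>|M. \<bar>blinfun_apply \<xi> (F \<omega>)\<bar>) \<le> K * norm \<xi>"
    using dunford_integrable_bound[OF F] by blast
  have "bounded_linear (\<lambda>\<xi> :: 'e \<Rightarrow>\<^sub>L real. LINT \<omega>:A|M. blinfun_apply \<xi> (F \<omega>))"
  proof (rule bounded_linear_intro)
    fix \<xi> \<eta> :: "'e \<Rightarrow>\<^sub>L real" and c :: real
    show "(LINT \<omega>:A|M. blinfun_apply (\<xi> + \<eta>) (F \<omega>)) =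
        (LINT \<omega>:A|M. blinfun_apply \<xi> (F \<omega>)) + (LINT \<omega>:A|M. blinfun_apply \<eta> (F \<omega>))"
      using set_int by (simp add: blinfun.add_left set_integral_add)
    show "(LINT \<omega>:A|M. blinfun_apply (c *\<^sub>R \<xi>) (F \<omega>)) = c *\<^sub>R (LINT \<omega>:A|M. blinfun_apply \<xi> (F \<omega>))"
      by (simp add: blinfun.scaleR_left)
    have "norm (LINT \<omega>:A|M. blinfun_apply \<xi> (F \<omega>)) \<le> (LINT \<omega>|M. \<bar>blinfun_apply \<xi> (F \<omega>)\<bar>)"
      unfolding set_lebesgue_integral_def using int set_int[of \<xi>]
      by (intro order_trans[OF integral_norm_bound] integral_mono)
        (auto simp: set_integrable_def indicator_def)
    then show "norm (LINT \<omega>:A|M. blinfun_apply \<xi> (F \<omega>)) \<le> norm \<xi> * K"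
      using K[of \<xi>] by (simp add: mult.commute)
  qed
  then have *: "is_dunford_integral M A F (Blinfun (\<lambda>\<xi>. LINT \<omega>:A|M. blinfun_apply \<xi> (F \<omega>)))"
    by (simp add: is_dunford_integral_def bounded_linear_Blinfun_apply)
  show ?thesis
    unfolding dunford_integral_def
    by (rule theI[of "is_dunford_integral M A F", OF * is_dunford_integral_unique[OF _ *]])
qed


section \<open>Uniform integrability\<close>

text \<open>
  The integrals are extended non-negative, so the limit also entails that each \<open>Y i\<close> is integrable
  when \<open>M\<close> is finite.
\<close>

definition uniformly_integrable ::
    "'w measure \<Rightarrow> 'i set \<Rightarrow> ('i \<Rightarrow> 'w \<Rightarrow> real) \<Rightarrow> bool" where
  "uniformly_integrable M I Y \<longleftrightarrow>
     (\<forall>i\<in>I. Y i \<in> borel_measurable M) \<and>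
     ((\<lambda>c :: real. SUP i\<in>I. \<integral>\<^sup>+\<omega>. ennreal \<bar>Y i \<omega>\<bar> * indicator {\<omega>. c < \<bar>Y i \<omega>\<bar>} \<omega> \<partial>M) \<longlongrightarrow> 0) at_top"

end

(*
  With the two-point splitting of every t in (0,1], D([0,1]^m) becomes a C(K), and its injective
  tensor power is C(K^l) = D([0,1]^(ml)); this isometry reduces everything to a random element G of a
  single space D([0,1]^n) with G(t) = X(t_1) ... X(t_l).  Instead of representing a functional xi on
  that space by a measure on the non-metrisable K, xi is shown to be a pointwise limit of quadratures
  f |-> sum_r w_r f(r) with sum_r |w_r| <= ||xi||: all but countably many coordinate hyperplanes
  carry no mass of xi, and one takes nested grids that contain the exceptional ones.  Measurability
  and Fatou give the Dunford case.  Under uniform integrability, Vitali's theorem makes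
  t |-> E[1_A G(t)] an element of D([0,1]^n), and by the quadratures it is the integral of G over A.
  Conversely, if uniform integrability fails along points t_j, these may be taken convergent within
  one orthant, so that G(t_j) converges pointwise; Pettis integrability makes the integrals over each
  A converge too, and a gliding hump turns this into convergence in L^1.
*)

theory Submission
  imports Defs
begin

text \<open>The obstacle is that D([0,1]^n) is not separable in the supremum norm: nothing makes
  \<xi>(G) measurable beforehand, and a net of approximations to \<xi> would not help. The
  quadratures must therefore form one sequence that depends on \<xi> only and works for every f. A
  step function may jump anywhere, and no countable family of grids contains all jumps. A jump off
  the grids does no harm when \<xi> has no mass on its hyperplane, and the finite norm of \<xi>
  leaves only countably many hyperplanes in each direction with mass. In the converse, the
  difference between Pettis and Dunford enters at one place: an integral over A that is an element
  of the space inherits the convergence of evaluations, which an element of the bidual need not do.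
  Setwise convergence of the integrals is the situation of the Vitali-Hahn-Saks theorem; as the
  integrands converge pointwise too, a direct gliding hump suffices.\<close>

section \<open>Uniform integrability\<close>

text \<open>
  Unlike \<open>\<bar>y\<bar>\<close> cut off to \<open>c < \<bar>y\<bar>\<close>, the excess is convex in \<open>y\<close>, so that bounds on it pass to
  weighted sums.
\<close>

definition excess :: "real \<Rightarrow> real \<Rightarrow> real" where
  "excess c y = max 0 (\<bar>y\<bar> - c)"

lemma excess_nonneg [simp]: "0 \<le> excess c y"
  by (simp add: excess_def)

lemma borel_measurable_excess [measurable]: "excess c \<in> borel_measurable borel"
  unfolding excess_def by measurable

lemma excess_mono_abs: "\<bar>x\<bar> \<le> \<bar>y\<bar> \<Longrightarrow> excess c x \<le> excess c y"
  by (auto simp: excess_def)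

text \<open>The two truncations dominate each other. For c \<ge> 0 the excess is at most
  \<bar>y\<bar> cut off to c < \<bar>y\<bar>; for d \<ge> 2 * c the cut-off at d is at most twice
  \<open>excess c y\<close>, whence the tolerance \<open>e / 2\<close> in the second
  direction.\<close>

lemma uniformly_integrable_iff_excess:
  "uniformly_integrable M I Y \<longleftrightarrow>
     (\<forall>i\<in>I. Y i \<in> borel_measurable M) \<and>
     (\<forall>e>0. \<exists>c\<ge>0. \<forall>i\<in>I. (\<integral>\<^sup>+\<omega>. ennreal (excess c (Y i \<omega>)) \<partial>M) \<le> ennreal e)"
  (is "_ \<longleftrightarrow> ?meas \<and> ?exc")
proof -
  define S where "S = (\<lambda>c :: real. SUP i\<in>I. \<integral>\<^sup>+\<omega>. ennreal \<bar>Y i \<omega>\<bar> * indicator {\<omega>. c < \<bar>Y i \<omega>\<bar>} \<omega> \<partial>M)"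
  have "(S \<longlongrightarrow> 0) at_top \<longleftrightarrow> ?exc" if meas: ?meas
  proof
    assume S: "(S \<longlongrightarrow> 0) at_top"
    show ?exc
    proof (intro allI impI)
      fix e :: real
      assume "e > 0"
      then have "\<forall>\<^sub>F c in at_top. S c < ennreal e"
        using order_tendstoD(2)[OF S, of "ennreal e"] by simp
      then have "\<forall>\<^sub>F c in at_top. S c < ennreal e \<and> c \<ge> 0"
        using eventually_ge_at_top[of 0] by (rule eventually_conj)
      then obtain c where c: "S c < ennreal e" "c \<ge> 0"
        using eventually_happens[of _ "at_top :: real filter"] by auto
      have "(\<integral>\<^sup>+\<omega>. ennreal (excess c (Y i \<omega>)) \<partial>M) \<le> ennreal e" if "i \<in> I" for i
      proof -
        have "(\<integral>\<^sup>+\<omega>. ennreal (excess c (Y i \<omega>)) \<partial>M) \<le>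
            (\<integral>\<^sup>+\<omega>. ennreal \<bar>Y i \<omega>\<bar> * indicator {\<omega>. c < \<bar>Y i \<omega>\<bar>} \<omega> \<partial>M)"
          using c(2) by (intro nn_integral_mono) (auto simp: excess_def indicator_def ennreal_neg intro!: ennreal_leI)
        also have "\<dots> \<le> S c" unfolding S_def using that by (rule SUP_upper)
        finally show ?thesis using c(1) by simp
      qed
      then show "\<exists>c\<ge>0. \<forall>i\<in>I. (\<integral>\<^sup>+\<omega>. ennreal (excess c (Y i \<omega>)) \<partial>M) \<le> ennreal e"
        using c(2) by blast
    qed
  next
    assume exc: ?exc
    show "(S \<longlongrightarrow> 0) at_top"
    proof (rule order_tendstoI)
      fix a :: ennreal
      assume "0 < a"
      then obtain b where b: "0 < b" "b < a" using dense by blast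
      then obtain e where e: "b = ennreal e" "e > 0" by (cases b) auto
      obtain c where c: "c \<ge> 0" "\<And>i. i \<in> I \<Longrightarrow> (\<integral>\<^sup>+\<omega>. ennreal (excess c (Y i \<omega>)) \<partial>M) \<le> ennreal (e / 2)"
        using exc[rule_format, of "e / 2"] e(2) by auto
      have "S d < a" if d: "d \<ge> 2 * c" for d
      proof -
        have "S d \<le> ennreal e"
          unfolding S_def
        proof (rule SUP_least)
          fix i
          assume i: "i \<in> I"
          have "(\<integral>\<^sup>+\<omega>. ennreal \<bar>Y i \<omega>\<bar> * indicator {\<omega>. d < \<bar>Y i \<omega>\<bar>} \<omega> \<partial>M) \<le>
              (\<integral>\<^sup>+\<omega>. 2 * ennreal (excess c (Y i \<omega>)) \<partial>M)"
          proof (rule nn_integral_mono)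
            fix \<omega>
            have "\<bar>Y i \<omega>\<bar> \<le> 2 * excess c (Y i \<omega>)" if "d < \<bar>Y i \<omega>\<bar>"
              using that d c(1) by (auto simp: excess_def)
            then show "ennreal \<bar>Y i \<omega>\<bar> * indicator {\<omega>. d < \<bar>Y i \<omega>\<bar>} \<omega> \<le> 2 * ennreal (excess c (Y i \<omega>))"
              by (auto simp: indicator_def ennreal_mult[symmetric] simp flip: ennreal_numeral intro!: ennreal_leI)
          qed
          also have "\<dots> = 2 * (\<integral>\<^sup>+\<omega>. ennreal (excess c (Y i \<omega>)) \<partial>M)"
            using meas i by (intro nn_integral_cmult) auto
          also have "\<dots> \<le> 2 * ennreal (e / 2)"
            by (intro mult_left_mono c(2) i) auto
          also have "\<dots> = ennreal e"
            using e(2) by (simp add: ennreal_mult[symmetric] flip: ennreal_numeral)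
          finally show "(\<integral>\<^sup>+\<omega>. ennreal \<bar>Y i \<omega>\<bar> * indicator {\<omega>. d < \<bar>Y i \<omega>\<bar>} \<omega> \<partial>M) \<le> ennreal e" .
        qed
        then show ?thesis using b e by simp
      qed
      then show "\<forall>\<^sub>F d in at_top. S d < a"
        unfolding eventually_at_top_linorder by blast
    qed simp
  qed
  then show ?thesis unfolding uniformly_integrable_def S_def by blast
qed

text \<open>From the triangle inequality and \<bar>y\<bar> \<le> c + \<open>excess c y\<close>:
  weights of total mass at most W multiply the threshold by W. This serves both the quadratures of a
  functional and the bound of a product by a sum of powers.\<close>

lemma excess_weighted_sum:
  assumes "finite R" "(\<Sum>r\<in>R. \<bar>w r\<bar>) \<le> W" "c \<ge> 0"
  shows "excess (W * c) (\<Sum>r\<in>R. w r * y r) \<le> (\<Sum>r\<in>R. \<bar>w r\<bar> * excess c (y r))"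
proof -
  have "\<bar>\<Sum>r\<in>R. w r * y r\<bar> \<le> (\<Sum>r\<in>R. \<bar>w r\<bar> * \<bar>y r\<bar>)"
    by (rule order_trans[OF sum_abs]) (simp add: abs_mult)
  also have "\<dots> \<le> (\<Sum>r\<in>R. \<bar>w r\<bar> * excess c (y r) + \<bar>w r\<bar> * c)"
    by (intro sum_mono) (simp add: distrib_left[symmetric] mult_left_mono excess_def)
  also have "\<dots> = (\<Sum>r\<in>R. \<bar>w r\<bar> * excess c (y r)) + (\<Sum>r\<in>R. \<bar>w r\<bar>) * c"
    by (simp add: sum.distrib sum_distrib_right)
  also have "\<dots> \<le> (\<Sum>r\<in>R. \<bar>w r\<bar> * excess c (y r)) + W * c"
    using assms by (intro add_left_mono mult_right_mono)
  finally show ?thesis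
    by (auto simp: excess_def intro!: sum_nonneg)
qed

lemma nn_integral_weighted_sum_le:
  assumes "finite R" "(\<Sum>r\<in>R. \<bar>w r\<bar>) \<le> W"
    and "\<And>r. r \<in> R \<Longrightarrow> g r \<in> borel_measurable M"
    and "\<And>r. r \<in> R \<Longrightarrow> (\<integral>\<^sup>+\<omega>. ennreal (g r \<omega>) \<partial>M) \<le> b" "\<And>r \<omega>. 0 \<le> g r \<omega>"
  shows "(\<integral>\<^sup>+\<omega>. ennreal (\<Sum>r\<in>R. \<bar>w r\<bar> * g r \<omega>) \<partial>M) \<le> ennreal W * b"
proof -
  have "(\<integral>\<^sup>+\<omega>. ennreal (\<Sum>r\<in>R. \<bar>w r\<bar> * g r \<omega>) \<partial>M) =
      (\<integral>\<^sup>+\<omega>. (\<Sum>r\<in>R. ennreal \<bar>w r\<bar> * ennreal (g r \<omega>)) \<partial>M)"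
    using assms(5) by (simp add: ennreal_mult flip: sum_ennreal)
  also have "\<dots> = (\<Sum>r\<in>R. ennreal \<bar>w r\<bar> * (\<integral>\<^sup>+\<omega>. ennreal (g r \<omega>) \<partial>M))"
    using assms(3) by (simp add: nn_integral_sum nn_integral_cmult)
  also have "\<dots> \<le> (\<Sum>r\<in>R. ennreal \<bar>w r\<bar> * b)"
    by (intro sum_mono mult_left_mono assms(4)) auto
  also have "\<dots> = ennreal (\<Sum>r\<in>R. \<bar>w r\<bar>) * b"
    by (simp add: sum_distrib_right flip: sum_ennreal)
  also have "\<dots> \<le> ennreal W * b"
    by (intro mult_right_mono ennreal_leI assms(2)) auto
  finally show ?thesis .
qed

lemma (in finite_measure) integrable_if_excess:
  fixes Y :: "'a \<Rightarrow> real"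
  assumes [measurable]: "Y \<in> borel_measurable M"
    and c: "c \<ge> 0" "(\<integral>\<^sup>+\<omega>. ennreal (excess c (Y \<omega>)) \<partial>M) \<le> ennreal e" "0 \<le> e"
  shows "integrable M Y" "integrable M (\<lambda>\<omega>. excess c (Y \<omega>))" "(LINT \<omega>|M. excess c (Y \<omega>)) \<le> e"
proof -
  show *: "integrable M (\<lambda>\<omega>. excess c (Y \<omega>))"
    by (rule integrableI_nonneg) (use le_less_trans[OF c(2) ennreal_less_top] in auto)
  show "integrable M Y"
    by (rule Bochner_Integration.integrable_bound[of _ "\<lambda>\<omega>. c + excess c (Y \<omega>)"])
      (use * c in \<open>auto simp: excess_def\<close>)
  show "(LINT \<omega>|M. excess c (Y \<omega>)) \<le> e"
    using c nn_integral_eq_integral[OF *] by simp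
qed

section \<open>Convergence theorems for integrals\<close>

lemma nn_integral_pointwise_limit_le:
  fixes f :: "nat \<Rightarrow> 'a \<Rightarrow> real"
  assumes "\<And>k. f k \<in> borel_measurable M"
    and "\<And>\<omega>. \<omega> \<in> space M \<Longrightarrow> (\<lambda>k. f k \<omega>) \<longlonglongrightarrow> g \<omega>"
    and "\<And>k. (\<integral>\<^sup>+\<omega>. ennreal (f k \<omega>) \<partial>M) \<le> b"
  shows "(\<integral>\<^sup>+\<omega>. ennreal (g \<omega>) \<partial>M) \<le> b"
proof -
  have "(\<integral>\<^sup>+\<omega>. ennreal (g \<omega>) \<partial>M) = (\<integral>\<^sup>+\<omega>. liminf (\<lambda>k. ennreal (f k \<omega>)) \<partial>M)"
    by (intro nn_integral_cong lim_imp_Liminf[symmetric] tendsto_ennrealI assms(2)) auto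
  also have "\<dots> \<le> liminf (\<lambda>k. \<integral>\<^sup>+\<omega>. ennreal (f k \<omega>) \<partial>M)"
    using assms(1) by (intro nn_integral_liminf) auto
  also have "\<dots> \<le> liminf (\<lambda>k::nat. b)"
    by (intro Liminf_mono always_eventually allI assms(3))
  finally show ?thesis by (simp add: Liminf_const)
qed

text \<open>Clipping y to [-c, c] changes it by exactly \<open>excess c y\<close>, so the error is
  small uniformly in k, and Fatou carries the bound over to Z. The clipped functions converge by
  domination.\<close>

lemma (in finite_measure) Vitali_convergence:
  fixes Y :: "nat \<Rightarrow> 'a \<Rightarrow> real"
  assumes meas: "\<And>k. Y k \<in> borel_measurable M"
    and lim: "\<And>\<omega>. \<omega> \<in> space M \<Longrightarrow> (\<lambda>k. Y k \<omega>) \<longlonglongrightarrow> Z \<omega>"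
    and exc: "\<And>e. e > 0 \<Longrightarrow> \<exists>c\<ge>0. \<forall>k. (\<integral>\<^sup>+\<omega>. ennreal (excess c (Y k \<omega>)) \<partial>M) \<le> ennreal e"
    and A: "A \<in> sets M"
  shows "(\<lambda>k. LINT \<omega>:A|M. Y k \<omega>) \<longlonglongrightarrow> (LINT \<omega>:A|M. Z \<omega>)"
proof (rule LIMSEQ_I)
  fix e :: real
  assume e: "e > 0"
  have Z [measurable]: "Z \<in> borel_measurable M"
    by (rule borel_measurable_LIMSEQ_real[OF lim meas])
  note meas [measurable] A [measurable]
  \<comment> \<open>Three errors of \<open>e / 4\<close> will occur: clipping \<open>Y k\<close>,
    clipping \<open>Z\<close>, and the distance of the clipped integrals.\<close>
  obtain c where c: "c \<ge> 0" "\<And>k. (\<integral>\<^sup>+\<omega>. ennreal (excess c (Y k \<omega>)) \<partial>M) \<le> ennreal (e / 4)"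
    using exc[of "e / 4"] e by auto
  have Zc: "(\<integral>\<^sup>+\<omega>. ennreal (excess c (Z \<omega>)) \<partial>M) \<le> ennreal (e / 4)"
    by (rule nn_integral_pointwise_limit_le[OF _ _ c(2)])
      (auto simp: excess_def intro!: tendsto_intros lim)
  define clip where "clip = (\<lambda>y. max (- c) (min c y))"
  have [measurable]: "clip \<in> borel_measurable borel" unfolding clip_def by measurable
  have clip_bound: "\<bar>clip y\<bar> \<le> c" for y using c(1) by (auto simp: clip_def)
  have near: "\<bar>(LINT \<omega>:A|M. W \<omega>) - (LINT \<omega>:A|M. clip (W \<omega>))\<bar> \<le> e / 4"
    if [measurable]: "W \<in> borel_measurable M"
      and W: "(\<integral>\<^sup>+\<omega>. ennreal (excess c (W \<omega>)) \<partial>M) \<le> ennreal (e / 4)" for W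
  proof -
    note i = integrable_if_excess[OF that(1) c(1) W]
    have ic: "integrable M (\<lambda>\<omega>. clip (W \<omega>))"
      by (rule integrable_const_bound[of _ c]) (auto simp: clip_bound)
    have "(LINT \<omega>:A|M. W \<omega>) - (LINT \<omega>:A|M. clip (W \<omega>)) = (LINT \<omega>:A|M. W \<omega> - clip (W \<omega>))"
      using i(1) ic e A
      unfolding set_lebesgue_integral_def scaleR_diff_right
      by (intro Bochner_Integration.integral_diff[symmetric] integrable_mult_indicator) auto
    also have "\<bar>\<dots>\<bar> \<le> (LINT \<omega>|M. excess c (W \<omega>))"
    proof -
      have iA: "integrable M (\<lambda>\<omega>. indicat_real A \<omega> *\<^sub>R (W \<omega> - clip (W \<omega>)))"
        using i(1) ic e A by (intro integrable_mult_indicator) auto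
      have "\<bar>LINT \<omega>:A|M. W \<omega> - clip (W \<omega>)\<bar> \<le> (LINT \<omega>|M. \<bar>indicat_real A \<omega> *\<^sub>R (W \<omega> - clip (W \<omega>))\<bar>)"
        unfolding set_lebesgue_integral_def by (rule integral_abs_bound)
      also have "\<dots> \<le> (LINT \<omega>|M. excess c (W \<omega>))"
        using i(2) iA e by (intro integral_mono) (auto simp: indicator_def excess_def clip_def)
      finally show ?thesis .
    qed
    also have "\<dots> \<le> e / 4" using i(3) e by simp
    finally show ?thesis .
  qed
  have "(\<lambda>k. LINT \<omega>:A|M. clip (Y k \<omega>)) \<longlonglongrightarrow> (LINT \<omega>:A|M. clip (Z \<omega>))"
    unfolding set_lebesgue_integral_def
  proof (rule integral_dominated_convergence[where w = "\<lambda>_. c"])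
    show "AE \<omega> in M. (\<lambda>k. indicat_real A \<omega> *\<^sub>R clip (Y k \<omega>)) \<longlonglongrightarrow> indicat_real A \<omega> *\<^sub>R clip (Z \<omega>)"
      unfolding clip_def by (intro AE_I2 tendsto_intros lim)
    show "AE \<omega> in M. norm (indicat_real A \<omega> *\<^sub>R clip (Y k \<omega>)) \<le> c" for k
      using clip_bound c(1) by (auto simp: indicator_def)
  qed auto
  then obtain N where N: "\<And>k. k \<ge> N \<Longrightarrow>
      \<bar>(LINT \<omega>:A|M. clip (Y k \<omega>)) - (LINT \<omega>:A|M. clip (Z \<omega>))\<bar> < e / 4"
    using LIMSEQ_D[of _ _ "e / 4"] e by fastforce
  show "\<exists>N. \<forall>k\<ge>N. norm ((LINT \<omega>:A|M. Y k \<omega>) - (LINT \<omega>:A|M. Z \<omega>)) < e"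
  proof (intro exI allI impI)
    fix k
    assume "k \<ge> N"
    from N[OF this] near[OF meas c(2), of k] near[OF Z Zc] e
    show "norm ((LINT \<omega>:A|M. Y k \<omega>) - (LINT \<omega>:A|M. Z \<omega>)) < e"
      unfolding real_norm_def by linarith
  qed
qed

text \<open>Convergence on sets alone would not suffice, as the Rademacher functions show. By
  pointwise convergence the sets \<open>G p\<close>, where \<bar>Z j\<bar> \<le> 1 for all j \<ge>
  p, exhaust the space. On a fixed \<open>G p\<close> the integrals of \<bar>Z j\<bar> tend to 0 by
  domination, whereas a single \<open>Z j\<close> leaves little mass outside a large
  \<open>G q\<close>. Functions with large integral thus carry their mass on disjoint shells, where
  one set can collect all the positive parts and another all the negative ones.\<close>

lemma (in finite_measure) L1_limit_if_set_integrals_limit: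
  fixes Z :: "nat \<Rightarrow> 'a \<Rightarrow> real"
  assumes int: "\<And>j. integrable M (Z j)"
    and lim: "\<And>\<omega>. \<omega> \<in> space M \<Longrightarrow> (\<lambda>j. Z j \<omega>) \<longlonglongrightarrow> 0"
    and sets: "\<And>A. A \<in> sets M \<Longrightarrow> (\<lambda>j. LINT \<omega>:A|M. Z j \<omega>) \<longlonglongrightarrow> 0"
  shows "(\<lambda>j. LINT \<omega>|M. \<bar>Z j \<omega>\<bar>) \<longlonglongrightarrow> 0"
proof (rule ccontr)
  assume "\<not> ?thesis"
  then obtain e where e: "e > 0" and inf: "\<And>N. \<exists>j\<ge>N. (LINT \<omega>|M. \<bar>Z j \<omega>\<bar>) \<ge> e"
    unfolding LIMSEQ_iff real_norm_def diff_zero abs_abs not_all not_ex not_imp not_less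
      abs_of_nonneg[OF Bochner_Integration.integral_nonneg[OF abs_ge_zero]] by blast
  have [measurable]: "Z j \<in> borel_measurable M" for j using int by auto
  define G where "G = (\<lambda>p. {\<omega> \<in> space M. \<forall>j\<ge>p. \<bar>Z j \<omega>\<bar> \<le> 1})"
  have G [measurable]: "G p \<in> sets M" for p unfolding G_def by measurable
  have G_mono: "G p \<subseteq> G q" if "p \<le> q" for p q using that by (auto simp: G_def)
  have setint: "integrable M (\<lambda>\<omega>. indicat_real A \<omega> * \<bar>Z j \<omega>\<bar>)" if "A \<in> sets M" for A j
    using integrable_mult_indicator[OF that integrable_abs[OF int[of j]]] by simp
  \<comment> \<open>On \<open>G p\<close> the bound 1 holds only from index p on, hence the shift of
    the sequence.\<close>
  have "(\<lambda>j. LINT \<omega>|M. indicat_real (G p) \<omega> * \<bar>Z j \<omega>\<bar>) \<longlonglongrightarrow> (LINT \<omega>|M. 0)" for p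
  proof (rule LIMSEQ_offset[of _ p], rule integral_dominated_convergence[where w = "\<lambda>_. 1"])
    show "AE \<omega> in M. (\<lambda>j. indicat_real (G p) \<omega> * \<bar>Z (j + p) \<omega>\<bar>) \<longlonglongrightarrow> 0"
      using LIMSEQ_ignore_initial_segment[OF lim]
      by (intro AE_I2 tendsto_mult_right_zero tendsto_rabs_zero)
    show "AE \<omega> in M. norm (indicat_real (G p) \<omega> * \<bar>Z (j + p) \<omega>\<bar>) \<le> 1" for j
      by (auto simp: G_def indicator_def)
  qed auto
  then have *: "\<forall>\<^sub>F j in sequentially. (LINT \<omega>|M. indicat_real (G p) \<omega> * \<bar>Z j \<omega>\<bar>) < e / 16" for p
    using e by (intro order_tendstoD(2)) auto
  have "\<exists>j\<ge>p. (LINT \<omega>|M. indicat_real (G p) \<omega> * \<bar>Z j \<omega>\<bar>) < e / 16 \<and> (LINT \<omega>|M. \<bar>Z j \<omega>\<bar>) \<ge> e" for p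
  proof -
    obtain N where "\<And>j. j \<ge> N \<Longrightarrow> (LINT \<omega>|M. indicat_real (G p) \<omega> * \<bar>Z j \<omega>\<bar>) < e / 16"
      using *[of p] unfolding eventually_sequentially by blast
    moreover obtain j where "j \<ge> max N p" "(LINT \<omega>|M. \<bar>Z j \<omega>\<bar>) \<ge> e" using inf by blast
    ultimately show ?thesis by (intro exI[of _ j]) auto
  qed
  then obtain J where J: "\<And>p. J p \<ge> p" "\<And>p. (LINT \<omega>|M. indicat_real (G p) \<omega> * \<bar>Z (J p) \<omega>\<bar>) < e / 16"
    "\<And>p. (LINT \<omega>|M. \<bar>Z (J p) \<omega>\<bar>) \<ge> e"
    by metis
  have "(\<lambda>q. LINT \<omega>|M. indicat_real (space M - G q) \<omega> * \<bar>Z j \<omega>\<bar>) \<longlonglongrightarrow> (LINT \<omega>|M. 0)" for j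
  proof (rule integral_dominated_convergence[where w = "\<lambda>\<omega>. \<bar>Z j \<omega>\<bar>"])
    show "AE \<omega> in M. (\<lambda>q. indicat_real (space M - G q) \<omega> * \<bar>Z j \<omega>\<bar>) \<longlonglongrightarrow> 0"
    proof (rule AE_I2)
      fix \<omega>
      assume \<omega>: "\<omega> \<in> space M"
      then obtain N where "\<And>j. j \<ge> N \<Longrightarrow> \<bar>Z j \<omega>\<bar> < 1"
        using LIMSEQ_D[OF lim[OF \<omega>], of 1] by auto
      then have "\<forall>q\<ge>N. indicat_real (space M - G q) \<omega> * \<bar>Z j \<omega>\<bar> = 0"
        using \<omega> by (auto simp: G_def indicator_def less_imp_le)
      then show "(\<lambda>q. indicat_real (space M - G q) \<omega> * \<bar>Z j \<omega>\<bar>) \<longlonglongrightarrow> 0"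
        by (intro tendsto_eventually) (auto simp: eventually_sequentially)
    qed
  qed (use int in \<open>auto simp: indicator_def\<close>)
  then have *: "\<forall>\<^sub>F q in sequentially. (LINT \<omega>|M. indicat_real (space M - G q) \<omega> * \<bar>Z j \<omega>\<bar>) < e / 16" for j
    using e by (intro order_tendstoD(2)) auto
  have "\<exists>q>p. (LINT \<omega>|M. indicat_real (space M - G q) \<omega> * \<bar>Z (J p) \<omega>\<bar>) < e / 16" for p
  proof -
    obtain N where "\<And>q. q \<ge> N \<Longrightarrow> (LINT \<omega>|M. indicat_real (space M - G q) \<omega> * \<bar>Z (J p) \<omega>\<bar>) < e / 16"
      using *[of "J p"] unfolding eventually_sequentially by blast
    then show ?thesis by (intro exI[of _ "max N (Suc p)"]) auto
  qed
  then obtain Q where Q: "\<And>p. Q p > p"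
    "\<And>p. (LINT \<omega>|M. indicat_real (space M - G (Q p)) \<omega> * \<bar>Z (J p) \<omega>\<bar>) < e / 16"
    by metis
  \<comment> \<open>Gliding hump: all but \<open>e / 8\<close> of the integral of \<open>\<bar>Z (j k)\<bar>\<close> comes from the shell \<open>D k\<close>, and
    \<open>C\<close> and \<open>C'\<close> collect the parts of the shells where \<open>Z (j k)\<close> is positive and negative.\<close>
  define P where "P = (\<lambda>k. (Q ^^ k) 0)"
  have P_Suc: "P (Suc k) = Q (P k)" for k by (simp add: P_def)
  have P: "strict_mono P" unfolding strict_mono_Suc_iff using Q(1) by (simp add: P_Suc)
  define j where "j = (\<lambda>k. J (P k))"
  define D where "D = (\<lambda>k. G (P (Suc k)) - G (P k))"
  have disj: "D k \<inter> D l = {}" if "k < l" for k l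
    using that G_mono[of "P (Suc k)" "P l"] P by (auto simp: D_def strict_mono_less_eq)
  have D_eq: "k = l" if "\<omega> \<in> D k" "\<omega> \<in> D l" for \<omega> k l
    using disj[of k l] disj[of l k] that by (cases k l rule: linorder_cases) auto
  define C where "C = (\<Union>k. {\<omega> \<in> D k. Z (j k) \<omega> > 0})"
  define C' where "C' = (\<Union>k. {\<omega> \<in> D k. Z (j k) \<omega> < 0})"
  have Dsub: "{\<omega> \<in> D k. R \<omega>} = {\<omega> \<in> space M. \<omega> \<in> D k \<and> R \<omega>}" for k R
    by (auto simp: D_def G_def)
  have [measurable]: "D k \<in> sets M" for k unfolding D_def by measurable
  have C [measurable]: "C \<in> sets M" "C' \<in> sets M"
    unfolding C_def C'_def Dsub by measurable
  have big: "(LINT \<omega>:C|M. Z (j k) \<omega>) - (LINT \<omega>:C'|M. Z (j k) \<omega>) \<ge> e / 2" for k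
  proof -
    let ?Z = "\<lambda>\<omega>. \<bar>Z (j k) \<omega>\<bar>"
    \<comment> \<open>Outside \<open>D k\<close> other shells may contribute to \<open>C\<close> or
      \<open>C'\<close> with the wrong sign, so the right-hand integrand can be as low as
      -\<bar>Z\<bar>; this is why both losses count twice. With losses below \<open>e / 16\<close>
      at least e - 4 * (e / 16) \<ge> e / 2 remains.\<close>
    have "(LINT \<omega>|M. ?Z \<omega> - 2 * (indicat_real (G (P k)) \<omega> * ?Z \<omega>)
          - 2 * (indicat_real (space M - G (P (Suc k))) \<omega> * ?Z \<omega>)) \<le>
        (LINT \<omega>|M. indicat_real C \<omega> *\<^sub>R Z (j k) \<omega> - indicat_real C' \<omega> *\<^sub>R Z (j k) \<omega>)"
    proof (rule integral_mono)
      fix \<omega>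
      assume \<omega>: "\<omega> \<in> space M"
      have c: "\<omega> \<in> C \<longleftrightarrow> Z (j k) \<omega> > 0" "\<omega> \<in> C' \<longleftrightarrow> Z (j k) \<omega> < 0" if "\<omega> \<in> D k"
        using that D_eq unfolding C_def C'_def by blast+
      show "?Z \<omega> - 2 * (indicat_real (G (P k)) \<omega> * ?Z \<omega>)
          - 2 * (indicat_real (space M - G (P (Suc k))) \<omega> * ?Z \<omega>)
          \<le> indicat_real C \<omega> *\<^sub>R Z (j k) \<omega> - indicat_real C' \<omega> *\<^sub>R Z (j k) \<omega>"
      proof (cases "\<omega> \<in> D k")
        case True
        then have "\<omega> \<notin> G (P k)" "\<omega> \<in> G (P (Suc k))" by (auto simp: D_def)
        with c[OF True] \<omega> show ?thesis by (cases "Z (j k) \<omega>" "0 :: real" rule: linorder_cases) simp_all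
      next
        case False
        then have "\<omega> \<in> G (P k) \<or> \<omega> \<in> space M - G (P (Suc k))" using \<omega> by (auto simp: D_def)
        then show ?thesis by (cases "\<omega> \<in> C"; cases "\<omega> \<in> C'") (auto simp: indicator_def)
      qed
    qed (use int setint integrable_mult_indicator[OF _ int] in auto)
    also have "(LINT \<omega>|M. ?Z \<omega> - 2 * (indicat_real (G (P k)) \<omega> * ?Z \<omega>)
          - 2 * (indicat_real (space M - G (P (Suc k))) \<omega> * ?Z \<omega>)) =
        (LINT \<omega>|M. ?Z \<omega>) - 2 * (LINT \<omega>|M. indicat_real (G (P k)) \<omega> * ?Z \<omega>)
          - 2 * (LINT \<omega>|M. indicat_real (space M - G (P (Suc k))) \<omega> * ?Z \<omega>)"
      using int setint by (simp add: Bochner_Integration.integral_diff)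
    also have "(LINT \<omega>|M. indicat_real C \<omega> *\<^sub>R Z (j k) \<omega> - indicat_real C' \<omega> *\<^sub>R Z (j k) \<omega>) =
        (LINT \<omega>:C|M. Z (j k) \<omega>) - (LINT \<omega>:C'|M. Z (j k) \<omega>)"
      unfolding set_lebesgue_integral_def
      using integrable_mult_indicator[OF _ int] by (intro Bochner_Integration.integral_diff) auto
    finally show ?thesis
      using J(2)[of "P k"] J(3)[of "P k"] Q(2)[of "P k"] e by (simp add: j_def P_Suc)
  qed
  have "filterlim j at_top sequentially"
  proof (rule filterlim_at_top_mono)
    show "filterlim P at_top sequentially" using P by (rule filterlim_subseq)
    show "\<forall>\<^sub>F k in sequentially. P k \<le> j k" using J(1) by (simp add: j_def)
  qed
  then have "(\<lambda>k. (LINT \<omega>:C|M. Z (j k) \<omega>) - (LINT \<omega>:C'|M. Z (j k) \<omega>)) \<longlonglongrightarrow> 0 - 0"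
    using C by (intro tendsto_diff filterlim_compose[OF sets]) auto
  then have "e / 2 \<le> 0 - 0"
    by (rule tendsto_lowerbound[OF _ always_eventually[OF allI[OF big]]]) simp
  then show False using e by simp
qed


section \<open>Grids and step functions\<close>

text \<open>Containing 0 keeps the set in \<open>grid_floor\<close> nonempty for every s \<ge> 0, so
  that its \<open>Max\<close> is meaningful.\<close>

definition grid :: "real set \<Rightarrow> bool" where
  "grid T \<longleftrightarrow> finite T \<and> 0 \<in> T \<and> T \<subseteq> {0..1}"

text \<open>Rounding goes down so that the cells are half-open on the same side as the orthants of
  \<open>is_cadlag\<close>; every function of the rounded argument is then cadlag.\<close>

definition grid_floor :: "real set \<Rightarrow> real \<Rightarrow> real" where
  "grid_floor T s = Max {r \<in> T. r \<le> s}"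

definition grid_floor_vec :: "real set \<Rightarrow> real ^ 'n \<Rightarrow> real ^ 'n" where
  "grid_floor_vec T t = (\<chi> i. grid_floor T (t $ i))"

definition grid_points :: "real set \<Rightarrow> (real ^ 'n) set" where
  "grid_points T = {r. \<forall>i. r $ i \<in> T}"

lemma unit_cubeD: "t \<in> unit_cube \<Longrightarrow> 0 \<le> t $ i" "t \<in> unit_cube \<Longrightarrow> t $ i \<le> 1"
  by (auto simp: unit_cube_def)

lemma grid_floor:
  assumes "grid T" "0 \<le> s"
  shows grid_floor_in: "grid_floor T s \<in> T"
    and grid_floor_le: "grid_floor T s \<le> s"
    and grid_floor_ge: "r \<in> T \<Longrightarrow> r \<le> s \<Longrightarrow> r \<le> grid_floor T s"
proof -
  have fin: "finite {r \<in> T. r \<le> s}" and "0 \<in> {r \<in> T. r \<le> s}" using assms by (auto simp: grid_def)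
  then have "Max {r \<in> T. r \<le> s} \<in> {r \<in> T. r \<le> s}" by (intro Max_in) auto
  then show "grid_floor T s \<in> T" "grid_floor T s \<le> s" by (auto simp: grid_floor_def)
  show "r \<in> T \<Longrightarrow> r \<le> s \<Longrightarrow> r \<le> grid_floor T s"
    unfolding grid_floor_def using fin by (intro Max_ge) auto
qed

lemma grid_floor_vec_in:
  assumes "grid T" "t \<in> unit_cube"
  shows "grid_floor_vec T t \<in> grid_points T" "grid_floor_vec T t \<in> unit_cube"
proof -
  have "grid_floor T (t $ i) \<in> T" for i using grid_floor_in[OF assms(1) unit_cubeD(1)[OF assms(2)]] .
  then show "grid_floor_vec T t \<in> grid_points T" "grid_floor_vec T t \<in> unit_cube"
    using assms(1) by (auto simp: grid_points_def grid_floor_vec_def unit_cube_def grid_def subset_iff)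
qed

lemma finite_grid_points:
  assumes "grid T"
  shows "finite (grid_points T :: (real ^ 'n) set)"
proof (rule finite_subset)
  show "grid_points T \<subseteq> (\<lambda>g. \<chi> i. g i) ` (UNIV \<rightarrow>\<^sub>E T :: ('n \<Rightarrow> real) set)"
  proof
    fix r :: "real ^ 'n"
    assume "r \<in> grid_points T"
    then show "r \<in> (\<lambda>g. \<chi> i. g i) ` (UNIV \<rightarrow>\<^sub>E T :: ('n \<Rightarrow> real) set)"
      by (intro image_eqI[of _ _ "\<lambda>i. r $ i"]) (auto simp: grid_points_def)
  qed
  show "finite ((\<lambda>g. \<chi> i. g i) ` (UNIV \<rightarrow>\<^sub>E T :: ('n \<Rightarrow> real) set) :: (real ^ 'n) set)"
    using assms by (intro finite_imageI finite_PiE) (auto simp: grid_def)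
qed

lemma grid_points_subset: "grid T \<Longrightarrow> grid_points T \<subseteq> unit_cube"
  by (auto simp: grid_points_def unit_cube_def grid_def)

lemma eventually_grid_floor:
  assumes "grid T" "J = {t..1} \<or> J = {0..<t}"
  shows "\<exists>c. \<forall>\<^sub>F s in nhds t. s \<in> J \<longrightarrow> grid_floor T s = c"
proof -
  have fin: "finite {r \<in> T. P r}" for P using assms(1) by (auto simp: grid_def)
  show ?thesis
    using assms(2)
  proof
    assume J: "J = {t..1}"
    have "\<forall>\<^sub>F s in nhds t. \<forall>r\<in>{r \<in> T. t < r}. s < r"
    proof (intro eventually_ball_finite fin ballI)
      fix r
      assume "r \<in> {r \<in> T. t < r}"
      then show "\<forall>\<^sub>F s in nhds t. s < r" using eventually_nhds_in_open[of "{..<r}" t] by simp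
    qed
    then have "\<forall>\<^sub>F s in nhds t. s \<in> J \<longrightarrow> grid_floor T s = Max {r \<in> T. r \<le> t}"
    proof eventually_elim
      case (elim s)
      have "{r \<in> T. r \<le> s} = {r \<in> T. r \<le> t}" if "t \<le> s" using elim that by force
      then show ?case by (simp add: J grid_floor_def)
    qed
    then show ?thesis by blast
  next
    assume J: "J = {0..<t}"
    have "\<forall>\<^sub>F s in nhds t. \<forall>r\<in>{r \<in> T. r < t}. r < s"
    proof (intro eventually_ball_finite fin ballI)
      fix r
      assume "r \<in> {r \<in> T. r < t}"
      then show "\<forall>\<^sub>F s in nhds t. r < s" using eventually_nhds_in_open[of "{r<..}" t] by simp
    qed
    \<comment> \<open>For t \<le> 0 this is the \<open>Max\<close> of an empty set, but then J is
      empty as well.\<close>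
    then have "\<forall>\<^sub>F s in nhds t. s \<in> J \<longrightarrow> grid_floor T s = Max {r \<in> T. r < t}"
    proof eventually_elim
      case (elim s)
      have "{r \<in> T. r \<le> s} = {r \<in> T. r < t}" if "s < t" using elim that by force
      then show ?case by (simp add: J grid_floor_def)
    qed
    then show ?thesis by blast
  qed
qed

section \<open>Step functions on a grid\<close>

definition grid_step :: "real set \<Rightarrow> (real ^ 'n \<Rightarrow> real) \<Rightarrow> 'n::finite cadlag" where
  "grid_step T \<phi> = Cadlag (\<lambda>t. if t \<in> unit_cube then \<phi> (grid_floor_vec T t) else 0)"

lemma cadlag_apply_grid_step:
  assumes "grid T"
  shows "cadlag_apply (grid_step T \<phi>) t = (if t \<in> unit_cube then \<phi> (grid_floor_vec T t) else 0)"
proof -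
  let ?f = "\<lambda>t :: real ^ 'a. if t \<in> unit_cube then \<phi> (grid_floor_vec T t) else 0"
  have "is_cadlag ?f"
    unfolding is_cadlag_def
  proof (intro ballI allI impI)
    fix t :: "real ^ 'a" and J :: "'a \<Rightarrow> real set"
    assume t: "t \<in> unit_cube"
      and J: "\<forall>i. J i = {t $ i..1} \<or> (0 < t $ i \<and> J i = {0..<t $ i})"
    have "\<exists>c. \<forall>\<^sub>F s in nhds (t $ i). s \<in> J i \<longrightarrow> grid_floor T s = c" for i
      using J by (intro eventually_grid_floor[OF assms]) auto
    then obtain c where c: "\<And>i. \<forall>\<^sub>F s in nhds (t $ i). s \<in> J i \<longrightarrow> grid_floor T s = c i" by metis
    have "\<forall>\<^sub>F s in nhds t. \<forall>i. s $ i \<in> J i \<longrightarrow> grid_floor T (s $ i) = c i"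
      by (intro eventually_all_finite eventually_compose_filterlim[OF c] tendsto_vec_nth filterlim_ident)
    then have "\<forall>\<^sub>F s in inf (nhds t) (principal {s. \<forall>i. s $ i \<in> J i}). ?f s = \<phi> (\<chi> i. c i)"
      unfolding eventually_inf_principal
    proof eventually_elim
      case (elim s)
      have "s \<in> unit_cube" if "\<forall>i. s $ i \<in> J i"
        unfolding unit_cube_def mem_Collect_eq
      proof
        fix i
        show "0 \<le> s $ i \<and> s $ i \<le> 1"
          using J[rule_format, of i] that[rule_format, of i] unit_cubeD[OF t, of i] by auto
      qed
      then show ?case using elim by (auto simp: grid_floor_vec_def)
    qed
    then show "\<exists>L. (?f \<longlongrightarrow> L) (inf (nhds t) (principal {s. \<forall>i. s $ i \<in> J i}))"
      by (intro exI[of _ "\<phi> (\<chi> i. c i)"] tendsto_eventually)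
  qed
  then show ?thesis unfolding grid_step_def by (subst Cadlag_inverse) auto
qed

lemma norm_grid_step_le:
  fixes \<phi> :: "real ^ 'n \<Rightarrow> real"
  assumes T: "grid T" and \<phi>: "\<And>r. r \<in> grid_points T \<Longrightarrow> \<bar>\<phi> r\<bar> \<le> K"
  shows "norm (grid_step T \<phi> :: 'n::finite cadlag) \<le> K"
  by (rule norm_cadlag_leI) (simp add: cadlag_apply_grid_step[OF T] \<phi> grid_floor_vec_in[OF T])

lemma cadlag_apply_sum: "cadlag_apply (sum f A) t = (\<Sum>k\<in>A. cadlag_apply (f k) t)"
  by (induction A rule: infinite_finite_induct) (simp_all add: cadlag_apply_simps)

text \<open>A linear functional thereby acts on the step functions of one grid as a finite weighted
  sum of the values of \<phi> at the grid points.\<close>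

lemma grid_step_eq_sum:
  fixes \<phi> :: "real ^ 'n \<Rightarrow> real"
  assumes T: "grid T"
  shows "(grid_step T \<phi> :: 'n::finite cadlag) = (\<Sum>r\<in>grid_points T. \<phi> r *\<^sub>R grid_step T (indicat_real {r}))"
proof (rule cadlag_eqI)
  fix t :: "real ^ 'n"
  assume t: "t \<in> unit_cube"
  have "(\<Sum>r\<in>grid_points T. \<phi> r * indicat_real {r} (grid_floor_vec T t)) =
      (\<Sum>r\<in>grid_points T. if r = grid_floor_vec T t then \<phi> r else 0)"
    by (intro sum.cong) (auto simp: indicator_def)
  then show "cadlag_apply (grid_step T \<phi>) t =
      cadlag_apply (\<Sum>r\<in>grid_points T. \<phi> r *\<^sub>R grid_step T (indicat_real {r})) t"
    using grid_floor_vec_in(1)[OF T t] t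
    by (simp add: cadlag_apply_sum cadlag_apply_simps cadlag_apply_grid_step[OF T] finite_grid_points[OF T])
qed

abbreviation grid_proj :: "real set \<Rightarrow> 'n::finite cadlag \<Rightarrow> 'n cadlag" where
  "grid_proj T f \<equiv> grid_step T (cadlag_apply f)"

lemma norm_grid_proj_le: "grid T \<Longrightarrow> norm (grid_proj T f) \<le> norm f"
  by (intro norm_grid_step_le cadlag_apply_le_norm)

lemma grid_proj_diff: "grid T \<Longrightarrow> grid_proj T (f - g) = grid_proj T f - grid_proj T g"
  by (rule cadlag_eqI) (simp add: cadlag_apply_grid_step cadlag_apply_simps)

section \<open>Uniform density of step functions\<close>

text \<open>The limits in the finitely many orthants at t are approached on a common ball. Two
  points on the same side of t in every coordinate lie in one orthant, so both values are within
  \<open>e / 2\<close> of the same limit.\<close>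

lemma is_cadlag_oscillation:
  fixes f :: "real ^ 'n \<Rightarrow> real"
  assumes f: "is_cadlag f" and t: "t \<in> unit_cube" and e: "e > 0"
  shows "\<exists>d>0. \<forall>s\<in>unit_cube. \<forall>s'\<in>unit_cube.
    (\<forall>i. \<bar>s $ i - t $ i\<bar> < d \<and> \<bar>s' $ i - t $ i\<bar> < d \<and> (s $ i < t $ i \<longleftrightarrow> s' $ i < t $ i)) \<longrightarrow>
    \<bar>f s - f s'\<bar> \<le> e"
proof -
  \<comment> \<open>On a face t_i = 0 there is no left side; falling back to [t_i, 1] makes
    \<open>J S\<close> an admissible choice for every S.\<close>
  define J :: "'n set \<Rightarrow> 'n \<Rightarrow> real set"
    where "J = (\<lambda>S i. if i \<in> S \<and> 0 < t $ i then {0..<t $ i} else {t $ i..1})"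
  have "\<exists>L. \<forall>\<^sub>F s in nhds t. (\<forall>i. s $ i \<in> J S i) \<longrightarrow> dist (f s) L < e / 2" for S
  proof -
    have "J S i = {t $ i..1} \<or> (0 < t $ i \<and> J S i = {0..<t $ i})" for i
      by (auto simp: J_def)
    then obtain L where "(f \<longlongrightarrow> L) (inf (nhds t) (principal {s. \<forall>i. s $ i \<in> J S i}))"
      using is_cadlagD[OF f t, of "J S"] by blast
    from tendstoD[OF this, of "e / 2"] e show ?thesis unfolding eventually_inf_principal by auto
  qed
  then have "\<exists>L. \<forall>S. \<forall>\<^sub>F s in nhds t. (\<forall>i. s $ i \<in> J S i) \<longrightarrow> dist (f s) (L S) < e / 2"
    by (intro choice allI)
  then obtain L where L: "\<And>S. \<forall>\<^sub>F s in nhds t. (\<forall>i. s $ i \<in> J S i) \<longrightarrow> dist (f s) (L S) < e / 2"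
    by blast
  have "\<forall>\<^sub>F s in nhds t. \<forall>S\<in>UNIV. (\<forall>i. s $ i \<in> J S i) \<longrightarrow> dist (f s) (L S) < e / 2"
    by (intro eventually_ball_finite ballI L finite)
  then obtain d where d: "d > 0"
    "\<And>s S. dist s t < d \<Longrightarrow> (\<forall>i. s $ i \<in> J S i) \<Longrightarrow> dist (f s) (L S) < e / 2"
    unfolding eventually_nhds_metric by auto
  \<comment> \<open>The distance is at most the sum of the coordinate differences, of which there
    are \<open>CARD('n)\<close>.\<close>
  have near: "dist s t < d" if "\<forall>i. \<bar>s $ i - t $ i\<bar> < d / CARD('n)" for s
  proof -
    have "dist s t \<le> (\<Sum>i\<in>UNIV. \<bar>(s - t) $ i\<bar>)" unfolding dist_norm by (rule norm_le_l1_cart)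
    also have "\<dots> < (\<Sum>i\<in>(UNIV :: 'n set). d / CARD('n))"
      using that by (intro sum_strict_mono) auto
    finally show ?thesis by simp
  qed
  have "\<bar>f s - f s'\<bar> \<le> e"
    if s: "s \<in> unit_cube" "s' \<in> unit_cube"
      and *: "\<forall>i. \<bar>s $ i - t $ i\<bar> < d / CARD('n) \<and> \<bar>s' $ i - t $ i\<bar> < d / CARD('n) \<and> (s $ i < t $ i \<longleftrightarrow> s' $ i < t $ i)"
    for s s'
  proof -
    define S where "S = {i. s $ i < t $ i}"
    have "s $ i \<in> J S i \<and> s' $ i \<in> J S i" for i
    proof (cases "s $ i < t $ i")
      case True
      then have "0 < t $ i" using unit_cubeD(1)[OF s(1), of i] by linarith
      then have "J S i = {0..<t $ i}" "s' $ i < t $ i"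
        using True * by (auto simp: J_def S_def)
      then show ?thesis using True unit_cubeD(1)[OF s(1), of i] unit_cubeD(1)[OF s(2), of i] by simp
    next
      case False
      then have "J S i = {t $ i..1}" "\<not> s' $ i < t $ i" using * by (auto simp: J_def S_def)
      then show ?thesis using False unit_cubeD(2)[OF s(1), of i] unit_cubeD(2)[OF s(2), of i] by simp
    qed
    then have "dist (f s) (L S) < e / 2" "dist (f s') (L S) < e / 2"
      using * by (intro d(2) near; blast)+
    then show ?thesis unfolding dist_real_def by linarith
  qed
  moreover have "d / CARD('n) > 0" using d(1) by simp
  ultimately show ?thesis by blast
qed

text \<open>Compactness leaves finitely many centres t. The coordinates t_i in the grid prevent
  rounding from crossing t_i from the right to the left; the points t_i - d t / 2 keep a rounded
  point within d t if it started less than d t / 2 to the left of t_i. A point and its rounding thus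
  lie in one orthant near t, where f oscillates by at most e. A point t_i - d t / 2 below 0 is
  replaced by the grid point 0.\<close>

lemma grid_proj_dense:
  fixes f :: "'n::finite cadlag"
  assumes e: "e > 0"
  shows "\<exists>T. grid T \<and> norm (f - grid_proj T f) \<le> e"
proof -
  let ?f = "cadlag_apply f"
  have "\<forall>t\<in>unit_cube. \<exists>d>0. \<forall>s\<in>unit_cube. \<forall>s'\<in>unit_cube.
    (\<forall>i. \<bar>s $ i - t $ i\<bar> < d \<and> \<bar>s' $ i - t $ i\<bar> < d \<and> (s $ i < t $ i \<longleftrightarrow> s' $ i < t $ i)) \<longrightarrow>
    \<bar>?f s - ?f s'\<bar> \<le> e"
    using is_cadlag_oscillation[OF cadlag_apply_is_cadlag _ e] by blast
  then obtain d where d: "\<And>t. t \<in> unit_cube \<Longrightarrow> d t > 0"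
    and osc: "\<And>t s s'. t \<in> unit_cube \<Longrightarrow> s \<in> unit_cube \<Longrightarrow> s' \<in> unit_cube \<Longrightarrow>
      (\<And>i. \<bar>s $ i - t $ i\<bar> < d t \<and> \<bar>s' $ i - t $ i\<bar> < d t \<and> (s $ i < t $ i \<longleftrightarrow> s' $ i < t $ i)) \<Longrightarrow>
      \<bar>?f s - ?f s'\<bar> \<le> e"
    by metis
  define U where "U = (\<lambda>t. {s :: real ^ 'n. \<forall>i. \<bar>s $ i - t $ i\<bar> < d t / 2})"
  have "open (U t)" for t
  proof -
    have "U t = (\<Inter>i. {s. \<bar>s $ i - t $ i\<bar> < d t / 2})" by (auto simp: U_def)
    then show ?thesis by (auto intro!: open_INT open_Collect_less continuous_intros)
  qed
  then obtain C where C: "C \<subseteq> unit_cube" "finite C" "unit_cube \<subseteq> (\<Union>t\<in>C. U t)"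
    using compactE_image[OF compact_unit_cube, of unit_cube U] d by (force simp: U_def)
  define T where "T = insert 0 (((\<lambda>(t, i). t $ i) ` (C \<times> UNIV) \<union> (\<lambda>(t, i). t $ i - d t / 2) ` (C \<times> UNIV)) \<inter> {0..1})"
  have T: "grid T" unfolding T_def grid_def using C(2) by auto
  have T1: "t $ i \<in> T" if "t \<in> C" for t i
    using that C(1) unit_cubeD[of t i] by (auto simp: T_def)
  have T2: "t $ i - d t / 2 \<in> T" if "t \<in> C" "0 \<le> t $ i - d t / 2" for t i
    using that C(1) unit_cubeD[of t i] d[of t] by (force simp: T_def)
  have "norm (f - grid_proj T f) \<le> e"
  proof (rule norm_cadlag_leI)
    fix s :: "real ^ 'n"
    assume s: "s \<in> unit_cube"
    then obtain t where t: "t \<in> C" "s \<in> U t" using C(3) by blast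
    have tc: "t \<in> unit_cube" using t C by blast
    let ?r = "grid_floor_vec T s"
    have "\<bar>?f s - ?f ?r\<bar> \<le> e"
    proof (rule osc[OF tc s grid_floor_vec_in(2)[OF T s]])
      fix i
      have near: "\<bar>s $ i - t $ i\<bar> < d t / 2" using t(2) by (auto simp: U_def)
      note gf = grid_floor_in[OF T unit_cubeD(1)[OF s, of i]] grid_floor_le[OF T unit_cubeD(1)[OF s, of i]]
        grid_floor_ge[OF T unit_cubeD(1)[OF s, of i]]
      have r: "?r $ i = grid_floor T (s $ i)" by (simp add: grid_floor_vec_def)
      have dt: "d t > 0" using d[OF tc] .
      show "\<bar>s $ i - t $ i\<bar> < d t \<and> \<bar>?r $ i - t $ i\<bar> < d t \<and> (s $ i < t $ i \<longleftrightarrow> ?r $ i < t $ i)"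
      proof (cases "t $ i \<le> s $ i")
        case True
        then have "t $ i \<le> ?r $ i" using gf(3) T1[OF t(1)] r by simp
        then show ?thesis using True gf(2) near dt r by (auto simp: abs_less_iff)
      next
        case False
        have "?r $ i \<ge> t $ i - d t / 2"
        proof (cases "0 \<le> t $ i - d t / 2")
          case True
          show ?thesis unfolding r using near by (intro gf(3) T2[OF t(1) True]) linarith
        next
          case False
          then show ?thesis using gf(1) T r by (auto simp: grid_def)
        qed
        then show ?thesis using False gf(2) near dt r by (auto simp: abs_less_iff)
      qed
    qed
    then show "\<bar>cadlag_apply (f - grid_proj T f) s\<bar> \<le> e"
      using s by (simp add: cadlag_apply_simps cadlag_apply_grid_step[OF T])
  qed
  then show ?thesis using T by blast
qed

section \<open>Mass of a functional near hyperplanes\<close>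

definition slab :: "'n \<Rightarrow> real \<Rightarrow> real \<Rightarrow> (real ^ 'n) set" where
  "slab i s \<epsilon> = {t. s \<le> t $ i \<and> t $ i < s + \<epsilon>}"

text \<open>
  As \<open>g\<close> may be replaced by \<open>- g\<close>, the following says that the variation of \<open>\<xi>\<close> on \<open>U\<close> is at most
  \<open>\<delta>\<close>.  The slabs shrinking to \<open>t\<^sub>i = s\<close> lie on the right of \<open>s\<close>, so an atom is mass of \<open>\<xi>\<close> on the
  hyperplane \<open>t\<^sub>i = s\<close> itself, not on its left limit copy.
\<close>

definition charge_le :: "('n::finite cadlag \<Rightarrow>\<^sub>L real) \<Rightarrow> (real ^ 'n) set \<Rightarrow> real \<Rightarrow> bool" where
  "charge_le \<xi> U \<delta> \<longleftrightarrow>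
     (\<forall>g. norm g \<le> 1 \<longrightarrow> (\<forall>t. t \<notin> U \<longrightarrow> cadlag_apply g t = 0) \<longrightarrow> blinfun_apply \<xi> g \<le> \<delta>)"

text \<open>The slab is half-open like the cells, so its indicator is a step function for the grid
  of its two faces, and products of cadlag functions are cadlag. An upper face beyond 1 does not
  meet the cube and is dropped from the grid.\<close>

lemma cadlag_restrict_slab:
  fixes g :: "'n::finite cadlag"
  assumes s: "s \<in> {0..1}" and e: "\<epsilon> > 0"
  shows "\<exists>h. \<forall>t. cadlag_apply h t = indicat_real (slab i s \<epsilon>) t * cadlag_apply g t"
proof -
  define T where "T = insert 0 ({s, s + \<epsilon>} \<inter> {0..1})"
  have T: "grid T" by (auto simp: T_def grid_def)
  have iff: "grid_floor_vec T t \<in> slab i s \<epsilon> \<longleftrightarrow> t \<in> slab i s \<epsilon>" if t: "t \<in> unit_cube" for t :: "real ^ 'n"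
  proof -
    note gf = grid_floor_in[OF T unit_cubeD(1)[OF t, of i]] grid_floor_le[OF T unit_cubeD(1)[OF t, of i]]
        grid_floor_ge[OF T unit_cubeD(1)[OF t, of i]]
    have "s \<in> T" using s by (simp add: T_def)
    then have "s \<le> grid_floor T (t $ i) \<longleftrightarrow> s \<le> t $ i" using gf(2) gf(3)[of s] by auto
    moreover have "grid_floor T (t $ i) < s + \<epsilon> \<longleftrightarrow> t $ i < s + \<epsilon>"
    proof (cases "s + \<epsilon> \<le> 1")
      case True
      then have "s + \<epsilon> \<in> T" using s e by (simp add: T_def)
      then show ?thesis using gf(2) gf(3)[of "s + \<epsilon>"] by force
    next
      case False
      then show ?thesis using unit_cubeD(2)[OF t, of i] gf(2) by auto
    qed
    ultimately show ?thesis by (simp add: slab_def grid_floor_vec_def)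
  qed
  let ?I = "grid_step T (indicat_real (slab i s \<epsilon>)) :: 'n cadlag"
  have "is_cadlag (\<lambda>t. cadlag_apply ?I t * cadlag_apply g t)"
    by (rule is_cadlag_combine[OF cadlag_apply_is_cadlag[of ?I] cadlag_apply_is_cadlag[of g]])
      (blast intro: tendsto_mult)
  then have "cadlag_apply (Cadlag (\<lambda>t. cadlag_apply ?I t * cadlag_apply g t)) =
      (\<lambda>t. cadlag_apply ?I t * cadlag_apply g t)"
    by (intro Cadlag_inverse) (simp add: cadlag_apply_outside)
  moreover have "cadlag_apply ?I t * cadlag_apply g t = indicat_real (slab i s \<epsilon>) t * cadlag_apply g t" for t
    by (cases "t \<in> unit_cube") (auto simp: cadlag_apply_grid_step[OF T] cadlag_apply_outside indicator_def iff)
  ultimately show ?thesis by metis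
qed

text \<open>A test function on the union splits into its restriction to the slab and a remainder
  living on U, both of norm at most 1. One of the sets is a slab in order that the restriction stays
  in the space.\<close>

lemma charge_le_slab_Un:
  fixes \<xi> :: "'n::finite cadlag \<Rightarrow>\<^sub>L real"
  assumes s: "s \<in> {0..1}" "\<epsilon> > 0" and a: "charge_le \<xi> (slab i s \<epsilon>) a" and b: "charge_le \<xi> U b"
  shows "charge_le \<xi> (slab i s \<epsilon> \<union> U) (a + b)"
  unfolding charge_le_def
proof (intro allI impI)
  fix g :: "'n cadlag"
  assume g: "norm g \<le> 1" "\<forall>t. t \<notin> slab i s \<epsilon> \<union> U \<longrightarrow> cadlag_apply g t = 0"
  obtain h where h: "\<And>t. cadlag_apply h t = indicat_real (slab i s \<epsilon>) t * cadlag_apply g t"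
    using cadlag_restrict_slab[OF s, of i g] by blast
  have le: "\<bar>cadlag_apply g t\<bar> \<le> 1" for t using cadlag_apply_le_norm[of g t] g(1) by linarith
  have "blinfun_apply \<xi> h \<le> a"
    by (rule a[unfolded charge_le_def, rule_format])
      (use le in \<open>auto simp: h indicator_def intro!: norm_cadlag_leI\<close>)
  moreover have "blinfun_apply \<xi> (g - h) \<le> b"
    by (rule b[unfolded charge_le_def, rule_format])
      (use le g(2) in \<open>auto simp: h cadlag_apply_simps indicator_def intro!: norm_cadlag_leI\<close>)
  ultimately show "blinfun_apply \<xi> g \<le> a + b" by (simp add: blinfun.diff_right)
qed

lemma charge_le_finite_slabs:
  fixes \<xi> :: "'n::finite cadlag \<Rightarrow>\<^sub>L real"
  assumes "finite P"
    and "\<And>p. p \<in> P \<Longrightarrow> snd p \<in> {0..1} \<and> \<epsilon> p > 0 \<and> charge_le \<xi> (slab (fst p) (snd p) (\<epsilon> p)) \<delta>"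
  shows "charge_le \<xi> (\<Union>p\<in>P. slab (fst p) (snd p) (\<epsilon> p)) (real (card P) * \<delta>)"
  using assms
proof (induction P rule: finite_induct)
  case empty
  have "g = 0" if "\<forall>t. cadlag_apply g t = 0" for g :: "'n cadlag"
    using that by (intro cadlag_eqI) (simp add: cadlag_apply_simps)
  then have "blinfun_apply \<xi> g = 0" if "\<forall>t. cadlag_apply g t = 0" for g
    using that by (metis blinfun.zero_right)
  then show ?case by (auto simp: charge_le_def)
next
  case (insert p P)
  have "charge_le \<xi> (slab (fst p) (snd p) (\<epsilon> p) \<union> (\<Union>p\<in>P. slab (fst p) (snd p) (\<epsilon> p))) (\<delta> + real (card P) * \<delta>)"
    using insert by (intro charge_le_slab_Un) auto
  then show ?case using insert by (simp add: algebra_simps)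
qed

definition atom :: "('n::finite cadlag \<Rightarrow>\<^sub>L real) \<Rightarrow> 'n \<Rightarrow> real \<Rightarrow> bool" where
  "atom \<xi> i s \<longleftrightarrow> (\<exists>\<delta>>0. \<forall>\<epsilon>>0. \<not> charge_le \<xi> (slab i s \<epsilon>) \<delta>)"

text \<open>N such hyperplanes lie in disjoint slabs, each with a test function on which \<xi>
  exceeds \<delta>. Their sum still has supremum norm at most 1, so N * \<delta> \<le>
  \<open>norm \<xi>\<close>.\<close>

lemma finite_large_atoms:
  fixes \<xi> :: "'n::finite cadlag \<Rightarrow>\<^sub>L real"
  assumes \<delta>: "\<delta> > 0"
  shows "finite {s. \<forall>\<epsilon>>0. \<not> charge_le \<xi> (slab i s \<epsilon>) \<delta>}" (is "finite ?A")
proof (rule ccontr)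
  assume "infinite ?A"
  obtain N :: nat where N: "norm \<xi> < real N * \<delta>"
    using reals_Archimedean3[OF \<delta>] by blast
  obtain B where B: "finite B" "card B = N" "B \<subseteq> ?A"
    using infinite_arbitrarily_large[OF \<open>infinite ?A\<close>] by blast
  define X where "X = (\<lambda>(s, s'). s' - s) ` {(s, s') \<in> B \<times> B. s < s'}"
  \<comment> \<open>The inserted 1 supplies a value when B has fewer than two points.\<close>
  define \<epsilon> where "\<epsilon> = Min (insert 1 X)"
  have fin: "finite X"
    unfolding X_def by (intro finite_imageI, rule finite_subset[of _ "B \<times> B"]) (auto simp: B(1))
  moreover have "x > 0" if "x \<in> X" for x using that by (auto simp: X_def)
  ultimately have "\<epsilon> > 0" by (simp add: \<epsilon>_def)
  have gap: "s + \<epsilon> \<le> s'" if "s \<in> B" "s' \<in> B" "s < s'" for s s'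
  proof -
    have "s' - s \<in> X"
      unfolding X_def using that by (intro image_eqI[of _ _ "(s, s')"]) auto
    then have "\<epsilon> \<le> s' - s" unfolding \<epsilon>_def using fin by (intro Min_le) auto
    then show ?thesis by simp
  qed
  have disj: "s = s'" if "s \<in> B" "s' \<in> B" "t \<in> slab i s \<epsilon>" "t \<in> slab i s' \<epsilon>" for s s' t
    using that gap[of s s'] gap[of s' s] by (cases s s' rule: linorder_cases) (auto simp: slab_def)
  have "\<exists>g. norm g \<le> 1 \<and> (\<forall>t. t \<notin> slab i s \<epsilon> \<longrightarrow> cadlag_apply g t = 0) \<and> blinfun_apply \<xi> g > \<delta>" if "s \<in> B" for s
    using that B(3) \<open>\<epsilon> > 0\<close> unfolding charge_le_def by (force simp: not_le)
  then obtain g where g: "\<And>s. s \<in> B \<Longrightarrow> norm (g s) \<le> 1"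
    "\<And>s t. s \<in> B \<Longrightarrow> t \<notin> slab i s \<epsilon> \<Longrightarrow> cadlag_apply (g s) t = 0"
    "\<And>s. s \<in> B \<Longrightarrow> blinfun_apply \<xi> (g s) > \<delta>"
    by metis
  have "norm (\<Sum>s\<in>B. g s) \<le> 1"
  proof (rule norm_cadlag_leI)
    fix t
    show "\<bar>cadlag_apply (\<Sum>s\<in>B. g s) t\<bar> \<le> 1"
    proof (cases "\<exists>s\<in>B. t \<in> slab i s \<epsilon>")
      case True
      then obtain s where s: "s \<in> B" "t \<in> slab i s \<epsilon>" by blast
      have "(\<Sum>s'\<in>B. cadlag_apply (g s') t) = cadlag_apply (g s) t"
      proof -
        have "cadlag_apply (g s') t = 0" if "s' \<in> B - {s}" for s'
          using that s disj g(2) by blast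
        then show ?thesis by (subst sum.remove[OF B(1) s(1)]) simp
      qed
      then show ?thesis using cadlag_apply_le_norm[of "g s" t] g(1)[OF s(1)] by (simp add: cadlag_apply_sum)
    next
      case False
      then show ?thesis using g(2) by (simp add: cadlag_apply_sum)
    qed
  qed
  then have "blinfun_apply \<xi> (\<Sum>s\<in>B. g s) \<le> norm \<xi>"
    using norm_blinfun[of \<xi> "\<Sum>s\<in>B. g s"] by (smt (verit) mult_left_le norm_ge_zero real_norm_def)
  moreover have "real N * \<delta> \<le> blinfun_apply \<xi> (\<Sum>s\<in>B. g s)"
    using sum_mono[of B "\<lambda>_. \<delta>" "\<lambda>s. blinfun_apply \<xi> (g s)"] g(3) B(2)
    by (simp add: blinfun.sum_right less_imp_le)
  ultimately show False using N by simp
qed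

lemma countable_atoms:
  fixes \<xi> :: "'n::finite cadlag \<Rightarrow>\<^sub>L real"
  shows "countable {s. atom \<xi> i s}"
proof (rule countable_subset)
  show "{s. atom \<xi> i s} \<subseteq> (\<Union>k::nat. {s. \<forall>\<epsilon>>0. \<not> charge_le \<xi> (slab i s \<epsilon>) (inverse (Suc k))})"
  proof
    fix s
    assume "s \<in> {s. atom \<xi> i s}"
    then obtain \<delta> where \<delta>: "\<delta> > 0" "\<forall>\<epsilon>>0. \<not> charge_le \<xi> (slab i s \<epsilon>) \<delta>" by (auto simp: atom_def)
    obtain k where "inverse (real (Suc k)) < \<delta>" using reals_Archimedean[OF \<delta>(1)] by blast
    then have "charge_le \<xi> U (inverse (Suc k)) \<Longrightarrow> charge_le \<xi> U \<delta>" for U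
      unfolding charge_le_def by force
    then show "s \<in> (\<Union>k::nat. {s. \<forall>\<epsilon>>0. \<not> charge_le \<xi> (slab i s \<epsilon>) (inverse (Suc k))})"
      using \<delta>(2) by blast
  qed
  show "countable (\<Union>k::nat. {s. \<forall>\<epsilon>>0. \<not> charge_le \<xi> (slab i s \<epsilon>) (inverse (Suc k))})"
    by (rule countable_UN[OF _ countable_finite[OF finite_large_atoms]]) simp_all
qed


section \<open>Functionals as limits of quadratures\<close>

text \<open>
  Rounding down to the grid \<open>T\<close> crosses a jump \<open>r\<close> of the step function only for arguments between \<open>r\<close>
  and the next grid point, and not at all if \<open>r \<in> T\<close>.
\<close>

lemma grid_proj_error_support:
  fixes g :: "'n::finite cadlag"
  assumes T: "grid T" and S: "grid S"
    and D: "S \<inter> D \<subseteq> T"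
    and q: "\<And>i r. r \<in> S - D \<Longrightarrow> \<exists>q\<in>T. r < q \<and> q < r + \<epsilon> (i, r)"
    and t: "t \<notin> (\<Union>p\<in>UNIV \<times> (S - D). slab (fst p) (snd p) (\<epsilon> p))"
  shows "cadlag_apply (grid_step S \<phi> - grid_proj T (grid_step S \<phi>)) t = 0"
proof (cases "t \<in> unit_cube")
  case True
  let ?r = "grid_floor_vec T t"
  have "grid_floor S (?r $ i) = grid_floor S (t $ i)" for i
  proof (rule ccontr)
    assume ne: "grid_floor S (?r $ i) \<noteq> grid_floor S (t $ i)"
    note t0 = unit_cubeD(1)[OF True, of i]
    note r0 = unit_cubeD(1)[OF grid_floor_vec_in(2)[OF T True], of i]
    have r: "?r $ i = grid_floor T (t $ i)" by (simp add: grid_floor_vec_def)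
    define s where "s = grid_floor S (t $ i)"
    have s: "s \<in> S" "s \<le> t $ i" using grid_floor_in[OF S t0] grid_floor_le[OF S t0] by (auto simp: s_def)
    have rt: "?r $ i \<le> t $ i" using grid_floor_le[OF T t0] by (simp add: r)
    have "grid_floor S (?r $ i) \<le> s"
      unfolding s_def using grid_floor_in[OF S r0] grid_floor_le[OF S r0] rt by (intro grid_floor_ge[OF S t0]) auto
    then have "\<not> s \<le> ?r $ i"
      using grid_floor_ge[OF S r0 s(1)] ne by (auto simp: s_def)
    then have "s \<notin> T" using grid_floor_ge[OF T t0 _ s(2)] by (auto simp: r)
    then have sD: "s \<in> S - D" using s(1) D by blast
    then obtain u where u: "u \<in> T" "s < u" "u < s + \<epsilon> (i, s)" using q by blast
    have "t $ i < u" using grid_floor_ge[OF T t0 u(1)] \<open>\<not> s \<le> ?r $ i\<close> u(2) r by force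
    then have "t \<in> slab i s (\<epsilon> (i, s))" using s(2) u(3) by (simp add: slab_def)
    then show False using t sD by force
  qed
  then have "grid_floor_vec S ?r = grid_floor_vec S t" by (simp add: vec_eq_iff grid_floor_vec_def[of S])
  then show ?thesis
    using True grid_floor_vec_in(2)[OF T True]
    by (simp add: cadlag_apply_simps cadlag_apply_grid_step[OF T] cadlag_apply_grid_step[OF S])
qed (simp add: cadlag_apply_outside)

text \<open>For a step function, the grids eventually contain every jump in D and a point closely to
  the right of every other jump. The projection error then lives on thin slabs at hyperplanes
  without mass, where \<xi> is small. Density of the step functions and contractivity of the
  projections extend this to every f, with the same grids.\<close>

lemma functional_grid_proj_tendsto:
  fixes \<xi> :: "'n::finite cadlag \<Rightarrow>\<^sub>L real"
  shows "\<exists>T. (\<forall>n::nat. grid (T n)) \<and>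
    (\<forall>f. (\<lambda>n. blinfun_apply \<xi> (grid_proj (T n) f)) \<longlonglongrightarrow> blinfun_apply \<xi> f)"
proof -
  \<comment> \<open>The rationals provide grid points arbitrarily close on the right of a jump
    outside D; as 1 is in D, such a jump lies below 1. Jumps at atoms are in D and so eventually
    cause no error. All directions i are united because every coordinate is rounded to the same
    grid.\<close>
  define D where "D = {0, 1} \<union> (\<rat> \<inter> {0..1}) \<union> ((\<Union>i. {s. atom \<xi> i s}) \<inter> {0..1})"
  have D: "countable D" "D \<noteq> {}"
    unfolding D_def by (auto intro!: countable_Un countable_Int1 countable_rat countable_atoms)
  define T where "T = (\<lambda>n. {0, 1} \<union> from_nat_into D ` {..n})"
  have from_D: "from_nat_into D k \<in> {0..1}" for k
    using from_nat_into[OF D(2), of k] by (auto simp: D_def)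
  have T: "grid (T n)" for n
    using from_D by (auto simp: T_def grid_def)
  have ev: "\<forall>\<^sub>F n in sequentially. r \<in> T n" if r: "r \<in> D" for r
  proof -
    obtain k where "from_nat_into D k = r" using from_nat_into_surj[OF D(1) r] by blast
    then show ?thesis by (auto simp: T_def eventually_sequentially intro!: exI[of _ k])
  qed
  have step: "(\<lambda>n. blinfun_apply \<xi> (grid_proj (T n) (grid_step S \<phi>))) \<longlonglongrightarrow> blinfun_apply \<xi> (grid_step S \<phi>)"
    if S: "grid S" for S and \<phi> :: "real ^ 'n \<Rightarrow> real"
  proof (rule LIMSEQ_I)
    fix e :: real
    assume e: "e > 0"
    define g where "g = (grid_step S \<phi> :: 'n cadlag)"
    define h where "h = (\<lambda>n. g - grid_proj (T n) g)"
    \<comment> \<open>The summand 1 permits division by K even if g = 0.\<close>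
    define K where "K = 2 * norm g + 1"
    have K: "K > 0" unfolding K_def using norm_ge_zero[of g] by linarith
    have hK: "norm (h n) \<le> K" for n
      using norm_triangle_ineq4[of g "grid_proj (T n) g"] norm_grid_proj_le[OF T, of n g]
      by (simp add: h_def K_def)
    define P where "P = (UNIV :: 'n set) \<times> (S - D)"
    have P: "finite P" using S by (auto simp: P_def grid_def)
    \<comment> \<open>The error will be at most \<open>card P * \<delta> * K\<close>, which is below
      e / 2; adding 1 to the cardinality covers an empty P.\<close>
    define \<delta> where "\<delta> = e / (2 * K * (real (card P) + 1))"
    have \<delta>: "\<delta> > 0" using e K by (simp add: \<delta>_def)
    have "\<exists>\<epsilon>>0. charge_le \<xi> (slab (fst p) (snd p) \<epsilon>) \<delta>" if "p \<in> P" for p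
    proof -
      have "snd p \<in> S - D" using that by (auto simp: P_def)
      then have "snd p \<in> {0..1} - D" using S by (auto simp: grid_def)
      then have "\<not> atom \<xi> (fst p) (snd p)" by (auto simp: D_def)
      then show ?thesis using \<delta> by (auto simp: atom_def)
    qed
    then obtain \<epsilon> where \<epsilon>: "\<And>p. p \<in> P \<Longrightarrow> \<epsilon> p > 0 \<and> charge_le \<xi> (slab (fst p) (snd p) (\<epsilon> p)) \<delta>" by metis
    have P01: "snd p \<in> {0..1}" "snd p < 1" if "p \<in> P" for p
    proof -
      have "snd p \<in> S" "snd p \<notin> D" using that by (auto simp: P_def)
      then show "snd p \<in> {0..1}" using S by (auto simp: grid_def)
      moreover have "snd p \<noteq> 1" using \<open>snd p \<notin> D\<close> by (auto simp: D_def)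
      ultimately show "snd p < 1" by simp
    qed
    have "\<exists>q\<in>D. snd p < q \<and> q < snd p + \<epsilon> p" if p: "p \<in> P" for p
    proof -
      have "snd p < min 1 (snd p + \<epsilon> p)" using P01[OF p] \<epsilon>[OF p] by simp
      then obtain q where "q \<in> \<rat>" "snd p < q" "q < min 1 (snd p + \<epsilon> p)" using Rats_dense_in_real by blast
      then show ?thesis using P01[OF p] by (intro bexI[of _ q]) (auto simp: D_def)
    qed
    then obtain q where q: "\<And>p. p \<in> P \<Longrightarrow> q p \<in> D \<and> snd p < q p \<and> q p < snd p + \<epsilon> p" by metis
    have "\<forall>\<^sub>F n in sequentially. \<forall>r\<in>q ` P \<union> (S \<inter> D). r \<in> T n"
      using P S q by (intro eventually_ball_finite ballI ev) (auto simp: grid_def)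
    then obtain N where N: "\<And>n. n \<ge> N \<Longrightarrow> q ` P \<union> (S \<inter> D) \<subseteq> T n"
      unfolding eventually_sequentially by blast
    have charge: "charge_le \<xi> (\<Union>p\<in>P. slab (fst p) (snd p) (\<epsilon> p)) (real (card P) * \<delta>)"
      using \<epsilon> P01 by (intro charge_le_finite_slabs P) auto
    show "\<exists>N. \<forall>n\<ge>N. norm (blinfun_apply \<xi> (grid_proj (T n) (grid_step S \<phi>)) - blinfun_apply \<xi> (grid_step S \<phi>)) < e"
    proof (intro exI allI impI)
      fix n
      assume n: "n \<ge> N"
      have supp: "cadlag_apply (h n) t = 0" if "t \<notin> (\<Union>p\<in>P. slab (fst p) (snd p) (\<epsilon> p))" for t
        unfolding h_def g_def
      proof (rule grid_proj_error_support[OF T S])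
        show "S \<inter> D \<subseteq> T n" using N[OF n] by blast
        show "t \<notin> (\<Union>p\<in>UNIV \<times> (S - D). slab (fst p) (snd p) (\<epsilon> p))" using that by (simp add: P_def)
        show "\<exists>q\<in>T n. r < q \<and> q < r + \<epsilon> (i, r)" if "r \<in> S - D" for i r
        proof -
          have p: "(i, r) \<in> P" using that by (simp add: P_def)
          then have "q (i, r) \<in> T n" using N[OF n] by blast
          then show ?thesis using q[OF p] by auto
        qed
      qed
      \<comment> \<open>\<open>charge_le\<close> is a one-sided bound for functions of norm at most
        1, hence the sign \<sigma> and the scaling by K.\<close>
      have "\<sigma> * blinfun_apply \<xi> (h n) / K \<le> real (card P) * \<delta>" if \<sigma>: "\<bar>\<sigma>\<bar> = 1" for \<sigma>
      proof -
        have "norm ((\<sigma> / K) *\<^sub>R h n) \<le> 1" using hK[of n] K \<sigma> by simp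
        moreover have "\<forall>t. t \<notin> (\<Union>p\<in>P. slab (fst p) (snd p) (\<epsilon> p)) \<longrightarrow> cadlag_apply ((\<sigma> / K) *\<^sub>R h n) t = 0"
          using supp unfolding cadlag_apply_simps by simp
        ultimately have "blinfun_apply \<xi> ((\<sigma> / K) *\<^sub>R h n) \<le> real (card P) * \<delta>"
          using charge unfolding charge_le_def by blast
        then show ?thesis by (simp add: blinfun.scaleR_right)
      qed
      from this[of 1] this[of "-1"] have "\<bar>blinfun_apply \<xi> (h n)\<bar> \<le> real (card P) * \<delta> * K"
        using K by (simp add: field_simps abs_le_iff)
      also have "\<dots> < e"
      proof -
        have "real (card P) * \<delta> * K = e * (real (card P) / (2 * (real (card P) + 1)))"
          using K by (simp add: \<delta>_def)
        also have "\<dots> < e * 1" using e by (intro mult_strict_left_mono) auto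
        finally show ?thesis by simp
      qed
      finally show "norm (blinfun_apply \<xi> (grid_proj (T n) (grid_step S \<phi>)) - blinfun_apply \<xi> (grid_step S \<phi>)) < e"
        by (simp add: h_def g_def blinfun.diff_right abs_minus_commute)
    qed
  qed
  have "(\<lambda>n. blinfun_apply \<xi> (grid_proj (T n) f)) \<longlonglongrightarrow> blinfun_apply \<xi> f" for f
  proof (rule LIMSEQ_I)
    fix e :: real
    assume e: "e > 0"
    define e' where "e' = e / (4 * (norm \<xi> + 1))"
    have n1: "norm \<xi> + 1 > 0" using norm_ge_zero[of \<xi>] by linarith
    have e': "e' > 0" using e n1 by (simp add: e'_def)
    obtain S where S: "grid S" "norm (f - grid_proj S f) \<le> e'" using grid_proj_dense[OF e'] by blast
    let ?g = "grid_proj S f"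
    have small: "\<bar>blinfun_apply \<xi> x\<bar> \<le> e / 4" if "norm x \<le> e'" for x
    proof -
      have "\<bar>blinfun_apply \<xi> x\<bar> \<le> norm \<xi> * norm x" using norm_blinfun[of \<xi> x] by simp
      also have "\<dots> \<le> (norm \<xi> + 1) * e'" using that e' by (intro mult_mono) auto
      also have "\<dots> = e / 4" using n1 by (simp add: e'_def divide_simps)
      finally show ?thesis .
    qed
    obtain N where N: "\<And>n. n \<ge> N \<Longrightarrow> \<bar>blinfun_apply \<xi> (grid_proj (T n) ?g) - blinfun_apply \<xi> ?g\<bar> < e / 4"
      using LIMSEQ_D[OF step[OF S(1)], of "e / 4"] e by fastforce
    show "\<exists>N. \<forall>n\<ge>N. norm (blinfun_apply \<xi> (grid_proj (T n) f) - blinfun_apply \<xi> f) < e"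
    proof (intro exI allI impI)
      fix n
      assume n: "n \<ge> N"
      have "\<bar>blinfun_apply \<xi> (grid_proj (T n) (f - ?g))\<bar> \<le> e / 4"
        using norm_grid_proj_le[OF T, of n "f - ?g"] S(2) by (intro small) simp
      moreover have "\<bar>blinfun_apply \<xi> (f - ?g)\<bar> \<le> e / 4" using S(2) by (rule small)
      ultimately show "norm (blinfun_apply \<xi> (grid_proj (T n) f) - blinfun_apply \<xi> f) < e"
        using N[OF n] e unfolding grid_proj_diff[OF T] blinfun.diff_right real_norm_def by linarith
    qed
  qed
  then show ?thesis using T by blast
qed

text \<open>The weights are the values of \<xi> on the indicators of the grid cells. Testing \<xi>
  on the step function of their signs bounds the sum of their absolute values, a discrete total
  variation.\<close>

lemma functional_eq_limit_of_quadratures: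
  fixes \<xi> :: "'n::finite cadlag \<Rightarrow>\<^sub>L real"
  obtains R :: "nat \<Rightarrow> (real ^ 'n) set" and w where "\<And>n. finite (R n)" "\<And>n. R n \<subseteq> unit_cube"
    "\<And>n. (\<Sum>r\<in>R n. \<bar>w n r\<bar>) \<le> norm \<xi>"
    "\<And>f. (\<lambda>n. \<Sum>r\<in>R n. w n r * cadlag_apply f r) \<longlonglongrightarrow> blinfun_apply \<xi> f"
proof -
  obtain T where T: "\<And>n::nat. grid (T n)"
    and lim: "\<And>f. (\<lambda>n. blinfun_apply \<xi> (grid_proj (T n) f)) \<longlonglongrightarrow> blinfun_apply \<xi> f"
    using functional_grid_proj_tendsto[of \<xi>] by blast
  define w where "w = (\<lambda>n r. blinfun_apply \<xi> (grid_step (T n) (indicat_real {r})))"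
  have eq: "blinfun_apply \<xi> (grid_step (T n) \<phi>) = (\<Sum>r\<in>grid_points (T n). w n r * \<phi> r)" for n \<phi>
    unfolding w_def
    by (subst grid_step_eq_sum[OF T]) (simp add: blinfun.sum_right blinfun.scaleR_right mult.commute)
  have "(\<Sum>r\<in>grid_points (T n). \<bar>w n r\<bar>) \<le> norm \<xi>" for n
  proof -
    have "(\<Sum>r\<in>grid_points (T n). \<bar>w n r\<bar>) = blinfun_apply \<xi> (grid_step (T n) (\<lambda>r. sgn (w n r)))"
      unfolding eq by (intro sum.cong) (simp_all add: abs_sgn)
    also have "\<dots> \<le> norm \<xi> * norm (grid_step (T n) (\<lambda>r. sgn (w n r)) :: 'n cadlag)"
      using norm_blinfun[of \<xi> "grid_step (T n) (\<lambda>r. sgn (w n r))"] by simp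
    also have "\<dots> \<le> norm \<xi> * 1"
      by (intro mult_left_mono norm_grid_step_le[OF T]) (auto simp: abs_sgn_eq)
    finally show ?thesis by simp
  qed
  moreover have "(\<lambda>n. \<Sum>r\<in>grid_points (T n). w n r * cadlag_apply f r) \<longlonglongrightarrow> blinfun_apply \<xi> f" for f
    using lim[of f] by (simp add: eq)
  ultimately show ?thesis
    using finite_grid_points[OF T] grid_points_subset[OF T] by (intro that[of "\<lambda>n. grid_points (T n)" w])
qed


section \<open>Dunford and Pettis integrals in $D([0,1]^n)$\<close>

text \<open>Outside the cube this is the zero functional, because elements of the type vanish there;
  so t can range over the whole space.\<close>

lift_definition eval_functional :: "real ^ 'n \<Rightarrow> 'n::finite cadlag \<Rightarrow>\<^sub>L real"
  is "\<lambda>t f. cadlag_apply f t"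
proof (rule bounded_linear_intro)
  fix t :: "real ^ 'n" and f g :: "'n cadlag" and c :: real
  show "cadlag_apply (f + g) t = cadlag_apply f t + cadlag_apply g t"
    and "cadlag_apply (c *\<^sub>R f) t = c *\<^sub>R cadlag_apply f t"
    by (simp_all add: cadlag_apply_simps)
  show "norm (cadlag_apply f t) \<le> norm f * 1" using cadlag_apply_le_norm by simp
qed

lemma norm_eval_functional_le: "norm (eval_functional t) \<le> 1"
  by (rule norm_blinfun_bound) (simp_all add: eval_functional.rep_eq cadlag_apply_le_norm)

lemma quadrature_measurable:
  assumes "finite R" "R \<subseteq> unit_cube"
    and "\<And>t. t \<in> unit_cube \<Longrightarrow> (\<lambda>\<omega>. cadlag_apply (G \<omega>) t) \<in> borel_measurable M"
  shows "(\<lambda>\<omega>. \<Sum>r\<in>R. w r * cadlag_apply (G \<omega>) r) \<in> borel_measurable M"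
  using assms by (intro borel_measurable_sum borel_measurable_times borel_measurable_const) auto

text \<open>Necessity is the category bound \<open>dunford_integrable_bound\<close>, applied to
  evaluations, which have norm at most 1. For sufficiency the quadratures do two things: as a
  sequence they make \<xi>(G) measurable, and their weights, of total mass at most
  \<open>norm \<xi>\<close>, bound the integral through Fatou.\<close>

lemma dunford_integrable_cadlag_iff:
  fixes G :: "'w \<Rightarrow> 'n::finite cadlag"
  assumes meas: "\<And>t. t \<in> unit_cube \<Longrightarrow> (\<lambda>\<omega>. cadlag_apply (G \<omega>) t) \<in> borel_measurable M"
  shows "dunford_integrable M G \<longleftrightarrow>
    (SUP t\<in>unit_cube. \<integral>\<^sup>+\<omega>. ennreal \<bar>cadlag_apply (G \<omega>) t\<bar> \<partial>M) < \<infinity>"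
    (is "_ \<longleftrightarrow> ?S < \<infinity>")
proof
  assume D: "dunford_integrable M G"
  obtain K where K: "\<And>\<xi> :: 'n cadlag \<Rightarrow>\<^sub>L real. (LINT \<omega>|M. \<bar>blinfun_apply \<xi> (G \<omega>)\<bar>) \<le> K * norm \<xi>"
    using dunford_integrable_bound[OF D] by blast
  have "?S \<le> ennreal \<bar>K\<bar>"
  proof (rule SUP_least)
    fix t :: "real ^ 'n"
    have "integrable M (\<lambda>\<omega>. blinfun_apply (eval_functional t) (G \<omega>))"
      using D by (simp add: dunford_integrable_def)
    then have "(\<integral>\<^sup>+\<omega>. ennreal \<bar>cadlag_apply (G \<omega>) t\<bar> \<partial>M) = ennreal (LINT \<omega>|M. \<bar>cadlag_apply (G \<omega>) t\<bar>)"
      by (intro nn_integral_eq_integral) (auto simp: eval_functional.rep_eq)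
    also have "\<dots> \<le> ennreal \<bar>K\<bar>"
    proof (rule ennreal_leI)
      have "(LINT \<omega>|M. \<bar>cadlag_apply (G \<omega>) t\<bar>) \<le> K * norm (eval_functional t)"
        using K[of "eval_functional t"] by (simp add: eval_functional.rep_eq)
      also have "\<dots> \<le> \<bar>K\<bar> * 1"
        using norm_eval_functional_le[of t] by (intro mult_mono) auto
      finally show "(LINT \<omega>|M. \<bar>cadlag_apply (G \<omega>) t\<bar>) \<le> \<bar>K\<bar>" by simp
    qed
    finally show "(\<integral>\<^sup>+\<omega>. ennreal \<bar>cadlag_apply (G \<omega>) t\<bar> \<partial>M) \<le> ennreal \<bar>K\<bar>" .
  qed
  then show "?S < \<infinity>" using ennreal_less_top le_less_trans by fastforce
next
  assume S: "?S < \<infinity>"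
  show "dunford_integrable M G"
    unfolding dunford_integrable_def
  proof
    fix \<xi> :: "'n cadlag \<Rightarrow>\<^sub>L real"
    obtain R :: "nat \<Rightarrow> (real ^ 'n) set" and w where R: "\<And>n. finite (R n)" "\<And>n. R n \<subseteq> unit_cube"
      and w: "\<And>n. (\<Sum>r\<in>R n. \<bar>w n r\<bar>) \<le> norm \<xi>"
      and lim: "\<And>f. (\<lambda>n. \<Sum>r\<in>R n. w n r * cadlag_apply f r) \<longlonglongrightarrow> blinfun_apply \<xi> f"
      by (rule functional_eq_limit_of_quadratures[of \<xi>]) blast
    have meas_q: "(\<lambda>\<omega>. \<Sum>r\<in>R n. w n r * cadlag_apply (G \<omega>) r) \<in> borel_measurable M" for n
      by (rule quadrature_measurable[OF R meas])
    have m: "(\<lambda>\<omega>. blinfun_apply \<xi> (G \<omega>)) \<in> borel_measurable M"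
      by (rule borel_measurable_LIMSEQ_real[OF lim meas_q])
    have "(\<integral>\<^sup>+\<omega>. ennreal \<bar>\<Sum>r\<in>R n. w n r * cadlag_apply (G \<omega>) r\<bar> \<partial>M) \<le> ennreal (norm \<xi>) * ?S" for n
    proof -
      have "(\<integral>\<^sup>+\<omega>. ennreal \<bar>\<Sum>r\<in>R n. w n r * cadlag_apply (G \<omega>) r\<bar> \<partial>M) \<le>
          (\<integral>\<^sup>+\<omega>. ennreal (\<Sum>r\<in>R n. \<bar>w n r\<bar> * \<bar>cadlag_apply (G \<omega>) r\<bar>) \<partial>M)"
        by (intro nn_integral_mono ennreal_leI order_trans[OF sum_abs]) (simp add: abs_mult)
      also have "\<dots> \<le> ennreal (norm \<xi>) * ?S"
        by (intro nn_integral_weighted_sum_le R w SUP_upper)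
          (auto intro!: borel_measurable_abs meas subsetD[OF R(2)])
      finally show ?thesis .
    qed
    then have "(\<integral>\<^sup>+\<omega>. ennreal \<bar>blinfun_apply \<xi> (G \<omega>)\<bar> \<partial>M) \<le> ennreal (norm \<xi>) * ?S"
      using meas_q by (intro nn_integral_pointwise_limit_le[OF _ tendsto_rabs[OF lim]]) auto
    also have "\<dots> < \<infinity>" using S by (simp add: ennreal_mult_less_top)
    finally show "integrable M (\<lambda>\<omega>. blinfun_apply \<xi> (G \<omega>))"
      using m by (intro integrableI_bounded) auto
  qed
qed

lemma uniformly_integrable_imp_SUP_finite:
  assumes "prob_space M" and "uniformly_integrable M I Y"
  shows "(SUP i\<in>I. \<integral>\<^sup>+\<omega>. ennreal \<bar>Y i \<omega>\<bar> \<partial>M) < \<infinity>"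
proof -
  interpret prob_space M by fact
  obtain c where c: "c \<ge> 0" "\<And>i. i \<in> I \<Longrightarrow> (\<integral>\<^sup>+\<omega>. ennreal (excess c (Y i \<omega>)) \<partial>M) \<le> ennreal 1"
    and meas: "\<And>i. i \<in> I \<Longrightarrow> Y i \<in> borel_measurable M"
    using assms(2) unfolding uniformly_integrable_iff_excess by (meson zero_less_one)
  have "(SUP i\<in>I. \<integral>\<^sup>+\<omega>. ennreal \<bar>Y i \<omega>\<bar> \<partial>M) \<le> ennreal (c + 1)"
  proof (rule SUP_least)
    fix i
    assume i: "i \<in> I"
    have "(\<integral>\<^sup>+\<omega>. ennreal \<bar>Y i \<omega>\<bar> \<partial>M) \<le> (\<integral>\<^sup>+\<omega>. ennreal c + ennreal (excess c (Y i \<omega>)) \<partial>M)"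
    proof (rule nn_integral_mono)
      fix \<omega>
      have "ennreal \<bar>Y i \<omega>\<bar> \<le> ennreal (c + excess c (Y i \<omega>))"
        by (rule ennreal_leI) (simp add: excess_def)
      then show "ennreal \<bar>Y i \<omega>\<bar> \<le> ennreal c + ennreal (excess c (Y i \<omega>))"
        using c(1) by (simp add: ennreal_plus)
    qed
    also have "\<dots> = ennreal c + (\<integral>\<^sup>+\<omega>. ennreal (excess c (Y i \<omega>)) \<partial>M)"
      using meas[OF i] by (subst nn_integral_add) (auto simp: emeasure_space_1)
    also have "\<dots> \<le> ennreal (c + 1)"
      using c(2)[OF i] c(1) by (simp add: ennreal_plus add_left_mono)
    finally show "(\<integral>\<^sup>+\<omega>. ennreal \<bar>Y i \<omega>\<bar> \<partial>M) \<le> ennreal (c + 1)" .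
  qed
  then show ?thesis using ennreal_less_top le_less_trans by fastforce
qed

lemma filterlim_orthant:
  assumes "X \<longlonglongrightarrow> t" "\<And>n::nat. X n \<in> Q"
  shows "filterlim X (inf (nhds t) (principal Q)) sequentially"
  using assms by (auto simp: filterlim_inf filterlim_principal)

section \<open>From uniform to Pettis integrability\<close>

lemma uniformly_integrable_imp_cadlag_set_integral:
  fixes G :: "'w \<Rightarrow> 'n::finite cadlag"
  assumes M: "prob_space M" and A: "A \<in> sets M"
    and ui: "uniformly_integrable M unit_cube (\<lambda>t \<omega>. cadlag_apply (G \<omega>) t)"
  shows "\<exists>u. \<forall>t. cadlag_apply u t = (LINT \<omega>:A|M. cadlag_apply (G \<omega>) t)"
proof -
  interpret prob_space M by fact
  have meas: "\<And>t. t \<in> unit_cube \<Longrightarrow> (\<lambda>\<omega>. cadlag_apply (G \<omega>) t) \<in> borel_measurable M"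
    and exc: "\<And>e. e > 0 \<Longrightarrow> \<exists>c\<ge>0. \<forall>t\<in>unit_cube. (\<integral>\<^sup>+\<omega>. ennreal (excess c (cadlag_apply (G \<omega>) t)) \<partial>M) \<le> ennreal e"
    using ui unfolding uniformly_integrable_iff_excess by auto
  let ?u = "\<lambda>t. LINT \<omega>:A|M. cadlag_apply (G \<omega>) t"
  have "is_cadlag ?u"
    unfolding is_cadlag_def
  proof (intro ballI allI impI)
    fix t :: "real ^ 'n" and J :: "'n \<Rightarrow> real set"
    assume t: "t \<in> unit_cube"
      and J: "\<forall>i. J i = {t $ i..1} \<or> (0 < t $ i \<and> J i = {0..<t $ i})"
    define Q where "Q = {s. \<forall>i. s $ i \<in> J i}"
    have Q: "Q \<subseteq> unit_cube"
    proof
      fix s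
      assume "s \<in> Q"
      then have s: "s $ i \<in> J i" for i by (auto simp: Q_def)
      show "s \<in> unit_cube"
        unfolding unit_cube_def mem_Collect_eq
      proof
        fix i
        show "0 \<le> s $ i \<and> s $ i \<le> 1"
          using J[rule_format, of i] s[of i] unit_cubeD[OF t, of i] by auto
      qed
    qed
    have "\<exists>L. (cadlag_apply (G \<omega>) \<longlongrightarrow> L) (inf (nhds t) (principal Q))" for \<omega>
      unfolding Q_def using is_cadlagD[OF cadlag_apply_is_cadlag t] J by blast
    then obtain L where L: "\<And>\<omega>. (cadlag_apply (G \<omega>) \<longlongrightarrow> L \<omega>) (inf (nhds t) (principal Q))" by metis
    have "(?u \<longlongrightarrow> (LINT \<omega>:A|M. L \<omega>)) (inf (nhds t) (principal Q))"
      unfolding tendsto_def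
    proof (intro allI impI)
      fix S
      assume S: "open S" "(LINT \<omega>:A|M. L \<omega>) \<in> S"
      show "\<forall>\<^sub>F s in inf (nhds t) (principal Q). ?u s \<in> S"
      \<comment> \<open>Vitali's theorem concerns sequences; since the space is metric, sequences
        inside the orthant determine the limit.\<close>
      proof (rule sequentially_imp_eventually_nhds_within, intro allI impI)
        fix s
        assume s: "(\<forall>n. s n \<in> Q) \<and> s \<longlonglongrightarrow> t"
        have "(\<lambda>n. ?u (s n)) \<longlonglongrightarrow> (LINT \<omega>:A|M. L \<omega>)"
        proof (rule Vitali_convergence)
          show "(\<lambda>\<omega>. cadlag_apply (G \<omega>) (s n)) \<in> borel_measurable M" for n
            using s Q by (intro meas) auto
          show "(\<lambda>n. cadlag_apply (G \<omega>) (s n)) \<longlonglongrightarrow> L \<omega>" for \<omega>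
            using s by (intro filterlim_compose[OF L filterlim_orthant]) auto
          show "\<exists>c\<ge>0. \<forall>n. (\<integral>\<^sup>+\<omega>. ennreal (excess c (cadlag_apply (G \<omega>) (s n))) \<partial>M) \<le> ennreal e"
            if "e > 0" for e
            using exc[OF that] s Q by blast
        qed (rule A)
        then show "\<forall>\<^sub>F n in sequentially. ?u (s n) \<in> S" using S by (rule topological_tendstoD)
      qed
    qed
    then show "\<exists>L. (?u \<longlongrightarrow> L) (inf (nhds t) (principal {s. \<forall>i. s $ i \<in> J i}))"
      unfolding Q_def by blast
  qed
  then have "cadlag_apply (Cadlag ?u) = ?u"
    by (intro Cadlag_inverse) (simp add: cadlag_apply_outside)
  then have "\<forall>t. cadlag_apply (Cadlag ?u) t = ?u t" by simp
  then show ?thesis by (rule exI)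
qed

text \<open>The function u of the preceding lemma is the integral as far as evaluations can tell,
  hence for every quadrature by linearity. In the limit to \<xi> one side converges because u lies
  in the space, the other by Vitali, as the weights are uniformly bounded in total mass.\<close>

lemma uniformly_integrable_imp_pettis:
  fixes G :: "'w \<Rightarrow> 'n::finite cadlag"
  assumes M: "prob_space M"
    and ui: "uniformly_integrable M unit_cube (\<lambda>t \<omega>. cadlag_apply (G \<omega>) t)"
  shows "pettis_integrable M G"
proof -
  interpret prob_space M by fact
  have meas: "\<And>t. t \<in> unit_cube \<Longrightarrow> (\<lambda>\<omega>. cadlag_apply (G \<omega>) t) \<in> borel_measurable M"
    and exc: "\<And>e. e > 0 \<Longrightarrow> \<exists>c\<ge>0. \<forall>t\<in>unit_cube. (\<integral>\<^sup>+\<omega>. ennreal (excess c (cadlag_apply (G \<omega>) t)) \<partial>M) \<le> ennreal e"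
    using ui unfolding uniformly_integrable_iff_excess by auto
  have D: "dunford_integrable M G"
    using uniformly_integrable_imp_SUP_finite[OF M ui]
      dunford_integrable_cadlag_iff[where G = G and M = M] meas by blast
  have int_eval: "integrable M (\<lambda>\<omega>. cadlag_apply (G \<omega>) t)" for t
    using D[unfolded dunford_integrable_def, rule_format, of "eval_functional t"]
    by (simp add: eval_functional.rep_eq)
  have "dunford_integral M A G \<in> range bidual_embedding" if A: "A \<in> sets M" for A
  proof -
    obtain u where u: "\<And>t. cadlag_apply u t = (LINT \<omega>:A|M. cadlag_apply (G \<omega>) t)"
      using uniformly_integrable_imp_cadlag_set_integral[OF M A ui] by blast
    have "is_dunford_integral M A G (bidual_embedding u)"
      unfolding is_dunford_integral_def bidual_embedding.rep_eq
    proof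
      fix \<xi> :: "'n cadlag \<Rightarrow>\<^sub>L real"
      obtain R :: "nat \<Rightarrow> (real ^ 'n) set" and w where R: "\<And>n. finite (R n)" "\<And>n. R n \<subseteq> unit_cube"
        and w: "\<And>n. (\<Sum>r\<in>R n. \<bar>w n r\<bar>) \<le> norm \<xi>"
        and lim: "\<And>f. (\<lambda>n. \<Sum>r\<in>R n. w n r * cadlag_apply f r) \<longlonglongrightarrow> blinfun_apply \<xi> f"
        by (rule functional_eq_limit_of_quadratures[of \<xi>]) blast
      \<comment> \<open>The bound is enlarged by 1 because it becomes a divisor and \<xi> may be
        0.\<close>
      have W: "norm \<xi> + 1 > 0" using norm_ge_zero[of \<xi>] by linarith
      have w': "(\<Sum>r\<in>R n. \<bar>w n r\<bar>) \<le> norm \<xi> + 1" for n using w[of n] by simp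
      have "(\<Sum>r\<in>R n. w n r * cadlag_apply u r) = (LINT \<omega>:A|M. \<Sum>r\<in>R n. w n r * cadlag_apply (G \<omega>) r)" for n
      proof -
        have "integrable M (\<lambda>\<omega>. indicat_real A \<omega> * cadlag_apply (G \<omega>) r)" for r
          using integrable_mult_indicator[OF A int_eval] by simp
        then have "(\<Sum>r\<in>R n. w n r * cadlag_apply u r) =
            (LINT \<omega>|M. (\<Sum>r\<in>R n. w n r * (indicat_real A \<omega> * cadlag_apply (G \<omega>) r)))"
          by (simp add: u set_lebesgue_integral_def)
        also have "\<dots> = (LINT \<omega>:A|M. \<Sum>r\<in>R n. w n r * cadlag_apply (G \<omega>) r)"
          unfolding set_lebesgue_integral_def
          by (intro Bochner_Integration.integral_cong) (simp_all add: sum_distrib_left mult.left_commute)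
        finally show ?thesis .
      qed
      moreover have "(\<lambda>n. LINT \<omega>:A|M. \<Sum>r\<in>R n. w n r * cadlag_apply (G \<omega>) r) \<longlonglongrightarrow>
          (LINT \<omega>:A|M. blinfun_apply \<xi> (G \<omega>))"
      proof (rule Vitali_convergence[OF _ lim _ A])
        show "(\<lambda>\<omega>. \<Sum>r\<in>R n. w n r * cadlag_apply (G \<omega>) r) \<in> borel_measurable M" for n
          by (rule quadrature_measurable[OF R meas])
        fix e :: real
        assume e: "e > 0"
        then have "e / (norm \<xi> + 1) > 0" using W by simp
        from exc[OF this] obtain c where c: "c \<ge> 0"
          "\<And>t. t \<in> unit_cube \<Longrightarrow> (\<integral>\<^sup>+\<omega>. ennreal (excess c (cadlag_apply (G \<omega>) t)) \<partial>M) \<le> ennreal (e / (norm \<xi> + 1))"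
          by blast
        have "(\<integral>\<^sup>+\<omega>. ennreal (excess ((norm \<xi> + 1) * c) (\<Sum>r\<in>R n. w n r * cadlag_apply (G \<omega>) r)) \<partial>M) \<le> ennreal e" for n
        proof -
          have "(\<integral>\<^sup>+\<omega>. ennreal (excess ((norm \<xi> + 1) * c) (\<Sum>r\<in>R n. w n r * cadlag_apply (G \<omega>) r)) \<partial>M) \<le>
              (\<integral>\<^sup>+\<omega>. ennreal (\<Sum>r\<in>R n. \<bar>w n r\<bar> * excess c (cadlag_apply (G \<omega>) r)) \<partial>M)"
            by (intro nn_integral_mono ennreal_leI excess_weighted_sum R w' c)
          also have "\<dots> \<le> ennreal (norm \<xi> + 1) * ennreal (e / (norm \<xi> + 1))"
            using R(2) by (intro nn_integral_weighted_sum_le R w' c) (auto intro!: measurable_compose[OF meas])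
          also have "\<dots> = ennreal ((norm \<xi> + 1) * (e / (norm \<xi> + 1)))"
            using W e by (intro ennreal_mult[symmetric]) auto
          also have "\<dots> = ennreal e" using W by simp
          finally show ?thesis .
        qed
        then show "\<exists>d\<ge>0. \<forall>n. (\<integral>\<^sup>+\<omega>. ennreal (excess d (\<Sum>r\<in>R n. w n r * cadlag_apply (G \<omega>) r)) \<partial>M) \<le> ennreal e"
          using W c(1) by (intro exI[of _ "(norm \<xi> + 1) * c"]) simp
      qed
      ultimately show "blinfun_apply \<xi> u = (LINT \<omega>:A|M. blinfun_apply \<xi> (G \<omega>))"
        using lim[of u] by (simp add: LIMSEQ_unique)
    qed
    then show ?thesis
      using is_dunford_integral_unique[OF dunford_integral[OF D A]] by blast
  qed
  then show ?thesis using D unfolding pettis_integrable_def by blast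
qed

section \<open>From Pettis to uniform integrability\<close>

text \<open>This is sequential compactness of the split cube. Along a subsequence converging to l,
  one of the finitely many sets of coordinates lying strictly below l recurs infinitely often, and
  there the points stay in one orthant at l. The choice does not depend on f.\<close>

lemma unit_cube_sequence_cadlag_convergent:
  fixes t :: "nat \<Rightarrow> real ^ 'n::finite"
  assumes t: "\<And>n. t n \<in> unit_cube"
  shows "\<exists>\<sigma>. strict_mono \<sigma> \<and> (\<forall>f :: 'n cadlag. convergent (\<lambda>n. cadlag_apply f (t (\<sigma> n))))"
proof -
  obtain l r where l: "l \<in> unit_cube" "strict_mono r" "(t \<circ> r) \<longlonglongrightarrow> l"
    using compact_unit_cube t unfolding compact_def by metis
  define S where "S = (\<lambda>n. {i. t (r n) $ i < l $ i})"
  obtain n0 where "infinite {n \<in> UNIV. S n = S n0}"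
    using pigeonhole_infinite[of "UNIV :: nat set" S] by auto
  then have inf: "infinite {n. S n = S n0}" by simp
  define \<rho> where "\<rho> = enumerate {n. S n = S n0}"
  have \<rho>: "strict_mono \<rho>" unfolding \<rho>_def by (rule strict_mono_enumerate[OF inf])
  have S\<rho>: "S (\<rho> n) = S n0" for n using enumerate_in_set[OF inf, of n] by (simp add: \<rho>_def)
  define \<sigma> where "\<sigma> = r \<circ> \<rho>"
  define J where "J = (\<lambda>i. if i \<in> S n0 then {0..<l $ i} else {l $ i..1})"
  have S\<sigma>: "i \<in> S n0 \<longleftrightarrow> t (\<sigma> n) $ i < l $ i" for n i
    unfolding S\<rho>[of n, symmetric] by (simp add: S_def \<sigma>_def)
  have "t (\<sigma> n) $ i \<in> J i" for n i
    using S\<sigma>[of i n] unit_cubeD[OF t[of "\<sigma> n"], of i] by (auto simp: J_def not_less)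
  then have "t (\<sigma> n) \<in> {s. \<forall>i. s $ i \<in> J i}" for n by simp
  moreover have "(\<lambda>n. t (\<sigma> n)) \<longlonglongrightarrow> l"
    using LIMSEQ_subseq_LIMSEQ[OF l(3) \<rho>] by (simp add: \<sigma>_def o_def)
  ultimately have filt: "filterlim (\<lambda>n. t (\<sigma> n)) (inf (nhds l) (principal {s. \<forall>i. s $ i \<in> J i})) sequentially"
    by (intro filterlim_orthant)
  \<comment> \<open>A left side is chosen only where a point of the cube has a coordinate below l_i,
    so l_i > 0 as admissibility requires.\<close>
  have J: "J i = {l $ i..1} \<or> (0 < l $ i \<and> J i = {0..<l $ i})" for i
    using unit_cubeD(1)[OF t[of "r n0"], of i] by (auto simp: J_def S_def)
  have "convergent (\<lambda>n. cadlag_apply f (t (\<sigma> n)))" for f :: "'n cadlag"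
  proof -
    obtain L where "(cadlag_apply f \<longlongrightarrow> L) (inf (nhds l) (principal {s. \<forall>i. s $ i \<in> J i}))"
      using is_cadlagD[OF cadlag_apply_is_cadlag l(1), of J f] J by blast
    from filterlim_compose[OF this filt] show ?thesis by (rule convergentI)
  qed
  moreover have "strict_mono \<sigma>" unfolding \<sigma>_def using l(2) \<rho> by (rule strict_mono_o)
  ultimately show ?thesis by blast
qed

text \<open>For the sequences of the preceding lemma this is a limit within an orthant at a point of
  the cube, in general not an evaluation. It inherits its bound from the evaluations.\<close>

lemma limit_functional:
  fixes t :: "nat \<Rightarrow> real ^ 'n::finite"
  assumes conv: "\<And>f :: 'n cadlag. convergent (\<lambda>n. cadlag_apply f (t n))"
  shows "\<exists>\<xi>. \<forall>f :: 'n cadlag. (\<lambda>n. cadlag_apply f (t n)) \<longlonglongrightarrow> blinfun_apply \<xi> f"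
proof -
  define \<phi> where "\<phi> = (\<lambda>f :: 'n cadlag. lim (\<lambda>n. cadlag_apply f (t n)))"
  have \<phi>: "(\<lambda>n. cadlag_apply f (t n)) \<longlonglongrightarrow> \<phi> f" for f
    using conv[of f] by (simp add: \<phi>_def convergent_LIMSEQ_iff)
  have "bounded_linear \<phi>"
  proof (rule bounded_linear_intro)
    fix f g :: "'n cadlag" and c :: real
    show "\<phi> (f + g) = \<phi> f + \<phi> g"
      using tendsto_add[OF \<phi>[of f] \<phi>[of g]] \<phi>[of "f + g"]
      by (simp add: cadlag_apply_simps LIMSEQ_unique)
    show "\<phi> (c *\<^sub>R f) = c *\<^sub>R \<phi> f"
      using tendsto_mult_left[OF \<phi>[of f], of c] \<phi>[of "c *\<^sub>R f"]
      by (simp add: cadlag_apply_simps LIMSEQ_unique)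
    show "norm (\<phi> f) \<le> norm f * 1"
      by (rule tendsto_upperbound[OF tendsto_norm[OF \<phi>]]) (simp_all add: cadlag_apply_le_norm)
  qed
  then show ?thesis
    using \<phi> by (intro exI[of _ "Blinfun \<phi>"]) (simp add: bounded_linear_Blinfun_apply)
qed

lemma excess_le_diff: "excess c y \<le> \<bar>y - z\<bar> + excess c z"
  by (auto simp: excess_def)

text \<open>The integral over A is an element x of the space, so the evaluations converge on x just
  as on each G \<omega>. The set integrals of \<open>Z j\<close> therefore vanish in the limit, and
  \<open>Z j\<close> tends to 0 in L^1. Up to this error the excess of the evaluations is that of
  the one integrable function \<xi>(G), which tends to 0 as the threshold grows.\<close>

lemma pettis_imp_uniformly_integrable:
  fixes G :: "'w \<Rightarrow> 'n::finite cadlag"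
  assumes M: "prob_space M" and P: "pettis_integrable M G"
  shows "uniformly_integrable M unit_cube (\<lambda>t \<omega>. cadlag_apply (G \<omega>) t)"
proof (rule ccontr)
  interpret prob_space M by fact
  have D: "dunford_integrable M G" using P by (simp add: pettis_integrable_def)
  have int: "integrable M (\<lambda>\<omega>. blinfun_apply \<xi> (G \<omega>))" for \<xi> :: "'n cadlag \<Rightarrow>\<^sub>L real"
    using D by (simp add: dunford_integrable_def)
  have int_eval: "integrable M (\<lambda>\<omega>. cadlag_apply (G \<omega>) t)" for t
    using int[of "eval_functional t"] by (simp add: eval_functional.rep_eq)
  assume "\<not> ?thesis"
  then obtain e where e: "e > 0" and bad: "\<And>c. c \<ge> 0 \<Longrightarrow>
      \<exists>t\<in>unit_cube. \<not> (\<integral>\<^sup>+\<omega>. ennreal (excess c (cadlag_apply (G \<omega>) t)) \<partial>M) \<le> ennreal e"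
    unfolding uniformly_integrable_iff_excess using int_eval by auto
  \<comment> \<open>The n-th point violates the bound at threshold n, so that the thresholds grow
    along every subsequence.\<close>
  have "\<exists>t\<in>unit_cube. \<not> (\<integral>\<^sup>+\<omega>. ennreal (excess (real n) (cadlag_apply (G \<omega>) t)) \<partial>M) \<le> ennreal e" for n :: nat
    by (rule bad) simp
  then obtain t where t: "\<And>n. t n \<in> unit_cube"
    and bad_t: "\<And>n::nat. \<not> (\<integral>\<^sup>+\<omega>. ennreal (excess (real n) (cadlag_apply (G \<omega>) (t n))) \<partial>M) \<le> ennreal e"
    by metis
  obtain \<sigma> where \<sigma>: "strict_mono \<sigma>" "\<And>f :: 'n cadlag. convergent (\<lambda>n. cadlag_apply f (t (\<sigma> n)))"
    using unit_cube_sequence_cadlag_convergent[of t] t by blast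
  obtain \<xi> where \<xi>: "\<And>f :: 'n cadlag. (\<lambda>n. cadlag_apply f (t (\<sigma> n))) \<longlonglongrightarrow> blinfun_apply \<xi> f"
    using limit_functional[of "\<lambda>n. t (\<sigma> n)"] \<sigma>(2) by blast
  define Z where "Z = (\<lambda>j \<omega>. cadlag_apply (G \<omega>) (t (\<sigma> j)) - blinfun_apply \<xi> (G \<omega>))"
  have Z: "integrable M (Z j)" for j
    unfolding Z_def by (intro Bochner_Integration.integrable_diff int int_eval)
  have L1: "(\<lambda>j. LINT \<omega>|M. \<bar>Z j \<omega>\<bar>) \<longlonglongrightarrow> 0"
  proof (rule L1_limit_if_set_integrals_limit[OF Z])
    show "(\<lambda>j. Z j \<omega>) \<longlonglongrightarrow> 0" for \<omega>
      unfolding Z_def using LIM_zero[OF \<xi>[of "G \<omega>"]] .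
    fix A
    assume A: "A \<in> sets M"
    then obtain x where x: "dunford_integral M A G = bidual_embedding x"
      using P unfolding pettis_integrable_def by blast
    have x': "blinfun_apply \<eta> x = (LINT \<omega>:A|M. blinfun_apply \<eta> (G \<omega>))"
      for \<eta> :: "'n cadlag \<Rightarrow>\<^sub>L real"
      using dunford_integral[OF D A] by (simp add: is_dunford_integral_def x bidual_embedding.rep_eq)
    have "(LINT \<omega>:A|M. Z j \<omega>) = cadlag_apply x (t (\<sigma> j)) - blinfun_apply \<xi> x" for j
    proof -
      have "(LINT \<omega>:A|M. Z j \<omega>) = (LINT \<omega>:A|M. cadlag_apply (G \<omega>) (t (\<sigma> j))) - (LINT \<omega>:A|M. blinfun_apply \<xi> (G \<omega>))"
        unfolding Z_def set_lebesgue_integral_def scaleR_diff_right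
        by (intro Bochner_Integration.integral_diff integrable_mult_indicator A int int_eval)
      then show ?thesis using x'[of \<xi>] x'[of "eval_functional (t (\<sigma> j))"] by (simp add: eval_functional.rep_eq)
    qed
    then show "(\<lambda>j. LINT \<omega>:A|M. Z j \<omega>) \<longlonglongrightarrow> 0" using LIM_zero[OF \<xi>[of x]] by simp
  qed
  have int_exc: "integrable M (\<lambda>\<omega>. excess c (Y \<omega>))" if "integrable M Y" "c \<ge> 0" for Y c
    by (rule Bochner_Integration.integrable_bound[OF that(1)])
      (use that in \<open>auto simp: excess_def\<close>)
  have "(\<lambda>n. LINT \<omega>|M. excess (real n) (blinfun_apply \<xi> (G \<omega>))) \<longlonglongrightarrow> (LINT \<omega>|M. 0)"
  proof (rule integral_dominated_convergence[where w = "\<lambda>\<omega>. \<bar>blinfun_apply \<xi> (G \<omega>)\<bar>"])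
    show "AE \<omega> in M. (\<lambda>n. excess (real n) (blinfun_apply \<xi> (G \<omega>))) \<longlonglongrightarrow> 0"
    proof (rule AE_I2, rule tendsto_eventually)
      fix \<omega>
      show "\<forall>\<^sub>F n in sequentially. excess (real n) (blinfun_apply \<xi> (G \<omega>)) = 0"
        using eventually_ge_at_top[of "nat \<lceil>\<bar>blinfun_apply \<xi> (G \<omega>)\<bar>\<rceil>"]
        by eventually_elim (auto simp: excess_def nat_ceiling_le_eq)
    qed
  qed (use int[of \<xi>] in \<open>auto simp: excess_def\<close>)
  from LIMSEQ_subseq_LIMSEQ[OF this \<sigma>(1)]
  have lim: "(\<lambda>j. (LINT \<omega>|M. \<bar>Z j \<omega>\<bar>) + (LINT \<omega>|M. excess (real (\<sigma> j)) (blinfun_apply \<xi> (G \<omega>)))) \<longlonglongrightarrow> 0 + 0"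
    using L1 by (intro tendsto_add) (auto simp: o_def)
  have ge: "e \<le> (LINT \<omega>|M. \<bar>Z j \<omega>\<bar>) + (LINT \<omega>|M. excess (real (\<sigma> j)) (blinfun_apply \<xi> (G \<omega>)))" for j
  proof -
    have "e \<le> (LINT \<omega>|M. excess (real (\<sigma> j)) (cadlag_apply (G \<omega>) (t (\<sigma> j))))"
      using bad_t[of "\<sigma> j"] e nn_integral_eq_integral[OF int_exc[OF int_eval, of "real (\<sigma> j)" "t (\<sigma> j)"]]
      by (simp add: not_le ennreal_less_iff)
    also have "\<dots> \<le> (LINT \<omega>|M. \<bar>Z j \<omega>\<bar> + excess (real (\<sigma> j)) (blinfun_apply \<xi> (G \<omega>)))"
      using Z[of j] int_exc[OF int_eval, of "real (\<sigma> j)" "t (\<sigma> j)"] int_exc[OF int, of "real (\<sigma> j)" \<xi>]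
      by (intro integral_mono) (auto simp: Z_def excess_le_diff)
    also have "\<dots> = (LINT \<omega>|M. \<bar>Z j \<omega>\<bar>) + (LINT \<omega>|M. excess (real (\<sigma> j)) (blinfun_apply \<xi> (G \<omega>)))"
      using Z[of j] int_exc[OF int, of "real (\<sigma> j)" \<xi>] by (intro Bochner_Integration.integral_add) auto
    finally show ?thesis .
  qed
  have "e \<le> 0 + 0"
    by (rule tendsto_lowerbound[OF lim always_eventually[OF allI[OF ge]] sequentially_bot])
  then show False using e by simp
qed

lemma pettis_integrable_cadlag_iff:
  fixes G :: "'w \<Rightarrow> 'n::finite cadlag"
  assumes "prob_space M"
  shows "pettis_integrable M G \<longleftrightarrow> uniformly_integrable M unit_cube (\<lambda>t \<omega>. cadlag_apply (G \<omega>) t)"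
  using uniformly_integrable_imp_pettis pettis_imp_uniformly_integrable assms by blast


section \<open>The injective tensor power as a space of cadlag functions\<close>

definition block :: "real ^ ('m::finite \<times> 'l::finite) \<Rightarrow> 'l \<Rightarrow> real ^ 'm" where
  "block t j = (\<chi> i. t $ (i, j))"

definition join_blocks :: "('l::finite \<Rightarrow> real ^ 'm::finite) \<Rightarrow> real ^ ('m \<times> 'l)" where
  "join_blocks \<tau> = (\<chi> p. \<tau> (snd p) $ fst p)"

lemma block_join_blocks [simp]: "block (join_blocks \<tau>) j = \<tau> j"
  by (simp add: block_def join_blocks_def vec_eq_iff)

lemma unit_cube_iff_blocks: "t \<in> unit_cube \<longleftrightarrow> (\<forall>j. block t j \<in> unit_cube)"
  by (auto simp: unit_cube_def block_def)

lemma is_cadlag_block: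
  fixes t :: "real ^ ('m::finite \<times> 'l::finite)" and f :: "'m cadlag"
  assumes t: "t \<in> unit_cube"
    and J: "\<forall>p. J p = {t $ p..1} \<or> (0 < t $ p \<and> J p = {0..<t $ p})"
  shows "\<exists>L. ((\<lambda>s. cadlag_apply f (block s j)) \<longlongrightarrow> L) (inf (nhds t) (principal {s. \<forall>p. s $ p \<in> J p}))"
proof -
  have tj: "block t j \<in> unit_cube" using t unit_cube_iff_blocks[of t] by blast
  have "J (i, j) = {block t j $ i..1} \<or> (0 < block t j $ i \<and> J (i, j) = {0..<block t j $ i})" for i
    using J by (auto simp: block_def)
  then obtain L where
    L: "(cadlag_apply f \<longlongrightarrow> L) (inf (nhds (block t j)) (principal {s. \<forall>i. s $ i \<in> J (i, j)}))"
    using is_cadlagD[OF cadlag_apply_is_cadlag tj, of "\<lambda>i. J (i, j)" f] by blast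
  have "((\<lambda>s. block s j) \<longlongrightarrow> block t j) (nhds t)"
    unfolding block_def by (intro tendsto_vec_lambda tendsto_vec_nth filterlim_ident)
  then have "filterlim (\<lambda>s. block s j) (inf (nhds (block t j)) (principal {s. \<forall>i. s $ i \<in> J (i, j)}))
      (inf (nhds t) (principal {s. \<forall>p. s $ p \<in> J p}))"
    unfolding filterlim_inf
    by (auto simp: filterlim_principal eventually_inf_principal block_def intro: tendsto_mono[OF inf_le1])
  from filterlim_compose[OF L this] show ?thesis by blast
qed

definition tensor_fun :: "('m::finite cadlag, 'l::finite) inj_tensor \<Rightarrow> real ^ ('m \<times> 'l) \<Rightarrow> real" where
  "tensor_fun u t = mform_apply (form_of_tensor u) (\<lambda>j. eval_functional (block t j))"

lemma tensor_fun_simps: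
  "tensor_fun (u + v) t = tensor_fun u t + tensor_fun v t"
  "tensor_fun (u - v) t = tensor_fun u t - tensor_fun v t"
  "tensor_fun (c *\<^sub>R u) t = c * tensor_fun u t"
  "tensor_fun 0 t = 0"
  by (simp_all add: tensor_fun_def plus_inj_tensor.rep_eq minus_inj_tensor.rep_eq
      scaleR_inj_tensor.rep_eq zero_inj_tensor.rep_eq mform_apply_simps)

lemma tensor_fun_elem_tensor:
  "tensor_fun (elem_tensor x) t = (\<Prod>j\<in>UNIV. cadlag_apply (x j) (block t j))"
  by (simp add: tensor_fun_def elem_tensor.rep_eq elem_tensor_form.rep_eq eval_functional.rep_eq)

lemma abs_tensor_fun_le: "\<bar>tensor_fun u t\<bar> \<le> norm u"
  unfolding tensor_fun_def norm_inj_tensor_def by (intro norm_mform_ge norm_eval_functional_le)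

lemma tensor_fun_elem_tensor_cadlag:
  fixes x :: "'l::finite \<Rightarrow> 'm::finite cadlag"
  shows "\<exists>f. cadlag_apply f = tensor_fun (elem_tensor x)"
proof -
  have "is_cadlag (tensor_fun (elem_tensor x))"
    unfolding is_cadlag_def
  proof (intro ballI allI impI)
    fix t :: "real ^ ('m \<times> 'l)" and J :: "'m \<times> 'l \<Rightarrow> real set"
    assume tJ: "t \<in> unit_cube" "\<forall>i. J i = {t $ i..1} \<or> (0 < t $ i \<and> J i = {0..<t $ i})"
    have "\<exists>L. ((\<lambda>s. cadlag_apply (x j) (block s j)) \<longlongrightarrow> L) (inf (nhds t) (principal {s. \<forall>p. s $ p \<in> J p}))" for j
      by (rule is_cadlag_block[OF tJ])
    then have "\<exists>L. \<forall>j. ((\<lambda>s. cadlag_apply (x j) (block s j)) \<longlongrightarrow> L j)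
        (inf (nhds t) (principal {s. \<forall>p. s $ p \<in> J p}))"
      by (intro choice allI)
    then obtain L where L: "\<And>j. ((\<lambda>s. cadlag_apply (x j) (block s j)) \<longlongrightarrow> L j)
        (inf (nhds t) (principal {s. \<forall>p. s $ p \<in> J p}))" by blast
    show "\<exists>L. (tensor_fun (elem_tensor x) \<longlongrightarrow> L) (inf (nhds t) (principal {s. \<forall>i. s $ i \<in> J i}))"
      unfolding tensor_fun_elem_tensor[abs_def] by (rule exI[of _ "\<Prod>j\<in>UNIV. L j"], rule tendsto_prod, rule L)
  qed
  moreover have "tensor_fun (elem_tensor x) t = 0" if t: "t \<notin> unit_cube" for t
  proof -
    obtain j where "block t j \<notin> unit_cube" using t unit_cube_iff_blocks[of t] by blast
    then show ?thesis unfolding tensor_fun_elem_tensor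
      by (intro prod_zero bexI[of _ j]) (simp_all add: cadlag_apply_outside)
  qed
  ultimately show ?thesis
    by (intro exI[of _ "Cadlag (tensor_fun (elem_tensor x))"] Cadlag_inverse) auto
qed

lemma inj_tensor_eq_limit:
  fixes u :: "('b::real_normed_vector, 'l::finite) inj_tensor"
  obtains V where "\<And>n. V n \<in> span (range elem_tensor)" "V \<longlonglongrightarrow> u"
proof -
  have "u \<in> closure (span (range elem_tensor))" by (simp add: closure_span_elem_tensor)
  then show ?thesis using that unfolding closure_sequential by blast
qed

text \<open>The injective norm dominates the supremum norm of \<open>tensor_fun\<close>, so
  approximation from the span is uniform and the limit stays in the space by completeness.\<close>

lemma tensor_fun_cadlag:
  fixes u :: "('m::finite cadlag, 'l::finite) inj_tensor"
  shows "\<exists>f. cadlag_apply f = tensor_fun u"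
proof -
  have span: "\<exists>f. cadlag_apply f = tensor_fun v" if "v \<in> span (range elem_tensor)"
    for v :: "('m cadlag, 'l) inj_tensor"
    using that
  proof (induction rule: span_induct_alt)
    case base
    then show ?case by (intro exI[of _ 0] ext) (simp add: cadlag_apply_simps tensor_fun_simps)
  next
    case (step c x y)
    then obtain f g where "cadlag_apply f = tensor_fun x" "cadlag_apply g = tensor_fun y"
      using tensor_fun_elem_tensor_cadlag by blast
    then show ?case
      by (intro exI[of _ "c *\<^sub>R f + g"] ext) (simp add: cadlag_apply_simps tensor_fun_simps)
  qed
  obtain V where V: "\<And>n. V n \<in> span (range elem_tensor)" "V \<longlonglongrightarrow> u"
    using inj_tensor_eq_limit[of u] by blast
  obtain f where f: "\<And>n. cadlag_apply (f n) = tensor_fun (V n)" using span[OF V(1)] by metis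
  have "dist (f m) (f n) \<le> dist (V m) (V n)" for m n
    unfolding dist_norm
    by (rule norm_cadlag_leI) (metis abs_tensor_fun_le cadlag_apply_simps(5) f tensor_fun_simps(2))
  then have "Cauchy f"
    using LIMSEQ_imp_Cauchy[OF V(2)] unfolding Cauchy_def by (meson le_less_trans)
  then obtain g where g: "f \<longlonglongrightarrow> g" using Cauchy_convergent convergent_def by blast
  have "cadlag_apply g t = tensor_fun u t" for t
  proof (rule LIMSEQ_unique)
    show "(\<lambda>n. cadlag_apply (f n) t) \<longlonglongrightarrow> cadlag_apply g t"
      using bounded_linear.tendsto[OF blinfun.bounded_linear_right g, of "eval_functional t"]
      by (simp add: eval_functional.rep_eq)
    show "(\<lambda>n. cadlag_apply (f n) t) \<longlonglongrightarrow> tensor_fun u t"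
    proof (rule metric_LIMSEQ_I)
      fix e :: real
      assume "e > 0"
      then obtain N where "\<And>n. n \<ge> N \<Longrightarrow> dist (V n) u < e" using metric_LIMSEQ_D[OF V(2)] by blast
      moreover have "dist (cadlag_apply (f n) t) (tensor_fun u t) \<le> dist (V n) u" for n
        using abs_tensor_fun_le[of "V n - u" t] by (simp add: f dist_norm tensor_fun_simps)
      ultimately show "\<exists>N. \<forall>n\<ge>N. dist (cadlag_apply (f n) t) (tensor_fun u t) < e"
        by (meson le_less_trans)
    qed
  qed
  then show ?thesis by blast
qed

definition tensor_cadlag :: "('m::finite cadlag, 'l::finite) inj_tensor \<Rightarrow> ('m \<times> 'l) cadlag" where
  "tensor_cadlag u = Cadlag (tensor_fun u)"

lemma cadlag_apply_tensor_cadlag: "cadlag_apply (tensor_cadlag u) t = tensor_fun u t"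
proof -
  obtain f where "cadlag_apply f = tensor_fun u" using tensor_fun_cadlag by blast
  then show ?thesis unfolding tensor_cadlag_def by (metis cadlag_apply_inverse)
qed

lemma tensor_cadlag_simps:
  "tensor_cadlag (u + v) = tensor_cadlag u + tensor_cadlag v"
  "tensor_cadlag (u - v) = tensor_cadlag u - tensor_cadlag v"
  "tensor_cadlag (c *\<^sub>R u) = c *\<^sub>R tensor_cadlag u"
  by (auto intro!: cadlag_eqI simp: cadlag_apply_tensor_cadlag cadlag_apply_simps tensor_fun_simps)

lemma norm_tensor_cadlag_le: "norm (tensor_cadlag u) \<le> norm u"
  by (rule norm_cadlag_leI) (simp add: cadlag_apply_tensor_cadlag abs_tensor_fun_le)

lemma bounded_linear_tensor_cadlag: "bounded_linear tensor_cadlag"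
  by (rule bounded_linear_intro[of _ 1]) (simp_all add: tensor_cadlag_simps norm_tensor_cadlag_le)

section \<open>Isometry onto the function space\<close>

text \<open>With all arguments but one fixed, a general form on the dual gives only an element of
  the bidual. For u in the span it is a vector b, whose norm evaluations compute. The norm estimate
  is therefore proved on the span and then passed to the closure.\<close>

lemma span_elem_tensor_partial_apply:
  fixes u :: "('b::real_normed_vector, 'l::finite) inj_tensor"
  assumes "u \<in> span (range elem_tensor)"
  shows "\<exists>b. \<forall>\<eta>. mform_apply (form_of_tensor u) (\<xi>(j := \<eta>)) = blinfun_apply \<eta> b"
  using assms
proof (induction rule: span_induct_alt)
  case base
  then show ?case by (intro exI[of _ 0]) (simp add: zero_inj_tensor.rep_eq mform_apply_simps)
next
  case (step c u v)
  then obtain x where x: "u = elem_tensor x" by blast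
  have *: "mform_apply (form_of_tensor u) (\<xi>(j := \<eta>)) =
      blinfun_apply \<eta> ((\<Prod>i\<in>UNIV - {j}. blinfun_apply (\<xi> i) (x i)) *\<^sub>R x j)" for \<eta>
    by (simp add: x elem_tensor.rep_eq elem_tensor_form.rep_eq prod.remove[of UNIV j] blinfun.scaleR_right)
  obtain b where b: "\<And>\<eta>. mform_apply (form_of_tensor v) (\<xi>(j := \<eta>)) = blinfun_apply \<eta> b"
    using step by blast
  show ?case
    by (intro exI[of _ "c *\<^sub>R ((\<Prod>i\<in>UNIV - {j}. blinfun_apply (\<xi> i) (x i)) *\<^sub>R x j) + b"] allI)
      (simp only: plus_inj_tensor.rep_eq scaleR_inj_tensor.rep_eq mform_apply_simps
        blinfun.add_right blinfun.scaleR_right real_scaleR_def * b)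
qed

text \<open>
  The arguments of the form are replaced one at a time by evaluations, which attain the norm of the
  vector produced by the preceding lemma.
\<close>

lemma norm_span_le_tensor_cadlag:
  fixes u :: "('m::finite cadlag, 'l::finite) inj_tensor"
  assumes u: "u \<in> span (range elem_tensor)"
  shows "norm u \<le> norm (tensor_cadlag u)"
proof -
  let ?\<phi> = "mform_apply (form_of_tensor u)"
  have "\<bar>?\<phi> \<xi>\<bar> \<le> norm (tensor_cadlag u)"
    if "finite S" "\<And>j. norm (\<xi> j) \<le> 1" "\<And>j. j \<notin> S \<Longrightarrow> \<xi> j \<in> range eval_functional"
    for S :: "'l set" and \<xi> :: "'l \<Rightarrow> 'm cadlag \<Rightarrow>\<^sub>L real"
    using that
  proof (induction S arbitrary: \<xi> rule: finite_induct)
    case empty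
    then have "\<exists>\<tau>. \<forall>j. \<xi> j = eval_functional (\<tau> j)" by (intro choice) auto
    then obtain \<tau> where "\<xi> = (\<lambda>j. eval_functional (\<tau> j))" by blast
    then have "?\<phi> \<xi> = tensor_fun u (join_blocks \<tau>)" by (simp add: tensor_fun_def)
    then show ?case using cadlag_apply_le_norm[of "tensor_cadlag u"] by (simp add: cadlag_apply_tensor_cadlag)
  next
    case (insert j S)
    obtain b where b: "\<And>\<eta>. ?\<phi> (\<xi>(j := \<eta>)) = blinfun_apply \<eta> b"
      using span_elem_tensor_partial_apply[OF u] by blast
    have "norm b \<le> norm (tensor_cadlag u)"
    proof (rule norm_cadlag_leI)
      fix t :: "real ^ 'm"
      have "\<bar>?\<phi> (\<xi>(j := eval_functional t))\<bar> \<le> norm (tensor_cadlag u)"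
        using insert.prems by (intro insert.IH) (auto simp: norm_eval_functional_le)
      then show "\<bar>cadlag_apply b t\<bar> \<le> norm (tensor_cadlag u)" by (simp add: b eval_functional.rep_eq)
    qed
    moreover have "\<bar>?\<phi> \<xi>\<bar> \<le> norm (\<xi> j) * norm b"
      using b[of "\<xi> j"] norm_blinfun[of "\<xi> j" b] by simp
    moreover have "norm (\<xi> j) * norm b \<le> 1 * norm b"
      using insert.prems(1) by (intro mult_right_mono) auto
    ultimately show ?case by simp
  qed
  from this[of UNIV] show ?thesis
    unfolding norm_inj_tensor_def by (intro norm_mform_leI) auto
qed

lemma norm_tensor_cadlag: "norm (tensor_cadlag u) = norm u"
proof -
  obtain V where V: "\<And>n. V n \<in> span (range elem_tensor)" "V \<longlonglongrightarrow> u"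
    using inj_tensor_eq_limit[of u] by blast
  have "(\<lambda>n. tensor_cadlag (V n)) \<longlonglongrightarrow> tensor_cadlag u"
    by (rule bounded_linear.tendsto[OF bounded_linear_tensor_cadlag V(2)])
  then have "norm u \<le> norm (tensor_cadlag u)"
    using norm_span_le_tensor_cadlag[OF V(1)]
    by (intro LIMSEQ_le[OF tendsto_norm[OF V(2)] tendsto_norm]) auto
  then show ?thesis using norm_tensor_cadlag_le[of u] by simp
qed

lemma block_grid_floor_vec: "block (grid_floor_vec T t) j = grid_floor_vec T (block t j)"
  by (simp add: block_def grid_floor_vec_def vec_eq_iff)

text \<open>A cell is the product of the cells of its blocks, since one grid T serves all
  coordinates; its indicator is thus an elementary tensor.\<close>

lemma tensor_cadlag_grid_step:
  fixes r :: "real ^ ('m::finite \<times> 'l::finite)"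
  assumes T: "grid T"
  shows "tensor_cadlag (elem_tensor (\<lambda>j. grid_step T (indicat_real {block r j}))) = grid_step T (indicat_real {r})"
proof (rule cadlag_eqI)
  fix t :: "real ^ ('m \<times> 'l)"
  assume t: "t \<in> unit_cube"
  have "x = r \<longleftrightarrow> (\<forall>j. block x j = block r j)" for x :: "real ^ ('m \<times> 'l)"
    by (auto simp: block_def vec_eq_iff)
  then have "(\<Prod>j\<in>UNIV. indicat_real {block r j} (block x j)) = indicat_real {r} x" for x :: "real ^ ('m \<times> 'l)"
    by (auto simp: indicator_def)
  moreover have "block t j \<in> unit_cube" for j using t unit_cube_iff_blocks[of t] by blast
  ultimately show "cadlag_apply (tensor_cadlag (elem_tensor (\<lambda>j. grid_step T (indicat_real {block r j})))) t =
      cadlag_apply (grid_step T (indicat_real {r})) t"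
    using t by (simp add: cadlag_apply_tensor_cadlag tensor_fun_elem_tensor cadlag_apply_grid_step[OF T]
        flip: block_grid_floor_vec)
qed

text \<open>The image contains all projections of f to grids, which approximate f; being the
  isometric image of a complete space, it contains the limit as well.\<close>

lemma surj_tensor_cadlag: "surj (tensor_cadlag :: ('m::finite cadlag, 'l::finite) inj_tensor \<Rightarrow> _)"
proof -
  interpret J: bounded_linear "tensor_cadlag :: ('m cadlag, 'l) inj_tensor \<Rightarrow> _"
    by (rule bounded_linear_tensor_cadlag)
  have "\<exists>u. f = tensor_cadlag u" for f :: "('m \<times> 'l) cadlag"
  proof -
    have "\<exists>u. dist (tensor_cadlag u) f \<le> inverse (Suc n)" for n
    proof -
      obtain T where T: "grid T" "norm (f - grid_proj T f) \<le> inverse (Suc n)"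
        using grid_proj_dense[of "inverse (Suc n)" f] by auto
      have eq: "grid_proj T f = tensor_cadlag (\<Sum>r\<in>grid_points T. cadlag_apply f r *\<^sub>R
          elem_tensor (\<lambda>j. grid_step T (indicat_real {block r j})))"
        by (subst grid_step_eq_sum[OF T(1)]) (simp add: J.sum J.scaleR tensor_cadlag_grid_step[OF T(1)])
      have "dist (grid_proj T f) f \<le> inverse (Suc n)"
        using T(2) by (simp add: dist_norm norm_minus_commute)
      then show ?thesis unfolding eq by blast
    qed
    then obtain U where U: "\<And>n. dist (tensor_cadlag (U n)) f \<le> inverse (Suc n)" by metis
    have lim: "(\<lambda>n. tensor_cadlag (U n)) \<longlonglongrightarrow> f"
      using U by (subst tendsto_dist_iff, intro tendsto_sandwich[OF _ _ tendsto_const LIMSEQ_inverse_real_of_nat]) auto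
    have "dist (tensor_cadlag u) (tensor_cadlag v) = dist u v" for u v :: "('m cadlag, 'l) inj_tensor"
      by (simp add: dist_norm norm_tensor_cadlag flip: J.diff)
    then have "Cauchy U" using LIMSEQ_imp_Cauchy[OF lim] by (simp add: Cauchy_def)
    then obtain u where "U \<longlonglongrightarrow> u" using Cauchy_convergent convergent_def by blast
    from J.tendsto[OF this] have "f = tensor_cadlag u" using lim by (rule LIMSEQ_unique[rotated])
    then show ?thesis by blast
  qed
  then show ?thesis by blast
qed

section \<open>Transfer of integrability along the isometry\<close>

lemma bounded_linear_inv_isometry:
  fixes L :: "'a::real_normed_vector \<Rightarrow> 'b::real_normed_vector"
  assumes L: "bounded_linear L" and norm: "\<And>x. norm (L x) = norm x" and surj: "surj L"
  shows "bounded_linear (inv L)" "inv L (L x) = x"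
proof -
  interpret bounded_linear L by fact
  have "inj L"
  proof (rule injI)
    fix x y
    assume "L x = L y"
    then have "norm (L (x - y)) = 0" by (simp add: diff)
    then show "x = y" unfolding norm by simp
  qed
  then show *: "inv L (L x) = x" for x by simp
  have L_inv: "L (inv L y) = y" for y using surj by (simp add: surj_f_inv_f)
  show "bounded_linear (inv L)"
  proof (rule bounded_linear_intro[of _ 1])
    show "inv L (x + y) = inv L x + inv L y" for x y
      using *[of "inv L x + inv L y"] by (simp add: add L_inv)
    show "inv L (c *\<^sub>R x) = c *\<^sub>R inv L x" for c x
      using *[of "c *\<^sub>R inv L x"] by (simp add: scaleR L_inv)
    show "norm (inv L x) \<le> norm x * 1" for x
      using norm[of "inv L x"] by (simp add: L_inv)
  qed
qed

lemma dunford_integrable_bounded_linear: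
  fixes L :: "'a::banach \<Rightarrow> 'b::banach"
  assumes L: "bounded_linear L" and F: "dunford_integrable M F"
  shows "dunford_integrable M (\<lambda>\<omega>. L (F \<omega>))"
  unfolding dunford_integrable_def
proof
  fix \<xi> :: "'b \<Rightarrow>\<^sub>L real"
  show "integrable M (\<lambda>\<omega>. blinfun_apply \<xi> (L (F \<omega>)))"
    using F[unfolded dunford_integrable_def, rule_format, of "\<xi> o\<^sub>L Blinfun L"]
    by (simp add: blinfun_compose.rep_eq bounded_linear_Blinfun_apply[OF L])
qed

lemma pettis_integrable_bounded_linear:
  fixes L :: "'a::banach \<Rightarrow> 'b::banach"
  assumes L: "bounded_linear L" and F: "pettis_integrable M F"
  shows "pettis_integrable M (\<lambda>\<omega>. L (F \<omega>))"
proof -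
  have D: "dunford_integrable M F" using F by (simp add: pettis_integrable_def)
  note DL = dunford_integrable_bounded_linear[OF L D]
  have "dunford_integral M A (\<lambda>\<omega>. L (F \<omega>)) \<in> range bidual_embedding" if A: "A \<in> sets M" for A
  proof -
    obtain x where x: "dunford_integral M A F = bidual_embedding x"
      using F A unfolding pettis_integrable_def by blast
    have "is_dunford_integral M A (\<lambda>\<omega>. L (F \<omega>)) (bidual_embedding (L x))"
      unfolding is_dunford_integral_def bidual_embedding.rep_eq
    proof
      fix \<xi> :: "'b \<Rightarrow>\<^sub>L real"
      show "blinfun_apply \<xi> (L x) = (LINT \<omega>:A|M. blinfun_apply \<xi> (L (F \<omega>)))"
        using dunford_integral[OF D A, unfolded is_dunford_integral_def, rule_format, of "\<xi> o\<^sub>L Blinfun L"]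
        by (simp add: x bidual_embedding.rep_eq blinfun_compose.rep_eq bounded_linear_Blinfun_apply[OF L])
    qed
    then show ?thesis using is_dunford_integral_unique[OF dunford_integral[OF DL A]] by blast
  qed
  then show ?thesis using DL unfolding pettis_integrable_def by blast
qed

lemma integrable_tensor_cadlag_iff:
  fixes F :: "'w \<Rightarrow> ('m::finite cadlag, 'l::finite) inj_tensor"
  shows dunford_integrable_tensor_cadlag_iff:
      "dunford_integrable M (\<lambda>\<omega>. tensor_cadlag (F \<omega>)) \<longleftrightarrow> dunford_integrable M F"
    and pettis_integrable_tensor_cadlag_iff:
      "pettis_integrable M (\<lambda>\<omega>. tensor_cadlag (F \<omega>)) \<longleftrightarrow> pettis_integrable M F"
proof -
  note inv = bounded_linear_inv_isometry[OF bounded_linear_tensor_cadlag norm_tensor_cadlag surj_tensor_cadlag]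
  show "dunford_integrable M (\<lambda>\<omega>. tensor_cadlag (F \<omega>)) \<longleftrightarrow> dunford_integrable M F"
    using dunford_integrable_bounded_linear[OF bounded_linear_tensor_cadlag, of M F]
      dunford_integrable_bounded_linear[OF inv(1), of M "\<lambda>\<omega>. tensor_cadlag (F \<omega>)"]
    unfolding inv(2) by blast
  show "pettis_integrable M (\<lambda>\<omega>. tensor_cadlag (F \<omega>)) \<longleftrightarrow> pettis_integrable M F"
    using pettis_integrable_bounded_linear[OF bounded_linear_tensor_cadlag, of M F]
      pettis_integrable_bounded_linear[OF inv(1), of M "\<lambda>\<omega>. tensor_cadlag (F \<omega>)"]
    unfolding inv(2) by blast
qed

text \<open>The product is at most the power of its largest factor, which is one of the summands. A
  pointwise bound, unlike Hoelder's inequality for the integrals, serves uniform integrability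
  directly. The factor 1 gives it the form of a weighted sum.\<close>

lemma abs_prod_le_sum_power:
  fixes y :: "'l::finite \<Rightarrow> real"
  shows "\<bar>\<Prod>j\<in>UNIV. y j\<bar> \<le> (\<Sum>j\<in>UNIV. 1 * \<bar>y j\<bar> ^ CARD('l))"
proof -
  define m where "m = Max (range (\<lambda>j. \<bar>y j\<bar>))"
  have "m \<in> range (\<lambda>j. \<bar>y j\<bar>)" unfolding m_def by (intro Max_in) auto
  then obtain k where k: "m = \<bar>y k\<bar>" by blast
  have "\<bar>y j\<bar> \<le> m" for j unfolding m_def by (intro Max_ge) auto
  then have "(\<Prod>j\<in>UNIV. \<bar>y j\<bar>) \<le> (\<Prod>j\<in>(UNIV :: 'l set). m)" by (intro prod_mono) auto
  also have "\<dots> = \<bar>y k\<bar> ^ CARD('l)" by (simp add: k)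
  also have "\<dots> \<le> (\<Sum>j\<in>UNIV. \<bar>y j\<bar> ^ CARD('l))" by (rule member_le_sum) auto
  finally show ?thesis by (simp add: abs_prod)
qed

theorem theorem8p5:
  fixes M :: "'w measure" and X :: "'w \<Rightarrow> 'm::finite cadlag"
  assumes "prob_space M"
    and "X \<in> M \<rightarrow>\<^sub>M evaluation_algebra"
  shows "(dunford_integrable M (\<lambda>\<omega>. tensor_power (X \<omega>) :: ('m cadlag, 'l::finite) inj_tensor) \<longleftrightarrow>
            (SUP t\<in>unit_cube. \<integral>\<^sup>+\<omega>. ennreal (\<bar>cadlag_apply (X \<omega>) t\<bar> ^ CARD('l)) \<partial>M) < \<infinity>) \<and>
         (pettis_integrable M (\<lambda>\<omega>. tensor_power (X \<omega>) :: ('m cadlag, 'l) inj_tensor) \<longleftrightarrow>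
            uniformly_integrable M unit_cube (\<lambda>t \<omega>. \<bar>cadlag_apply (X \<omega>) t\<bar> ^ CARD('l)))"
proof -
  define F where "F = (\<lambda>\<omega>. tensor_power (X \<omega>) :: ('m cadlag, 'l) inj_tensor)"
  define G where "G = (\<lambda>\<omega>. tensor_cadlag (F \<omega>))"
  define Y where "Y = (\<lambda>t \<omega>. \<bar>cadlag_apply (X \<omega>) t\<bar> ^ CARD('l))"
  have X: "(\<lambda>\<omega>. cadlag_apply (X \<omega>) t) \<in> borel_measurable M" if "t \<in> unit_cube" for t
    using assms(2) that by (simp add: measurable_evaluation_algebra_iff)
  have Y: "Y t \<in> borel_measurable M" if "t \<in> unit_cube" for t
    unfolding Y_def using X[OF that] by measurable
  have Y0: "0 \<le> Y t \<omega>" for t \<omega> by (simp add: Y_def)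
  have G: "cadlag_apply (G \<omega>) t = (\<Prod>j\<in>UNIV. cadlag_apply (X \<omega>) (block t j))" for \<omega> t
    by (simp add: G_def F_def cadlag_apply_tensor_cadlag tensor_power_def tensor_fun_elem_tensor)
  have G_meas: "(\<lambda>\<omega>. cadlag_apply (G \<omega>) t) \<in> borel_measurable M" if "t \<in> unit_cube" for t
    unfolding G using X that unit_cube_iff_blocks by (intro borel_measurable_prod) blast
  have cube: "block t j \<in> unit_cube" if "t \<in> unit_cube" for t :: "real ^ ('m \<times> 'l)" and j
    using that unit_cube_iff_blocks[of t] by blast
  \<comment> \<open>On the diagonal \<bar>G\<bar> is Y itself, which carries bounds from G to Y;
    \<open>G_le\<close> carries them back at the cost of the factor \<open>CARD('l)\<close>.\<close>
  have diag: "join_blocks (\<lambda>j :: 'l. t) \<in> unit_cube" "\<bar>cadlag_apply (G \<omega>) (join_blocks (\<lambda>j. t))\<bar> = Y t \<omega>"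
    if "t \<in> unit_cube" for t \<omega>
    using that by (simp_all add: unit_cube_iff_blocks[of "join_blocks _"] G Y_def power_abs)
  have G_le: "\<bar>cadlag_apply (G \<omega>) t\<bar> \<le> (\<Sum>j\<in>UNIV. 1 * Y (block t j) \<omega>)" for \<omega> t
    unfolding G Y_def by (rule abs_prod_le_sum_power)
  let ?SY = "SUP t\<in>unit_cube. \<integral>\<^sup>+\<omega>. ennreal (Y t \<omega>) \<partial>M"
  let ?SG = "SUP t\<in>unit_cube. \<integral>\<^sup>+\<omega>. ennreal \<bar>cadlag_apply (G \<omega>) t\<bar> \<partial>M"
  have "?SY \<le> ?SG"
  proof (rule SUP_mono)
    fix t :: "real ^ 'm"
    assume t: "t \<in> unit_cube"
    then show "\<exists>s\<in>unit_cube. (\<integral>\<^sup>+\<omega>. ennreal (Y t \<omega>) \<partial>M) \<le> (\<integral>\<^sup>+\<omega>. ennreal \<bar>cadlag_apply (G \<omega>) s\<bar> \<partial>M)"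
      using diag by (intro bexI[of _ "join_blocks (\<lambda>j. t)"]) simp_all
  qed
  moreover have "?SG \<le> ennreal (real CARD('l)) * ?SY"
  proof (rule SUP_least)
    fix t :: "real ^ ('m \<times> 'l)"
    assume t: "t \<in> unit_cube"
    have "(\<integral>\<^sup>+\<omega>. ennreal \<bar>cadlag_apply (G \<omega>) t\<bar> \<partial>M) \<le> (\<integral>\<^sup>+\<omega>. ennreal (\<Sum>j\<in>(UNIV :: 'l set). \<bar>1\<bar> * Y (block t j) \<omega>) \<partial>M)"
      using G_le by (intro nn_integral_mono ennreal_leI) simp
    also have "\<dots> \<le> ennreal (real CARD('l)) * ?SY"
      by (intro nn_integral_weighted_sum_le SUP_upper cube[OF t] Y) (simp_all add: Y0)
    finally show "(\<integral>\<^sup>+\<omega>. ennreal \<bar>cadlag_apply (G \<omega>) t\<bar> \<partial>M) \<le> ennreal (real CARD('l)) * ?SY" .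
  qed
  moreover have "ennreal (real CARD('l)) * ?SY < \<infinity>" if "?SY < \<infinity>"
    using that by (simp add: ennreal_mult_less_top)
  ultimately have SUP_iff: "?SG < \<infinity> \<longleftrightarrow> ?SY < \<infinity>"
    using le_less_trans by blast
  have UI_iff: "uniformly_integrable M unit_cube (\<lambda>t \<omega>. cadlag_apply (G \<omega>) t) \<longleftrightarrow> uniformly_integrable M unit_cube Y"
  proof
    assume ui: "uniformly_integrable M unit_cube (\<lambda>t \<omega>. cadlag_apply (G \<omega>) t)"
    have "\<exists>c\<ge>0. \<forall>t\<in>unit_cube. (\<integral>\<^sup>+\<omega>. ennreal (excess c (Y t \<omega>)) \<partial>M) \<le> ennreal e" if e: "e > 0" for e
    proof -
      obtain c where c: "c \<ge> 0" "\<And>s. s \<in> unit_cube \<Longrightarrow> (\<integral>\<^sup>+\<omega>. ennreal (excess c (cadlag_apply (G \<omega>) s)) \<partial>M) \<le> ennreal e"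
        using ui e unfolding uniformly_integrable_iff_excess by blast
      have "(\<integral>\<^sup>+\<omega>. ennreal (excess c (Y t \<omega>)) \<partial>M) \<le> ennreal e" if t: "t \<in> unit_cube" for t
        using c(2)[OF diag(1)[OF t]] by (simp add: excess_def diag(2)[OF t, symmetric])
      then show ?thesis using c(1) by blast
    qed
    then show "uniformly_integrable M unit_cube Y"
      unfolding uniformly_integrable_iff_excess using Y by blast
  next
    assume ui: "uniformly_integrable M unit_cube Y"
    have "\<exists>c\<ge>0. \<forall>t\<in>unit_cube. (\<integral>\<^sup>+\<omega>. ennreal (excess c (cadlag_apply (G \<omega>) t)) \<partial>M) \<le> ennreal e" if e: "e > 0" for e
    proof -
      \<comment> \<open>W is the total mass of the unit weights in \<open>G_le\<close>; it
        multiplies both the threshold and the integral of the excess.\<close>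
      define W where "W = real CARD('l)"
      have W: "W > 0" by (simp add: W_def)
      then have "e / W > 0" using e by simp
      then obtain c where c: "c \<ge> 0" "\<And>s. s \<in> unit_cube \<Longrightarrow> (\<integral>\<^sup>+\<omega>. ennreal (excess c (Y s \<omega>)) \<partial>M) \<le> ennreal (e / W)"
        using ui unfolding uniformly_integrable_iff_excess by blast
      have "(\<integral>\<^sup>+\<omega>. ennreal (excess (W * c) (cadlag_apply (G \<omega>) t)) \<partial>M) \<le> ennreal e" if t: "t \<in> unit_cube" for t
      proof -
        have "excess (W * c) (cadlag_apply (G \<omega>) t) \<le> (\<Sum>j\<in>UNIV. \<bar>1\<bar> * excess c (Y (block t j) \<omega>))" for \<omega>
        proof -
          have "excess (W * c) (cadlag_apply (G \<omega>) t) \<le> excess (W * c) (\<Sum>j\<in>UNIV. 1 * Y (block t j) \<omega>)"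
            using G_le by (intro excess_mono_abs) (rule order_trans[OF _ abs_ge_self])
          also have "\<dots> \<le> (\<Sum>j\<in>UNIV. \<bar>1\<bar> * excess c (Y (block t j) \<omega>))"
            by (rule excess_weighted_sum) (simp_all add: W_def c(1))
          finally show ?thesis .
        qed
        then have "(\<integral>\<^sup>+\<omega>. ennreal (excess (W * c) (cadlag_apply (G \<omega>) t)) \<partial>M) \<le>
            (\<integral>\<^sup>+\<omega>. ennreal (\<Sum>j\<in>(UNIV :: 'l set). \<bar>1\<bar> * excess c (Y (block t j) \<omega>)) \<partial>M)"
          by (intro nn_integral_mono ennreal_leI)
        also have "\<dots> \<le> ennreal W * ennreal (e / W)"
          using Y[OF cube[OF t]]
          by (intro nn_integral_weighted_sum_le c(2) cube[OF t]) (auto simp: W_def)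
        also have "\<dots> = ennreal e" using W e by (simp add: ennreal_mult[symmetric])
        finally show ?thesis .
      qed
      then show ?thesis using W c(1) by (intro exI[of _ "W * c"]) simp
    qed
    then show "uniformly_integrable M unit_cube (\<lambda>t \<omega>. cadlag_apply (G \<omega>) t)"
      unfolding uniformly_integrable_iff_excess using G_meas by blast
  qed
  have "dunford_integrable M F \<longleftrightarrow> ?SY < \<infinity>"
    using dunford_integrable_cadlag_iff[where G = G and M = M] G_meas SUP_iff
    unfolding G_def dunford_integrable_tensor_cadlag_iff by blast
  moreover have "pettis_integrable M F \<longleftrightarrow> uniformly_integrable M unit_cube Y"
    using pettis_integrable_cadlag_iff[OF assms(1), of G] UI_iff
    unfolding G_def pettis_integrable_tensor_cadlag_iff by blast
  ultimately show ?thesis unfolding F_def Y_def by blast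
qed

end
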